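(* Let $\boldsymbol{\gamma}=(\gamma_j)_{j\ge1}$ be a sequence of coordinate weights in $(0,1]$. For every $q\in(1,\infty)$, with Hölder conjugate $p$ (i.e. $1/p+1/q=1$), put $$\tau_p:=\frac{2p-(p+1)\big(1+2^{p/(p+1)}-2^{1/(p+1)}\big)}{4p^2+6p+(p+1)\big(1+2^{p/(p+1)}-2^{1/(p+1)}\big)}.$$ Then $\tau_p>0$, and for all $d\in\mathbb{N}$ and $\varepsilon\in(0,1/2)$ we have $$N^{\mathrm{disc}}_{p,\boldsymbol{\gamma}}(\varepsilon,d)\ \ge\ N^{\mathrm{int}}_{q,\boldsymbol{\gamma}}(\varepsilon,d)\ \ge\ (1-2\varepsilon)\prod_{j=1}^d\big(1+\tau_p\gamma_j^{p/2}\big)^{1/q}.$$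
   Context: Notation: $\mathbb{N}=\{1,2,\ldots\}$, $[d]=\{1,\ldots,d\}$, and $\gamma_{\mathfrak{u}}=\prod_{j\in\mathfrak{u}}\gamma_j$ for $\mathfrak{u}\subseteq[d]$. For $\boldsymbol{t}\in[0,1]^d$ write $\boldsymbol{t}_{\mathfrak{u}}=(t_j)_{j\in\mathfrak{u}}$; $(\boldsymbol{t}_{\mathfrak{u}},1)$, respectively $(\boldsymbol{t}_{\mathfrak{u}},0)$, is the $d$-dimensional vector with $j$-th coordinate $t_j$ if $j\in\mathfrak{u}$ and $1$, respectively $0$, if $j\notin\mathfrak{u}$. Discrepancy. For a set $\mathcal{P}=\{\boldsymbol{x}_1,\ldots,\boldsymbol{x}_N\}$ of $N$ points in $[0,1)^d$ let $$\Delta_{\mathcal{P}}(\boldsymbol{t})=\frac{|\{k:\boldsymbol{x}_k\in[0,t_1)\times\cdots\times[0,t_d)\}|}{N}-t_1\cdots t_d,$$ $$L_{p,\boldsymbol{\gamma},N}(\mathcal{P})=\Big(\sum_{\emptyset\ne\mathfrak{u}\subseteq[d]}\gamma_{\mathfrak{u}}^{p/2}\int_{[0,1]^{|\mathfrak{u}|}}|\Delta_{\mathcal{P}}((\boldsymbol{t}_{\mathfrak{u}},1))|^p\,\mathrm{d}\boldsymbol{t}_{\mathfrak{u}}\Big)^{1/p}.$$ Let $\mathrm{disc}_{p,\boldsymbol{\gamma}}(N,d)=\min_{\mathcal{P}}L_{p,\boldsymbol{\gamma},N}(\mathcal{P})$ (minimum understood as an infimum) over all $N$-element point sets in $[0,1)^d$,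 $\mathrm{disc}_{p,\boldsymbol{\gamma}}(0,d)=\prod_{j=1}^d\big(1+\frac{\gamma_j^{p/2}}{p+1}\big)^{1/p}$, and $$N^{\mathrm{disc}}_{p,\boldsymbol{\gamma}}(\varepsilon,d)=\min\{N\in\mathbb{N}:\mathrm{disc}_{p,\boldsymbol{\gamma}}(N,d)\le\varepsilon\,\mathrm{disc}_{p,\boldsymbol{\gamma}}(0,d)\}.$$ Integration. Let $W^1_q([0,1])$ be the space of absolutely continuous functions on $[0,1]$ with derivative in $L_q([0,1])$. $F_{1,\gamma,q}$ is this space with norm $\|f\|_{1,\gamma,q}=\big(|f(0)|^q+\gamma^{-q/2}\int_0^1|f'(t)|^q\,\mathrm{d}t\big)^{1/q}$. $F_{d,\boldsymbol{\gamma},q}=F_{1,\gamma_1,q}\otimes\cdots\otimes F_{1,\gamma_d,q}$ is the Sobolev space $W_q^{(1,\ldots,1)}([0,1]^d)$ of functions with dominating mixed first derivatives in $L_q$ (equivalently, $f(\boldsymbol{x})=\sum_{\mathfrak{u}\subseteq[d]}\int_{\prod_{j\in\mathfrak{u}}[0,x_j]}g_{\mathfrak{u}}(\boldsymbol{t}_{\mathfrak{u}})\,\mathrm{d}\boldsymbol{t}_{\mathfrak{u}}$ with $g_{\mathfrak{u}}=\frac{\partial^{|\mathfrak{u}|}}{\partial\boldsymbol{t}_{\mathfrak{u}}}f((\boldsymbol{t}_{\mathfrak{u}},0))\in L_q([0,1]^{|\mathfrak{u}|})$), with norm $$\|f\|_{d,\boldsymbol{\gamma},q}=\Big(\sum_{\mathfrak{u}\subseteq[d]}\frac{1}{\gamma_{\mathfrak{u}}^{q/2}}\int_{[0,1]^{|\mathfrak{u}|}}\Big|\frac{\partial^{|\mathfrak{u}|}}{\partial\boldsymbol{t}_{\mathfrak{u}}}f((\boldsymbol{t}_{\mathfrak{u}},0))\Big|^q\mathrm{d}\boldsymbol{t}_{\mathfrak{u}}\Big)^{1/q},$$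 where the term for $\mathfrak{u}=\emptyset$ is $|f(\boldsymbol{0})|^q$. Let $I_d(f)=\int_{[0,1]^d}f(\boldsymbol{x})\,\mathrm{d}\boldsymbol{x}$. Consider positive linear rules $A_{d,N}(f)=\sum_{k=1}^N a_kf(\boldsymbol{x}_k)$ with $\boldsymbol{x}_k\in[0,1)^d$ and $a_k\ge0$, with worst-case error $e(F_{d,\boldsymbol{\gamma},q},A_{d,N})=\sup_{\|f\|_{d,\boldsymbol{\gamma},q}\le1}|I_d(f)-A_{d,N}(f)|$. Let $e_{q,\boldsymbol{\gamma}}(N,d)$ be the minimum (understood as an infimum) of $e(F_{d,\boldsymbol{\gamma},q},A_{d,N})$ over all such rules, $e_{q,\boldsymbol{\gamma}}(0,d)=\sup_{\|f\|_{d,\boldsymbol{\gamma},q}\le1}|I_d(f)|$, and $$N^{\mathrm{int}}_{q,\boldsymbol{\gamma}}(\varepsilon,d)=\min\{N\in\mathbb{N}:e_{q,\boldsymbol{\gamma}}(N,d)\le\varepsilon\,e_{q,\boldsymbol{\gamma}}(0,d)\}.$$ *)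

theory Defs
  imports "HOL-Analysis.Analysis"
begin

text \<open>
  A point indexed by a finite set \<open>u\<close> of coordinates is an extensional function in
  \<open>\<Pi>\<^sub>E j\<in>u. _\<close> (value \<open>undefined\<close> outside \<open>u\<close>), and \<open>[d]\<close> is \<open>{1..d}\<close>.  Lebesgue measure on
  \<open>\<real>\<^sup>u\<close> is the completion of the product of \<open>lborel\<close>; for \<open>u = {}\<close> it is the unit mass at the
  unique point, so that integration is evaluation.
\<close>

type_synonym point = "nat \<Rightarrow> real"

definition leb :: "nat set \<Rightarrow> point measure" where
  "leb u = completion (Pi\<^sub>M u (\<lambda>_. lborel))"

definition unit_cube :: "nat set \<Rightarrow> point set" where
  "unit_cube u = (\<Pi>\<^sub>E j\<in>u. {0..1})"

definition half_open_cube :: "nat set \<Rightarrow> point set" where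
  "half_open_cube u = (\<Pi>\<^sub>E j\<in>u. {0..<1})"

text \<open>\<open>extend_by d u c t\<close> is the \<open>d\<close>-dimensional vector \<open>(t\<^sub>u, c)\<close>.\<close>

definition extend_by :: "nat \<Rightarrow> nat set \<Rightarrow> real \<Rightarrow> point \<Rightarrow> point" where
  "extend_by d u c t = (\<lambda>j\<in>{1..d}. if j \<in> u then t j else c)"


subsection \<open>Weighted discrepancy\<close>

definition local_disc :: "nat \<Rightarrow> point set \<Rightarrow> point \<Rightarrow> real" where
  "local_disc d P t =
     real (card {x \<in> P. x \<in> (\<Pi>\<^sub>E j\<in>{1..d}. {0..<t j})}) / real (card P) - (\<Prod>j\<in>{1..d}. t j)"

definition weighted_disc :: "real \<Rightarrow> (nat \<Rightarrow> real) \<Rightarrow> nat \<Rightarrow> point set \<Rightarrow> real" where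
  "weighted_disc p \<gamma> d P =
     (\<Sum>u\<in>Pow {1..d} - {{}}. (\<Prod>j\<in>u. \<gamma> j) powr (p / 2) *
        (LINT t:unit_cube u|leb u. \<bar>local_disc d P (extend_by d u 1 t)\<bar> powr p)) powr (1 / p)"

definition min_disc :: "real \<Rightarrow> (nat \<Rightarrow> real) \<Rightarrow> nat \<Rightarrow> nat \<Rightarrow> real" where
  "min_disc p \<gamma> N d =
     Inf {weighted_disc p \<gamma> d P | P. P \<subseteq> half_open_cube {1..d} \<and> finite P \<and> card P = N}"

definition initial_disc :: "real \<Rightarrow> (nat \<Rightarrow> real) \<Rightarrow> nat \<Rightarrow> real" where
  "initial_disc p \<gamma> d = (\<Prod>j\<in>{1..d}. (1 + \<gamma> j powr (p / 2) / (p + 1)) powr (1 / p))"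

definition N_disc :: "real \<Rightarrow> (nat \<Rightarrow> real) \<Rightarrow> real \<Rightarrow> nat \<Rightarrow> nat" where
  "N_disc p \<gamma> \<epsilon> d = (LEAST N. 1 \<le> N \<and> min_disc p \<gamma> N d \<le> \<epsilon> * initial_disc p \<gamma> d)"


subsection \<open>Sobolev space of dominating mixed smoothness\<close>

definition partial_deriv :: "nat \<Rightarrow> (point \<Rightarrow> real) \<Rightarrow> point \<Rightarrow> real" where
  "partial_deriv j f t = deriv (\<lambda>s. f (t(j := s))) (t j)"

text \<open>
  The mixed derivative in the coordinates \<open>u\<close>, once in each.  The order of differentiation is fixed,
  but for the functions in \<open>sobolev\<close> below it is irrelevant up to null sets: if \<open>f\<close> is a sum of
  integrals of \<open>g\<^sub>v \<in> L\<^sub>1\<close>, as there, then for almost every \<open>t\<^sub>u\<close> all iterated partial derivatives at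
  \<open>(t\<^sub>u, 0)\<close> exist and equal \<open>g\<^sub>u\<close>, in any order.  In particular the arbitrary value of \<open>deriv\<close> at
  points of non-differentiability does not matter.
\<close>

definition mixed_deriv :: "nat set \<Rightarrow> (point \<Rightarrow> real) \<Rightarrow> point \<Rightarrow> real" where
  "mixed_deriv u f = foldr partial_deriv (sorted_list_of_set u) f"

text \<open>The function \<open>t\<^sub>u \<mapsto> \<partial>\<^bsup>|u|\<^esup>f((t\<^sub>u, 0)) / \<partial>t\<^sub>u\<close>; for \<open>u = {}\<close> it is the value \<open>f(0)\<close>.\<close>

definition anchored_deriv :: "nat \<Rightarrow> nat set \<Rightarrow> (point \<Rightarrow> real) \<Rightarrow> point \<Rightarrow> real" where
  "anchored_deriv d u f t = mixed_deriv u f (extend_by d u 0 t)"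

definition in_Lq :: "real \<Rightarrow> nat set \<Rightarrow> (point \<Rightarrow> real) \<Rightarrow> bool" where
  "in_Lq q u g \<longleftrightarrow> set_borel_measurable (leb u) (unit_cube u) g \<and>
     set_integrable (leb u) (unit_cube u) (\<lambda>t. \<bar>g t\<bar> powr q)"

text \<open>Only the values of \<open>f\<close> on the cube \<open>[0,1]\<^sup>d\<close> are relevant.\<close>

definition sobolev :: "real \<Rightarrow> nat \<Rightarrow> (point \<Rightarrow> real) set" where
  "sobolev q d = {f. (\<forall>u\<subseteq>{1..d}. in_Lq q u (anchored_deriv d u f)) \<and>
     (\<forall>x\<in>unit_cube {1..d}.
        f x = (\<Sum>u\<in>Pow {1..d}. LINT t:(\<Pi>\<^sub>E j\<in>u. {0..x j})|leb u. anchored_deriv d u f t))}"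

definition sobolev_norm :: "real \<Rightarrow> (nat \<Rightarrow> real) \<Rightarrow> nat \<Rightarrow> (point \<Rightarrow> real) \<Rightarrow> real" where
  "sobolev_norm q \<gamma> d f =
     (\<Sum>u\<in>Pow {1..d}. 1 / (\<Prod>j\<in>u. \<gamma> j) powr (q / 2) *
        (LINT t:unit_cube u|leb u. \<bar>anchored_deriv d u f t\<bar> powr q)) powr (1 / q)"

definition sobolev_ball :: "real \<Rightarrow> (nat \<Rightarrow> real) \<Rightarrow> nat \<Rightarrow> (point \<Rightarrow> real) set" where
  "sobolev_ball q \<gamma> d = {f \<in> sobolev q d. sobolev_norm q \<gamma> d f \<le> 1}"


subsection \<open>Integration with positive linear rules\<close>

definition integral_cube :: "nat \<Rightarrow> (point \<Rightarrow> real) \<Rightarrow> real" where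
  "integral_cube d f = (LINT x:unit_cube {1..d}|leb {1..d}. f x)"

definition linear_rule :: "nat \<Rightarrow> (nat \<Rightarrow> real) \<Rightarrow> (nat \<Rightarrow> point) \<Rightarrow> (point \<Rightarrow> real) \<Rightarrow> real" where
  "linear_rule N a x f = (\<Sum>k=1..N. a k * f (x k))"

text \<open>
  The supremum is over a nonempty bounded set of reals for every \<open>linear_rule\<close> with nodes in the
  cube, because point evaluation and integration are bounded functionals on the space.
\<close>

definition worst_case_error ::
    "real \<Rightarrow> (nat \<Rightarrow> real) \<Rightarrow> nat \<Rightarrow> ((point \<Rightarrow> real) \<Rightarrow> real) \<Rightarrow> real" where
  "worst_case_error q \<gamma> d A = (SUP f\<in>sobolev_ball q \<gamma> d. \<bar>integral_cube d f - A f\<bar>)"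

definition min_error :: "real \<Rightarrow> (nat \<Rightarrow> real) \<Rightarrow> nat \<Rightarrow> nat \<Rightarrow> real" where
  "min_error q \<gamma> N d =
     Inf {worst_case_error q \<gamma> d (linear_rule N a x) | a x.
            \<forall>k\<in>{1..N}. 0 \<le> a k \<and> x k \<in> half_open_cube {1..d}}"

definition initial_error :: "real \<Rightarrow> (nat \<Rightarrow> real) \<Rightarrow> nat \<Rightarrow> real" where
  "initial_error q \<gamma> d = (SUP f\<in>sobolev_ball q \<gamma> d. \<bar>integral_cube d f\<bar>)"

definition N_int :: "real \<Rightarrow> (nat \<Rightarrow> real) \<Rightarrow> real \<Rightarrow> nat \<Rightarrow> nat" where
  "N_int q \<gamma> \<epsilon> d = (LEAST N. 1 \<le> N \<and> min_error q \<gamma> N d \<le> \<epsilon> * initial_error q \<gamma> d)"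


definition \<tau> :: "real \<Rightarrow> real" where
  "\<tau> p = (2 * p - (p + 1) * (1 + 2 powr (p / (p + 1)) - 2 powr (1 / (p + 1)))) /
     (4 * p\<^sup>2 + 6 * p + (p + 1) * (1 + 2 powr (p / (p + 1)) - 2 powr (1 / (p + 1))))"

end

theory Submission
  imports Defs
begin

text \<open>
  Write \<open>g\<close> for \<open>\<gamma>\<^sub>j powr (p/2)\<close>.  Inserting the representation of \<open>f\<close> by its anchored derivatives
  into \<open>I(f) - A(f)\<close> gives a sum of integrals of \<open>\<partial>\<^sub>u f\<close> against the kernels
  \<open>\<Prod>j\<in>u. (1 - t\<^sub>j) - \<Sum>k. a\<^sub>k [t\<^sub>u \<le> x\<^sub>k]\<close>, so Hoelder's inequality bounds the worst-case error by the
  weighted \<open>L\<^sub>p\<close>-norm of the kernels.  For the weights \<open>1/N\<close> and the reflected point set this norm is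
  the discrepancy, and for the zero rule it is attained by the product \<open>h\<close> of the functions \<open>extremal\<close>.

  For the lower bound let \<open>E\<close> be the initial error and \<open>e\<close> the error of a positive rule with \<open>N\<close>
  nodes.  In one variable the function of norm 1 with the largest value at \<open>y\<close> is
  \<open>spline y x = (1 + g min(x, y)) / (1 + g y) powr (1/q)\<close>; it is nonnegative, and the extremal function at \<open>y\<close> is
  at most \<open>(1 + \<tau> g) powr (-1/q) * spline y y\<close>.  Positivity of the rule applied to the product spline at the node
  \<open>x\<^sub>k\<close> then shows \<open>a\<^sub>k h(x\<^sub>k) \<le> \<rho> (E + e)\<close> with \<open>\<rho> = \<Prod>j. (1 + \<tau> g) powr (-1/q)\<close>, and summing over the nodes gives
  \<open>E - e \<le> A(h) \<le> N \<rho> (E + e)\<close>, whence \<open>N \<rho> \<ge> (1 - \<epsilon>) / (1 + \<epsilon>) \<ge> 1 - 2 \<epsilon>\<close> if \<open>e \<le> \<epsilon> E\<close>.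
\<close>

text \<open>The spline with knot y and the extremal function are the equality cases of Hoelder's
  inequality for two different functionals, evaluation at y and integration. They differ for every
  y, so the extremal function never reaches the norm (1 + g y) powr (1/p) of the evaluation. What
  has to be quantified is this gap: uniformly in y, and for small g of the form 1 + \<tau> g, since
  only such factors survive in the product over the coordinates. Of the constant \<tau> only
  positivity and the upper bound in \<open>tau_bounds\<close> are used; its powers of 2 disappear
  there. Much of the remaining work is caused by total operators. \<open>SUP\<close>,
  \<open>Inf\<close> and \<open>LEAST\<close> carry information only once boundedness, nonemptiness
  or a witness is known; the kernel bounds and regular grids supply these. Derivatives are pointwise
  values of \<open>deriv\<close>, integrated with respect to a completed measure, so every integral
  is first moved to a Borel representative.\<close>

subsection \<open>The inequality in one variable\<close>

text \<open>At s = 1 / (p + 1) this is the numerator of \<open>\<tau> p\<close> divided by p + 1.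
  The expression vanishes at 0 and at 1/2 and is strictly concave in between: with v = 2 powr s its
  derivative is -2 + ln 2 (2/v + v), which decreases as long as v < sqrt 2. A nonpositive interior
  value would give a derivative \<le> 0 to its left and one \<ge> 0 to its right.\<close>

lemma two_powr_gap_pos:
  fixes s :: real
  assumes "0 < s" "s < 1/2"
  shows "0 < 1 - 2 * s - 2 * 2 powr (-s) + 2 powr s"
proof (rule ccontr)
  define F where "F = (\<lambda>s::real. 1 - 2 * s - 2 * 2 powr (-s) + 2 powr s)"
  define F' where "F' = (\<lambda>s::real. -2 + ln 2 * (2 * 2 powr (-s) + 2 powr s))"
  assume "\<not> ?thesis"
  then have Fs: "F s \<le> 0" by (simp add: F_def)
  have der: "DERIV F x :> F' x" for x
    unfolding F_def F'_def by (auto intro!: derivative_eq_intros simp: algebra_simps)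
  have F0: "F 0 = 0" by (simp add: F_def)
  have Fh: "F (1/2) = 0"
    by (simp add: F_def powr_minus powr_half_sqrt field_simps)
  obtain a where a: "0 < a" "a < s" "F s - F 0 = (s - 0) * F' a"
    using MVT2[of 0 s F F'] assms der by auto
  obtain b where b: "s < b" "b < 1/2" "F (1/2) - F s = (1/2 - s) * F' b"
    using MVT2[of s "1/2" F F'] assms der by auto
  have "F' a \<le> 0" using a Fs F0 assms by (simp add: mult_le_0_iff)
  moreover have "0 \<le> F' b"
  proof -
    have "0 \<le> (1/2 - s) * F' b" using b(3) Fs Fh by simp
    then show ?thesis using assms by (simp add: zero_le_mult_iff)
  qed
  moreover have "F' b < F' a"
  proof -
    define v w where "v = (2::real) powr a" and "w = (2::real) powr b"
    have vw: "1 < v" "v < w"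
      using a b by (auto simp: v_def w_def)
    have "w \<le> 2 powr (1/2)" using b unfolding w_def by (intro powr_mono) auto
    moreover have "v < 2 powr (1/2)" using a b unfolding v_def by (intro powr_less_mono) auto
    ultimately have "v * w < 2 powr (1/2) * 2 powr (1/2)" using vw
      by (intro mult_less_le_imp_less) auto
    then have "v * w < 2" by (simp add: powr_add[symmetric])
    \<comment> \<open>Divided by v w, this product is the difference of 2/v + v and 2/w + w.\<close>
    then have "0 < (w - v) * (2 - v * w)" using vw by simp
    then have "2 / w + w < 2 / v + v" using vw by (simp add: field_simps)
    then show ?thesis unfolding F'_def powr_minus
      by (simp add: v_def w_def divide_inverse)
  qed
  ultimately show False by simp
qed

text \<open>Two linear estimates suffice: the tangent of 2 powr (-s) at 0 from below, and the chord
  of the convex function 2 powr s over [0, 1/2] from above. With ln 2 \<le> 25/36 and sqrt 2 \<le>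
  1.415 the slope becomes -2 + 50/36 + 0.83 < 0.22.\<close>

lemma two_powr_gap_le:
  fixes s :: real
  assumes "0 < s" "s < 1/2"
  shows "1 - 2 * s - 2 * 2 powr (-s) + 2 powr s \<le> 0.22 * s"
proof -
  have "1 - s * ln 2 \<le> exp (- s * ln 2)" using exp_ge_add_one_self[of "-s * ln 2"] by simp
  then have 1: "1 - s * ln 2 \<le> 2 powr (-s)" by (simp add: powr_def)
  have "s * ln 2 \<le> s * (25/36)" using assms ln2_le_25_over_36 by (intro mult_left_mono) auto
  with 1 have 1: "1 - s * (25/36) \<le> 2 powr (-s)" by linarith
  have sq: "sqrt 2 \<le> 1.415" by (rule real_le_lsqrt) (auto simp: power2_eq_square)
  have "2 powr s = (1 + (sqrt 2 - 1)) powr (2 * s)"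
    by (simp add: powr_powr flip: powr_half_sqrt)
  also have "\<dots> \<le> 1 + (2 * s) * (sqrt 2 - 1)"
  proof -
    have "(1 + (sqrt 2 - 1)) powr (2 * s) * 1 powr (1 - 2 * s) \<le> (2 * s) * (1 + (sqrt 2 - 1)) + (1 - 2 * s) * 1"
      using assms by (intro Youngs_inequality_0) auto
    then show ?thesis by (simp add: algebra_simps)
  qed
  also have "\<dots> \<le> 1 + (2 * s) * 0.415" using assms sq by (intro add_left_mono mult_left_mono) auto
  finally have 2: "2 powr s \<le> 1 + 0.83 * s" by simp
  from 1 2 assms show ?thesis by simp
qed

text \<open>The second claim is the smallness condition under which \<open>spline_inequality\<close>
  holds. With c the numerator of \<open>\<tau> p\<close>, the denominator is 4 p^2 + 8 p - c, and c
  \<le> 0.22 reduces the claim to a polynomial inequality in p.\<close>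

lemma tau_bounds:
  fixes p :: real
  assumes "1 < p"
  shows "0 < \<tau> p" "2 * \<tau> p * ((p + 1) / p) \<le> 1 / (p + 1) - (p+1)\<^sup>2 / (p\<^sup>2 + 4 * p + 5) / p"
proof -
  define s where "s = 1 / (p + 1)"
  have s: "0 < s" "s < 1/2" using assms by (auto simp: s_def field_simps)
  define c where "c = (p + 1) * (1 - 2 * s - 2 * 2 powr (-s) + 2 powr s)"
  have "p / (p + 1) = 1 + - s" using assms by (simp add: s_def field_simps)
  then have "2 powr (p / (p + 1)) = 2 * 2 powr (-s)" by (simp add: powr_add del: add_uminus_conv_diff)
  then have B: "(p + 1) * (1 + 2 powr (p / (p + 1)) - 2 powr (1 / (p + 1))) = 2 * p - c"
    using assms unfolding c_def s_def by (simp add: field_simps)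
  have tau: "\<tau> p = c / (4 * p\<^sup>2 + 8 * p - c)" unfolding \<tau>_def B by simp
  have c0: "0 < c" unfolding c_def using two_powr_gap_pos[OF s] assms by simp
  have "c \<le> (p + 1) * (0.22 * s)" unfolding c_def
    using two_powr_gap_le[OF s] assms by (intro mult_left_mono) auto
  moreover have "(p + 1) * (0.22 * s) = 0.22" using assms by (simp add: s_def divide_simps)
  ultimately have c1: "c \<le> 0.22" by linarith
  have p2: "1 < p\<^sup>2" using assms by (simp add: power_less_one_iff)
  have d: "4 * p\<^sup>2 + 8 * p - c > 0"
  proof -
    have "c < 1" using c1 by simp
    then show ?thesis using p2 assms by linarith
  qed
  then show "0 < \<tau> p" using c0 by (simp add: tau)
  have pos: "0 < p\<^sup>2 + 4 * p + 5" using p2 assms by linarith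
  have d': "0.22 < 4 * p\<^sup>2 + 8 * p"
  proof -
    have "(0.22::real) < 1" by simp
    then show ?thesis using p2 assms by linarith
  qed
  have "\<tau> p \<le> 0.22 / (4 * p\<^sup>2 + 8 * p - 0.22)" unfolding tau
    using c0 c1 d d' by (intro frac_le) auto
  then have t: "\<tau> p \<le> 0.11 / (2 * p\<^sup>2 + 4 * p - 0.11)"
    using d' by (simp add: field_simps)
  have "1 / (p + 1) - (p+1)\<^sup>2 / (p\<^sup>2 + 4 * p + 5) / p = (p\<^sup>2 + 2 * p - 1) / (p * (p + 1) * (p\<^sup>2 + 4 * p + 5))"
    using assms pos by (simp add: divide_simps) (simp add: power2_eq_square algebra_simps)
  moreover have "2 * \<tau> p * ((p + 1) / p) \<le> 2 * (0.11 / (2 * p\<^sup>2 + 4 * p - 0.11)) * ((p + 1) / p)"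
    using assms t by (intro mult_right_mono mult_left_mono) auto
  moreover have "2 * (0.11 / (2 * p\<^sup>2 + 4 * p - 0.11)) * ((p + 1) / p) \<le> (p\<^sup>2 + 2 * p - 1) / (p * (p + 1) * (p\<^sup>2 + 4 * p + 5))"
  proof -
    \<comment> \<open>Expanded around p = 1, the difference of the two sides has only positive
      coefficients.\<close>
    define x where "x = p - 1"
    have p: "p = 1 + x" and x: "0 < x" using assms by (auto simp: x_def)
    have "0 \<le> (p\<^sup>2 + 2 * p - 1) * (2 * p\<^sup>2 + 4 * p - 0.11) - 0.22 * (p + 1)\<^sup>2 * (p\<^sup>2 + 4 * p + 5)"
    proof -
      have "(p\<^sup>2 + 2 * p - 1) * (2 * p\<^sup>2 + 4 * p - 0.11) - 0.22 * (p + 1)\<^sup>2 * (p\<^sup>2 + 4 * p + 5)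
        = 2.98 + 25.48 * x + 33.53 * x\<^sup>2 + 13.8 * x ^ 3 + 1.78 * x ^ 4"
        unfolding p by (simp add: power2_eq_square power3_eq_cube power4_eq_xxxx field_simps)
      then show ?thesis using x by simp
    qed
    then have A: "0.22 * (p + 1)\<^sup>2 * (p\<^sup>2 + 4 * p + 5) \<le> (p\<^sup>2 + 2 * p - 1) * (2 * p\<^sup>2 + 4 * p - 0.11)" by simp
    have q: "0 < 2 * p\<^sup>2 + 4 * p - 0.11" using d' by simp
    have "0.22 * (p + 1) * (p * (p + 1) * (p\<^sup>2 + 4 * p + 5)) \<le> (p\<^sup>2 + 2 * p - 1) * ((2 * p\<^sup>2 + 4 * p - 0.11) * p)"
    proof -
      have "0.22 * (p + 1) * (p * (p + 1) * (p\<^sup>2 + 4 * p + 5)) = p * (0.22 * (p + 1)\<^sup>2 * (p\<^sup>2 + 4 * p + 5))"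
        by (simp only: power2_eq_square mult_ac)
      also have "\<dots> \<le> p * ((p\<^sup>2 + 2 * p - 1) * (2 * p\<^sup>2 + 4 * p - 0.11))"
        using A assms by (intro mult_left_mono) auto
      finally show ?thesis by (simp only: mult_ac)
    qed
    then have "0.22 * (p + 1) / ((2 * p\<^sup>2 + 4 * p - 0.11) * p) \<le> (p\<^sup>2 + 2 * p - 1) / (p * (p + 1) * (p\<^sup>2 + 4 * p + 5))"
      using assms q pos by (subst frac_le_eq) (auto simp: divide_le_0_iff)
    moreover have "2 * (0.11 / (2 * p\<^sup>2 + 4 * p - 0.11)) * ((p + 1) / p) = 0.22 * (p + 1) / ((2 * p\<^sup>2 + 4 * p - 0.11) * p)"
      by (simp only: times_divide_times_eq times_divide_eq_left times_divide_eq_right mult.assoc[symmetric]) simp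
    ultimately show ?thesis by linarith
  qed
  ultimately show "2 * \<tau> p * ((p + 1) / p) \<le> 1 / (p + 1) - (p+1)\<^sup>2 / (p\<^sup>2 + 4 * p + 5) / p"
    by linarith
qed

text \<open>The hypothesis says ln u \<le> - ln p / (p - 1), and ln p \<ge> 2 (p - 1) / (p + 1)
  turns this into u \<le> exp (-x) with x = 2 / (p + 1). The rational bound is 1 / (1 + x + x^2/2),
  the quadratic Taylor estimate of the exponential.\<close>

lemma critical_point_le:
  fixes p u :: real
  assumes "1 < p" "0 < u" "u powr (p - 1) \<le> 1 / p"
  shows "u \<le> (p+1)\<^sup>2 / (p\<^sup>2 + 4 * p + 5)"
proof -
  define x where "x = 2 / (p + 1)"
  have x: "0 < x" using assms by (simp add: x_def)
  have "(p - 1) * ln u = ln (u powr (p - 1))" using assms by (simp add: ln_powr)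
  also have "\<dots> \<le> ln (1 / p)" using assms by (subst ln_le_cancel_iff) auto
  finally have 1: "(p - 1) * ln u \<le> - ln p" using assms by (simp add: ln_div)
  have 2: "(p - 1) * x \<le> ln p"
  proof -
    have "2 * (p - 1) / (p + 1) \<le> ln p"
    proof -
      define G where "G = (\<lambda>t::real. ln t - 2 * (t - 1) / (t + 1))"
      have "G 1 \<le> G p"
        using less_imp_le[OF assms(1)]
      proof (rule DERIV_nonneg_imp_nondecreasing)
        fix t :: real assume t: "1 \<le> t"
        have "DERIV G t :> 1 / t - 4 / (t + 1)\<^sup>2" unfolding G_def
          using t by (auto intro!: derivative_eq_intros simp: field_simps power2_eq_square)
        moreover have "0 \<le> 1 / t - 4 / (t + 1)\<^sup>2"
        proof -
          have "4 * t \<le> (t + 1)\<^sup>2" using zero_le_power2[of "t - 1"] by (simp add: power2_eq_square algebra_simps)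
          then show ?thesis using t by (simp add: field_simps)
        qed
        ultimately show "\<exists>y. DERIV G t :> y \<and> 0 \<le> y" by blast
      qed
      then show ?thesis by (simp add: G_def)
    qed
    then show ?thesis by (simp add: x_def mult.commute)
  qed
  have "(p - 1) * (x + ln u) \<le> 0" using 1 2 by (simp add: algebra_simps)
  then have "ln u \<le> - x" using assms by (simp add: mult_le_0_iff)
  then have "u \<le> exp (- x)" using assms by (metis exp_le_cancel_iff exp_ln)
  also have "\<dots> = 1 / exp x" by (simp add: exp_minus field_simps)
  also have "\<dots> \<le> 1 / (1 + x + x\<^sup>2 / 2)"
    using exp_lower_Taylor_quadratic[of x] x by (intro divide_left_mono) (auto intro!: mult_pos_pos add_pos_pos)
  also have "\<dots> = (p+1)\<^sup>2 / (p\<^sup>2 + 4 * p + 5)"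
  proof -
    have xp: "x * (p + 1) = 2" unfolding x_def using assms by (intro nonzero_eq_divide_eq[THEN iffD1]) auto
    have "(1 + x + x\<^sup>2 / 2) * (p + 1)\<^sup>2 = (p + 1)\<^sup>2 + (x * (p + 1)) * (p + 1) + (x * (p + 1))\<^sup>2 / 2"
      by (simp add: power2_eq_square algebra_simps)
    also have "\<dots> = p\<^sup>2 + 4 * p + 5" unfolding xp by (simp add: power2_eq_square algebra_simps)
    finally have eq: "p\<^sup>2 + 4 * p + 5 = (1 + x + x\<^sup>2 / 2) * (p + 1)\<^sup>2" ..
    show ?thesis unfolding eq using assms by simp
  qed
  finally show ?thesis .
qed

text \<open>This is \<open>spline_inequality\<close> at a stationary point, where the numerator of
  the extremal function equals a Y with a = (1 + g/p) / (Y + g u / p^2). After division by the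
  right-hand side the claim reads a * z powr (p - 1) \<le> 1, which follows from its linearisation
  (p - 1) (z - 1) \<le> 1 - a at a = z = 1.\<close>

lemma critical_value_bound:
  fixes p g u t :: real
  assumes p: "1 < p" and g: "0 < g" "g \<le> 1" and u: "0 \<le> u" "u \<le> 1" and t: "0 \<le> t"
    and tu: "2 * t * ((p + 1) / p) \<le> 1 / (p + 1) - u / p"
  defines "Y \<equiv> 1 + g * (1 - u)"
  shows "((1 + g / p) * Y / (Y + g * u / p\<^sup>2)) powr p * (1 + t * g) powr (p - 1)
    \<le> (1 + g / (p + 1)) powr (p - 1) * Y"
proof -
  define D where "D = Y + g * u / p\<^sup>2"
  define a where "a = (1 + g / p) / D"
  define X where "X = 1 + g / (p + 1)"
  define z where "z = a * Y * (1 + t * g) / X"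
  have Y: "1 \<le> Y" using g u by (simp add: Y_def)
  have D: "1 \<le> D" using Y g u by (auto simp: D_def intro: order_trans)
  have X: "1 \<le> X" using g p by (simp add: X_def)
  have a: "0 < a" using g p D by (auto simp: a_def intro!: divide_pos_pos add_pos_pos)
  have tg: "0 < 1 + t * g" using t g by (auto intro: add_pos_nonneg)
  have z: "0 < z" using a Y X tg by (simp add: z_def)
  \<comment> \<open>The factor 2 (p + 1) / p in the hypothesis bounds (1 + g/p) Y, because g \<le> 1
    gives Y \<le> 2.\<close>
  have sl: "t * ((1 + g / p) * Y) \<le> 1 / (p + 1) - u / p"
  proof -
    have "(1 + g / p) * Y \<le> ((p + 1) / p) * 2"
    proof (intro mult_mono)
      show "1 + g / p \<le> (p + 1) / p" using g p by (simp add: field_simps)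
      have "g * (1 - u) \<le> 1 * 1" using g u by (intro mult_mono) auto
      then show "Y \<le> 2" by (simp add: Y_def)
    qed (use p Y in auto)
    from mult_left_mono[OF this t] tu show ?thesis by (simp add: mult_ac)
  qed
  \<comment> \<open>The terms of second order in \<open>g\<close> cancel because \<open>1/p - 1/(p+1) = 1/(p(p+1))\<close>.\<close>
  have id: "D * X * ((1 - a) / (p - 1) - (z - 1)) = g * (1 / (p + 1) - u / p - t * ((1 + g / p) * Y))"
  proof -
    define b where "b = 1 / p"
    define c where "c = 1 / (p + 1)"
    have bc: "b - c = b * c" using p by (simp add: b_def c_def field_simps)
    have pb: "p * b = 1" using p by (simp add: b_def)
    have Db: "D = Y + g * u * b\<^sup>2" by (simp add: D_def b_def power_divide)
    have "D * (1 - a) = D - (1 + g / p)" using D by (simp add: a_def right_diff_distrib)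
    also have "\<dots> = (p - 1) * (g * (b - u * (b + b\<^sup>2)))"
      unfolding Db Y_def using pb p by (simp add: b_def field_simps power2_eq_square)
    finally have "D * ((1 - a) / (p - 1)) = g * (b - u * (b + b\<^sup>2))"
      using p by (metis (no_types, lifting) diff_gt_0_iff_gt less_numeral_extra(3) nonzero_mult_div_cancel_left times_divide_eq_right)
    moreover have "D * X * (z - 1) = (1 + g * b) * Y * (1 + t * g) - D * X"
      using D X by (simp add: z_def a_def right_diff_distrib b_def)
    moreover have "X = 1 + g * c" by (simp add: X_def c_def)
    moreover have "D * X * ((1 - a) / (p - 1) - (z - 1)) = X * (D * ((1 - a) / (p - 1))) - D * X * (z - 1)"
      by (simp only: right_diff_distrib mult_ac)
    ultimately have "D * X * ((1 - a) / (p - 1) - (z - 1))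
        = (1 + g * c) * (g * (b - u * (b + b\<^sup>2))) - ((1 + g * b) * Y * (1 + t * g) - D * (1 + g * c))"
      by simp
    also have "\<dots> = g * (c - u * b - t * ((1 + g * b) * Y)) + g * g * (1 - u) * (c * b - (b - c))"
      unfolding Db Y_def by (simp add: algebra_simps power2_eq_square)
    also have "\<dots> = g * (c - u * b - t * ((1 + g * b) * Y))" by (simp add: bc)
    finally show ?thesis by (simp add: b_def c_def)
  qed
  have "0 \<le> D * X * ((1 - a) / (p - 1) - (z - 1))" unfolding id using sl g by simp
  moreover have "0 < D * X" using D X by simp
  ultimately have "z - 1 \<le> (1 - a) / (p - 1)" by (simp add: zero_le_mult_iff)
  then have zz: "(p - 1) * (z - 1) \<le> 1 - a" using p by (simp add: field_simps)
  \<comment> \<open>Bounding both factors by 1 + r \<le> exp r adds the linear terms in the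
    exponent, where \<open>zz\<close> applies.\<close>
  have "a * z powr (p - 1) \<le> exp (a - 1) * exp (z - 1) powr (p - 1)"
    using a z p exp_ge_add_one_self[of "a - 1"] exp_ge_add_one_self[of "z - 1"]
    by (intro mult_mono powr_mono2) auto
  also have "\<dots> = exp (a - 1 + (p - 1) * (z - 1))" by (simp add: powr_def exp_add mult.commute)
  also have "\<dots> \<le> 1" using zz by simp
  finally have main: "a * z powr (p - 1) \<le> 1" .
  have "((1 + g / p) * Y / (Y + g * u / p\<^sup>2)) powr p * (1 + t * g) powr (p - 1) = (a * Y) powr p * (1 + t * g) powr (p - 1)"
    by (simp add: a_def D_def)
  also have "(a * Y) powr p = a * Y * (a * Y) powr (p - 1)" using a Y
    by (simp add: powr_diff)
  also have "a * Y * (a * Y) powr (p - 1) * (1 + t * g) powr (p - 1) = a * Y * (z * X) powr (p - 1)"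
    using a Y tg X by (simp add: z_def powr_mult)
  also have "\<dots> = (a * z powr (p - 1)) * (X powr (p - 1) * Y)"
    using z X by (simp add: powr_mult)
  also have "\<dots> \<le> 1 * (X powr (p - 1) * Y)" using main Y by (intro mult_right_mono) auto
  finally show ?thesis by (simp add: X_def)
qed

text \<open>With u = 1 - y, A is the numerator of the extremal function at y and Y = 1 + g y. The
  quotient T = A powr p / Y is bounded at its maximum point v over [0, 1]: at v = 1 it equals 1, and
  elsewhere stationarity determines A algebraically, which removes the power of v.\<close>

lemma spline_inequality:
  fixes p g u t :: real
  assumes p: "1 < p" and g: "0 < g" "g \<le> 1" and u: "0 \<le> u" "u \<le> 1" and t: "0 \<le> t"
    and tp: "2 * t * ((p + 1) / p) \<le> 1 / (p + 1) - (p+1)\<^sup>2 / (p\<^sup>2 + 4 * p + 5) / p"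
  shows "(1 + g * (1 - u powr p) / p) powr p * (1 + t * g) powr (p - 1)
    \<le> (1 + g / (p + 1)) powr (p - 1) * (1 + g * (1 - u))"
proof -
  define A where "A = (\<lambda>u. 1 + g * (1 - u powr p) / p)"
  define Y where "Y = (\<lambda>u. 1 + g * (1 - u))"
  define T where "T = (\<lambda>u. A u powr p / Y u)"
  have A: "1 \<le> A v" if "0 \<le> v" "v \<le> 1" for v
    using that g p powr_le1[of p v] by (simp add: A_def)
  have Y: "1 \<le> Y v" if "0 \<le> v" "v \<le> 1" for v
    using that g by (simp add: Y_def)
  \<comment> \<open>This is Bernoulli's inequality for v powr p, read off from the weighted
    arithmetic-geometric mean inequality. It makes the stationarity equation imply v powr (p - 1)
    \<le> 1/p.\<close>
  have AY: "A v \<le> Y v" if "0 \<le> v" "v \<le> 1" for v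
  proof -
    have "v powr p \<ge> 1 + p * (v - 1)"
    proof (cases "v = 0")
      case False
      have "(v powr p) powr (1/p) * 1 powr (1 - 1/p) \<le> (1/p) * v powr p + (1 - 1/p) * 1"
        using p that False by (intro Youngs_inequality_0) auto
      then have "v \<le> (1/p) * v powr p + (1 - 1/p)" using p that False by (simp add: powr_powr)
      then have "p * v \<le> p * ((1/p) * v powr p + (1 - 1/p))" using p by (intro mult_left_mono) auto
      also have "\<dots> = v powr p + p - 1" using p by (simp add: field_simps)
      finally show ?thesis by (simp add: algebra_simps)
    qed (use p in auto)
    then have "1 - v powr p \<le> p * (1 - v)" by (simp add: algebra_simps)
    then have "g * (1 - v powr p) \<le> g * (p * (1 - v))" using g by (intro mult_left_mono) auto
    then show ?thesis using p by (simp add: A_def Y_def field_simps)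
  qed
  have "continuous_on {0..1} (\<lambda>v::real. v powr p)"
    using p by (intro continuous_on_powr' continuous_intros) auto
  then have cA: "continuous_on {0..1} A" unfolding A_def
    using p by (intro continuous_on_add continuous_on_mult continuous_on_divide continuous_on_diff continuous_on_const) auto
  have cY: "continuous_on {0..1} Y" unfolding Y_def by (intro continuous_intros)
  have "A v \<noteq> 0" "Y v \<noteq> 0" if "v \<in> {0..1}" for v using A[of v] Y[of v] that by auto
  then have cont: "continuous_on {0..1} T" unfolding T_def
    by (intro continuous_on_divide continuous_on_powr cA cY continuous_on_const) auto
  obtain v where v: "v \<in> {0..1}" "\<And>w. w \<in> {0..1} \<Longrightarrow> T w \<le> T v"
    using continuous_attains_sup[OF _ _ cont] by auto
  let ?R = "(1 + g / (p + 1)) powr (p - 1)"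
  have R: "(1 + t * g) powr (p - 1) \<le> ?R"
  proof -
    have "t \<le> 1 / (p + 1)"
    proof -
      have "2 * t * 1 \<le> 2 * t * ((p + 1) / p)" using p t by (intro mult_left_mono) (auto simp: field_simps)
      moreover have "0 \<le> (p+1)\<^sup>2 / (p\<^sup>2 + 4 * p + 5) / p" using p by (auto intro!: divide_nonneg_nonneg add_nonneg_nonneg)
      ultimately show ?thesis using tp t by linarith
    qed
    then have "t * g \<le> 1 / (p + 1) * g" using g by (intro mult_right_mono) auto
    then show ?thesis using t g p by (intro powr_mono2) auto
  qed
  have "T v * (1 + t * g) powr (p - 1) \<le> ?R"
  proof (cases "v = 1")
    case True
    then show ?thesis using R by (simp add: T_def A_def Y_def)
  next
    case False
    \<comment> \<open>In the interior, T' = 0 means p * v powr (p - 1) * Y = A; substituting v powr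
      p = v A / (p Y) into the definition of A and solving for A gives the formula. The endpoint 0
      satisfies it directly, without a derivative.\<close>
    have formula: "A v = (1 + g / p) * Y v / (Y v + g * v / p\<^sup>2) \<and> v \<le> (p+1)\<^sup>2 / (p\<^sup>2 + 4 * p + 5)"
    proof (cases "v = 0")
      case True
      then show ?thesis using g p by (auto simp: A_def Y_def intro!: divide_nonneg_nonneg add_nonneg_nonneg)
    next
      case v0: False
      have v01: "0 < v" "v < 1" using v0 False v by auto
      note Av = A[of v] and Yv = Y[of v]
      have dA: "DERIV A v :> - g * v powr (p - 1)" unfolding A_def
        using v01 p by (auto intro!: derivative_eq_intros)
      have dY: "DERIV Y v :> - g" unfolding Y_def by (auto intro!: derivative_eq_intros)
      have dT: "DERIV T v :> (A v powr p * (p * (- g * v powr (p - 1)) / A v) * Y v - A v powr p * (- g)) / (Y v * Y v)"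
        unfolding T_def using Av Yv v01
        by (auto intro!: derivative_eq_intros dA dY simp: powr_diff) (simp add: mult_ac)
      have "(A v powr p * (p * (- g * v powr (p - 1)) / A v) * Y v - A v powr p * (- g)) / (Y v * Y v) = 0"
      proof (rule DERIV_local_max[OF dT])
        show "0 < min v (1 - v)" using v01 by simp
        show "\<forall>y. \<bar>v - y\<bar> < min v (1 - v) \<longrightarrow> T y \<le> T v"
          by (intro allI impI v(2)) (auto simp: abs_if split: if_splits)
      qed
      moreover have "A v powr p * (p * (- g * v powr (p - 1)) / A v) * Y v - A v powr p * (- g)
          = A v powr p * g * (1 - p * v powr (p - 1) * Y v / A v)"
        using Av v01 by (simp add: algebra_simps)
      ultimately have "A v powr p * g * (1 - p * v powr (p - 1) * Y v / A v) = 0"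
        using Yv v01 by simp
      then have "p * v powr (p - 1) * Y v / A v = 1" using Av v01 g by auto
      then have crit: "v powr (p - 1) = A v / (p * Y v)" using Av Yv v01 p by (simp add: field_simps)
      have "v powr (p - 1) \<le> 1 / p" unfolding crit using AY[of v] Yv v01 p
        by (simp add: field_simps)
      then have 1: "v \<le> (p+1)\<^sup>2 / (p\<^sup>2 + 4 * p + 5)" using critical_point_le[OF p v01(1)] by simp
      have "v powr p = v * v powr (p - 1)" using v01 by (simp add: powr_diff)
      then have "v powr p = v * (A v / (p * Y v))" by (simp add: crit)
      then have "A v = 1 + g * (1 - v * (A v / (p * Y v))) / p" by (simp add: A_def)
      then have "A v * (Y v + g * v / p\<^sup>2) = (1 + g / p) * Y v"
        using Yv v01 p by (simp add: field_simps power2_eq_square)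
      moreover have "0 < Y v + g * v / p\<^sup>2" using Yv v01 g p by (intro add_pos_nonneg) auto
      ultimately show ?thesis using 1 by (simp add: field_simps)
    qed
    have "2 * t * ((p + 1) / p) \<le> 1 / (p + 1) - v / p"
    proof -
      have "v / p \<le> (p+1)\<^sup>2 / (p\<^sup>2 + 4 * p + 5) / p" using formula p by (intro divide_right_mono) auto
      then show ?thesis using tp by linarith
    qed
    then have "A v powr p * (1 + t * g) powr (p - 1) \<le> ?R * Y v"
      using critical_value_bound[OF p g _ _ t, of v] v(1) formula by (simp add: Y_def)
    then show ?thesis using Y[of v] v(1) by (simp add: T_def field_simps)
  qed
  moreover have "T u \<le> T v" using v u by simp
  then have "T u * (1 + t * g) powr (p - 1) \<le> T v * (1 + t * g) powr (p - 1)"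
    by (intro mult_right_mono) auto
  ultimately have "T u * (1 + t * g) powr (p - 1) \<le> ?R" by linarith
  then have "A u powr p * (1 + t * g) powr (p - 1) \<le> ?R * Y u"
    using Y[OF u] by (simp add: T_def field_simps)
  then show ?thesis by (simp add: A_def Y_def)
qed

subsection \<open>Products of Lebesgue measures\<close>

lemma borel_measurable_completion_AE:
  fixes f g :: "'a \<Rightarrow> real"
  assumes g: "g \<in> borel_measurable M" and ae: "AE x in M. f x = g x"
  shows "f \<in> borel_measurable (completion M)"
proof (rule measurableI)
  fix B :: "real set" assume B: "B \<in> sets borel"
  show "f -` B \<inter> space (completion M) \<in> sets (completion M)"
  proof (rule completion.in_sets_AE)
    show "g -` B \<inter> space (completion M) \<in> sets (completion M)"
      using measurable_sets[OF g B] by simp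
    show "AE x in completion M. x \<in> g -` B \<inter> space (completion M) \<longleftrightarrow> x \<in> f -` B \<inter> space (completion M)"
      using AE_completion[OF ae] by eventually_elim auto
  qed auto
qed auto

context
  fixes M :: "'a measure" and A and f g :: "'a \<Rightarrow> real"
  assumes A: "A \<in> sets M" and g: "set_borel_measurable M A g" and ae: "AE x in M. x \<in> A \<longrightarrow> f x = g x"
begin

text \<open>The integrands in the definitions agree with a Borel function g only on the cube and
  only outside a null set. This fact and the next two transfer measurability, integrability and
  integrals to g and the uncompleted product measure, where Fubini's theorem and product formulas
  are used.\<close>

lemma set_borel_measurable_completion: "set_borel_measurable (completion M) A f"
  unfolding set_borel_measurable_def
  by (rule borel_measurable_completion_AE[OF g[unfolded set_borel_measurable_def]])
    (use ae in \<open>eventually_elim, auto simp: indicator_def\<close>)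

lemma set_integrable_completion: "set_integrable (completion M) A f \<longleftrightarrow> set_integrable M A g"
proof -
  have "integrable (completion M) (\<lambda>x. indicator A x *\<^sub>R f x) \<longleftrightarrow> integrable (completion M) (\<lambda>x. indicator A x *\<^sub>R g x)"
    using set_borel_measurable_completion g ae
    by (intro integrable_cong_AE AE_completion)
      (auto simp: set_borel_measurable_def indicator_def intro: measurable_completion elim: eventually_mono)
  then show ?thesis
    using integrable_completion[OF g[unfolded set_borel_measurable_def]] by (simp add: set_integrable_def)
qed

lemma set_integral_completion: "(LINT x:A|completion M. f x) = (LINT x:A|M. g x)"
proof -
  have "(LINT x:A|completion M. f x) = (LINT x:A|completion M. g x)"
    unfolding set_lebesgue_integral_def
    using set_borel_measurable_completion g ae
    by (intro integral_cong_AE AE_completion)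
      (auto simp: set_borel_measurable_def indicator_def intro: measurable_completion elim: eventually_mono)
  then show ?thesis
    using integral_completion[OF g[unfolded set_borel_measurable_def]] by (simp add: set_lebesgue_integral_def)
qed

end

section \<open>Product measure, boxes and reflection of the cube\<close>

abbreviation lborel_pi :: "nat set \<Rightarrow> point measure" where
  "lborel_pi u \<equiv> Pi\<^sub>M u (\<lambda>_. lborel)"

interpretation lborel_pi: product_sigma_finite "\<lambda>_::nat. lborel :: real measure"
  by standard

lemma sets_box [measurable]:
  assumes "finite u" "\<And>j. j \<in> u \<Longrightarrow> B j \<in> sets borel"
  shows "Pi\<^sub>E u B \<in> sets (lborel_pi u)"
  using assms by (intro sets_PiM_I_finite) auto

lemma sets_unit_cube [measurable]: "finite u \<Longrightarrow> unit_cube u \<in> sets (lborel_pi u)"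
  unfolding unit_cube_def by (intro sets_box) auto

lemma emeasure_unit_cube: "finite u \<Longrightarrow> emeasure (lborel_pi u) (unit_cube u) = 1"
  unfolding unit_cube_def by (subst lborel_pi.emeasure_PiM) auto

lemma measure_unit_cube: "finite u \<Longrightarrow> measure (lborel_pi u) (unit_cube u) = 1"
  by (simp add: measure_def emeasure_unit_cube)

text \<open>Used for the points where a product function may fail to be differentiable: finitely
  many values in each coordinate form finitely many null hyperplanes.\<close>

lemma AE_lborel_pi_notin:
  assumes u: "finite u" and K: "\<And>j. j \<in> u \<Longrightarrow> finite (K j)"
  shows "AE t in lborel_pi u. \<forall>j\<in>u. t j \<notin> K j"
proof (rule AE_finite_allI[OF u])
  fix i assume i: "i \<in> u"
  let ?N = "\<Pi>\<^sub>E j\<in>u. if j = i then K i else UNIV"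
  have sets: "?N \<in> sets (lborel_pi u)" using u K[OF i] by (intro sets_box) (auto intro: borel_closed finite_imp_closed)
  have "emeasure lborel (K i) = 0" using K[OF i] by (simp add: emeasure_lborel_countable countable_finite)
  moreover have "emeasure (lborel_pi u) ?N = (\<Prod>j\<in>u. emeasure lborel (if j = i then K i else UNIV))"
    using u K[OF i] by (intro lborel_pi.emeasure_PiM) (auto intro: borel_closed finite_imp_closed)
  \<comment> \<open>The remaining factors are infinite, but zero times infinity is zero in
    \<open>ennreal\<close>.\<close>
  ultimately have "emeasure (lborel_pi u) ?N = 0"
    using u i by (auto intro!: prod_zero bexI[of _ i])
  then have "AE t in lborel_pi u. t \<notin> ?N" using sets by (intro AE_not_in null_setsI)
  then show "AE t in lborel_pi u. t i \<notin> K i"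
    using AE_space
  proof eventually_elim
    case (elim t)
    then show ?case by (auto simp: space_PiM PiE_iff split: if_splits)
  qed
qed

lemma set_integrable_unit_cube:
  fixes f :: "point \<Rightarrow> real"
  assumes u: "finite u" and f: "set_borel_measurable (lborel_pi u) (unit_cube u) f"
    and B: "\<And>t. t \<in> unit_cube u \<Longrightarrow> \<bar>f t\<bar> \<le> B"
  shows "set_integrable (lborel_pi u) (unit_cube u) f"
  unfolding set_integrable_def
proof (rule Bochner_Integration.integrable_bound)
  have "integrable (lborel_pi u) (indicator (unit_cube u) :: point \<Rightarrow> real)"
    using u by (intro integrable_real_indicator) (auto simp: emeasure_unit_cube)
  then show "integrable (lborel_pi u) (\<lambda>t. indicator (unit_cube u) t * B)" by simp
  show "AE t in lborel_pi u. norm (indicator (unit_cube u) t *\<^sub>R f t) \<le> norm (indicator (unit_cube u) t * B)"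
    using B by (intro AE_I2) (fastforce simp: indicator_def)
qed (use f in \<open>simp add: set_borel_measurable_def\<close>)

lemma indicator_box:
  assumes "t \<in> space (lborel_pi u)" "finite u"
  shows "indicator (Pi\<^sub>E u B) t = (\<Prod>j\<in>u. indicator (B j) (t j) :: real)"
proof (cases "t \<in> Pi\<^sub>E u B")
  case False
  then obtain j where "j \<in> u" "t j \<notin> B j" using assms by (auto simp: space_PiM PiE_iff)
  then have "(\<Prod>j\<in>u. indicator (B j) (t j) :: real) = 0" using assms by (intro prod_zero) (auto intro: bexI[of _ j])
  then show ?thesis using False by simp
qed (auto simp: PiE_iff)

lemma
  fixes F :: "nat \<Rightarrow> real \<Rightarrow> real"
  assumes u: "finite u" and F: "\<And>j. j \<in> u \<Longrightarrow> set_integrable lborel (B j) (F j)"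
  shows set_integral_box_prod:
      "(LINT t:Pi\<^sub>E u B|lborel_pi u. \<Prod>j\<in>u. F j (t j)) = (\<Prod>j\<in>u. LINT s:B j|lborel. F j s)"
    and set_integrable_box_prod: "set_integrable (lborel_pi u) (Pi\<^sub>E u B) (\<lambda>t. \<Prod>j\<in>u. F j (t j))"
proof -
  have eq: "indicator (Pi\<^sub>E u B) t *\<^sub>R (\<Prod>j\<in>u. F j (t j)) = (\<Prod>j\<in>u. indicator (B j) (t j) *\<^sub>R F j (t j))"
    if "t \<in> space (lborel_pi u)" for t
    using that u by (simp add: indicator_box prod.distrib)
  show "(LINT t:Pi\<^sub>E u B|lborel_pi u. \<Prod>j\<in>u. F j (t j)) = (\<Prod>j\<in>u. LINT s:B j|lborel. F j s)"
    unfolding set_lebesgue_integral_def using F u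
    by (subst Bochner_Integration.integral_cong[OF refl eq])
      (auto simp: set_integrable_def intro!: lborel_pi.product_integral_prod)
  show "set_integrable (lborel_pi u) (Pi\<^sub>E u B) (\<lambda>t. \<Prod>j\<in>u. F j (t j))"
    unfolding set_integrable_def using F u
    by (subst Bochner_Integration.integrable_cong[OF refl eq])
      (auto simp: set_integrable_def intro!: lborel_pi.product_integrable_prod)
qed

text \<open>Boxes determine the product measure, so invariance of \<open>lborel\<close> under s -> 1
  - s in each coordinate is enough. The reflection exchanges the boxes [0, t) of the discrepancy,
  anchored at 0, with the conditions t \<le> x of the integration kernel.\<close>

lemma distr_lborel_pi_reflect:
  assumes u: "finite u"
  shows "distr (lborel_pi u) (lborel_pi u) (\<lambda>t. \<lambda>j\<in>u. 1 - t j) = lborel_pi u" (is "distr _ _ ?r = _")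
proof (rule lborel_pi.PiM_eqI[OF u])
  fix A :: "nat \<Rightarrow> real set" assume "\<And>j. j \<in> u \<Longrightarrow> A j \<in> sets lborel"
  then have A: "\<And>j. j \<in> u \<Longrightarrow> A j \<in> sets borel" by simp
  have r: "?r \<in> measurable (lborel_pi u) (lborel_pi u)" by measurable
  have "emeasure (distr (lborel_pi u) (lborel_pi u) ?r) (Pi\<^sub>E u A) = emeasure (lborel_pi u) (\<Pi>\<^sub>E j\<in>u. (\<lambda>s. 1 - s) -` A j)"
    using A u by (subst emeasure_distr[OF r])
      (auto intro!: sets_box arg_cong[where f="emeasure _"] simp: space_PiM PiE_iff)
  also have "\<dots> = (\<Prod>j\<in>u. emeasure lborel ((\<lambda>s::real. 1 - s) -` A j))"
  proof (rule lborel_pi.emeasure_PiM[OF u])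
    fix j assume "j \<in> u"
    have "(\<lambda>s::real. 1 - s) -` A j \<inter> space borel \<in> sets borel" by (rule measurable_sets[OF _ A[OF \<open>j \<in> u\<close>]]) measurable
    then show "(\<lambda>s. 1 - s) -` A j \<in> sets lborel" by simp
  qed
  also have "\<dots> = (\<Prod>j\<in>u. emeasure lborel (A j))"
  proof (rule prod.cong[OF refl])
    fix j assume j: "j \<in> u"
    have "(lborel :: real measure) = distr lborel borel (\<lambda>s. 1 + (-1) * s)"
      using lborel_real_affine[of "-1" 1] by (simp add: density_1)
    then have "emeasure lborel (A j) = emeasure (distr lborel borel (\<lambda>s::real. 1 - s)) (A j)" by simp
    also have "\<dots> = emeasure lborel ((\<lambda>s::real. 1 - s) -` A j)"
      using A[OF j] by (subst emeasure_distr) auto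
    finally show "emeasure lborel ((\<lambda>s::real. 1 - s) -` A j) = emeasure lborel (A j)" ..
  qed
  finally show "emeasure (distr (lborel_pi u) (lborel_pi u) ?r) (Pi\<^sub>E u A) = (\<Prod>j\<in>u. emeasure lborel (A j))" .
qed simp

lemma set_integral_unit_cube_reflect:
  fixes f :: "point \<Rightarrow> real"
  assumes u: "finite u" and f: "set_borel_measurable (lborel_pi u) (unit_cube u) f"
  shows "(LINT t:unit_cube u|lborel_pi u. f (\<lambda>j\<in>u. 1 - t j)) = (LINT t:unit_cube u|lborel_pi u. f t)"
proof -
  have "(LINT t:unit_cube u|lborel_pi u. f t)
      = (LINT t|distr (lborel_pi u) (lborel_pi u) (\<lambda>t. \<lambda>j\<in>u. 1 - t j). indicator (unit_cube u) t *\<^sub>R f t)"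
    by (simp add: distr_lborel_pi_reflect[OF u] set_lebesgue_integral_def)
  also have "\<dots> = (LINT t|lborel_pi u. indicator (unit_cube u) (\<lambda>j\<in>u. 1 - t j) *\<^sub>R f (\<lambda>j\<in>u. 1 - t j))"
    using f by (intro integral_distr) (auto simp: set_borel_measurable_def)
  also have "\<dots> = (LINT t:unit_cube u|lborel_pi u. f (\<lambda>j\<in>u. 1 - t j))"
    unfolding set_lebesgue_integral_def
    by (intro Bochner_Integration.integral_cong)
      (auto simp: indicator_def unit_cube_def space_PiM PiE_iff)
  finally show ?thesis ..
qed

subsection \<open>Product functions in the Sobolev space\<close>

text \<open>Absolute continuity on [0, 1] with a bounded derivative, in the form needed for
  \<open>partial_deriv\<close>: outside a finite set the derivative is two-sided on the real line,
  also at 0 and 1, so that \<open>deriv\<close> really returns F'. The finite exceptional set keeps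
  the corresponding hyperplanes null.\<close>

definition piecewise_antideriv :: "(real \<Rightarrow> real) \<Rightarrow> (real \<Rightarrow> real) \<Rightarrow> bool" where
  "piecewise_antideriv F F' \<longleftrightarrow>
     (\<exists>K. finite K \<and> (\<forall>s\<in>{0..1} - K. (F has_real_derivative F' s) (at s))) \<and>
     F' \<in> borel_measurable borel \<and> (\<exists>B. \<forall>s\<in>{0..1}. \<bar>F' s\<bar> \<le> B) \<and>
     (\<forall>x\<in>{0..1}. F x = F 0 + (LINT s:{0..x}|lborel. F' s))"

lemma piecewise_antiderivD:
  assumes "piecewise_antideriv F F'"
  shows "\<exists>K. finite K \<and> (\<forall>s\<in>{0..1} - K. (F has_real_derivative F' s) (at s))"
    and "F' \<in> borel_measurable borel"
    and "\<exists>B. \<forall>s\<in>{0..1}. \<bar>F' s\<bar> \<le> B"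
    and "x \<in> {0..1} \<Longrightarrow> F x = F 0 + (LINT s:{0..x}|lborel. F' s)"
  using assms unfolding piecewise_antideriv_def by blast+

lemma set_integrable_bounded_interval:
  fixes F :: "real \<Rightarrow> real"
  assumes F: "F \<in> borel_measurable borel" and B: "\<And>s. s \<in> {a..b} \<Longrightarrow> \<bar>F s\<bar> \<le> B"
  shows "set_integrable lborel {a..b} F"
  unfolding set_integrable_def
proof (rule Bochner_Integration.integrable_bound)
  show "integrable lborel (\<lambda>t. indicator {a..b} t * B)"
    by (intro integrable_mult_left integrable_real_indicator) (auto simp: emeasure_lborel_Icc_eq)
  show "AE t in lborel. norm (indicator {a..b} t *\<^sub>R F t) \<le> norm (indicator {a..b} t * B)"
    using B by (intro AE_I2) (fastforce simp: indicator_def)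
qed (use F in simp)

text \<open>Differentiating in the head coordinate i needs the inner derivative along the whole line
  s -> t(i := s), also for s outside [0, 1]. The induction hypothesis provides it, because i does
  not occur in the tail and the conditions on t concern only the coordinates of the tail.\<close>

lemma mixed_deriv_product:
  assumes js: "distinct js" "set js \<subseteq> {1..d}"
    and der: "\<And>j s. j \<in> {1..d} \<Longrightarrow> s \<in> {0..1} - K j \<Longrightarrow> (\<phi> j has_real_derivative \<phi>' j s) (at s)"
    and t: "\<And>j. j \<in> set js \<Longrightarrow> t j \<in> {0..1} - K j"
  shows "foldr partial_deriv js (\<lambda>x. \<Prod>j\<in>{1..d}. \<phi> j (x j)) t
    = (\<Prod>j\<in>{1..d}. if j \<in> set js then \<phi>' j (t j) else \<phi> j (t j))"
  using js t
proof (induction js arbitrary: t)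
  case (Cons i js)
  let ?f = "foldr partial_deriv js (\<lambda>x. \<Prod>j\<in>{1..d}. \<phi> j (x j))"
  define c where "c = (\<Prod>j\<in>{1..d} - {i}. if j \<in> set js then \<phi>' j (t j) else \<phi> j (t j))"
  have i: "i \<in> {1..d}" "i \<notin> set js" using Cons by auto
  have "?f (t(i := s)) = c * \<phi> i s" for s
  proof -
    have "?f (t(i := s)) = (\<Prod>j\<in>{1..d}. if j \<in> set js then \<phi>' j ((t(i := s)) j) else \<phi> j ((t(i := s)) j))"
      using Cons.prems i by (intro Cons.IH) auto
    also have "\<dots> = \<phi> i s * c" unfolding c_def
    proof (subst prod.remove[of _ i])
      show "(if i \<in> set js then \<phi>' i ((t(i := s)) i) else \<phi> i ((t(i := s)) i)) *
          (\<Prod>j\<in>{1..d} - {i}. if j \<in> set js then \<phi>' j ((t(i := s)) j) else \<phi> j ((t(i := s)) j)) =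
        \<phi> i s * (\<Prod>j\<in>{1..d} - {i}. if j \<in> set js then \<phi>' j (t j) else \<phi> j (t j))"
        using i by (intro arg_cong2[where f="(*)"] prod.cong) auto
    qed (use i in auto)
    finally show ?thesis by (simp add: mult.commute)
  qed
  then have "foldr partial_deriv (i # js) (\<lambda>x. \<Prod>j\<in>{1..d}. \<phi> j (x j)) t = deriv (\<lambda>s. c * \<phi> i s) (t i)"
    by (simp add: partial_deriv_def)
  also have "\<dots> = c * \<phi>' i (t i)"
    using Cons.prems i by (intro DERIV_imp_deriv DERIV_cmult der) auto
  also have "\<dots> = (\<Prod>j\<in>{1..d}. if j \<in> set (i # js) then \<phi>' j (t j) else \<phi> j (t j))"
    unfolding c_def
  proof (subst (2) prod.remove[of _ i])
    show "(\<Prod>j\<in>{1..d} - {i}. if j \<in> set js then \<phi>' j (t j) else \<phi> j (t j)) * \<phi>' i (t i) =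
      (if i \<in> set (i # js) then \<phi>' i (t i) else \<phi> i (t i)) *
      (\<Prod>j\<in>{1..d} - {i}. if j \<in> set (i # js) then \<phi>' j (t j) else \<phi> j (t j))"
      by (subst mult.commute) (auto intro!: arg_cong2[where f="(*)"] prod.cong)
  qed (use i in auto)
  finally show ?case .
qed simp

lemma anchored_deriv_product:
  assumes u: "u \<subseteq> {1..d}"
    and der: "\<And>j s. j \<in> {1..d} \<Longrightarrow> s \<in> {0..1} - K j \<Longrightarrow> (\<phi> j has_real_derivative \<phi>' j s) (at s)"
    and t: "\<And>j. j \<in> u \<Longrightarrow> t j \<in> {0..1} - K j"
  shows "anchored_deriv d u (\<lambda>x. \<Prod>j\<in>{1..d}. \<phi> j (x j)) t = (\<Prod>j\<in>u. \<phi>' j (t j)) * (\<Prod>j\<in>{1..d} - u. \<phi> j 0)"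
proof -
  have fin: "finite u" using u finite_subset by blast
  have "anchored_deriv d u (\<lambda>x. \<Prod>j\<in>{1..d}. \<phi> j (x j)) t =
     (\<Prod>j\<in>{1..d}. if j \<in> set (sorted_list_of_set u) then \<phi>' j (extend_by d u 0 t j) else \<phi> j (extend_by d u 0 t j))"
    unfolding anchored_deriv_def mixed_deriv_def
    using u t fin by (intro mixed_deriv_product[where K=K] der) (auto simp: extend_by_def subset_iff)
  also have "\<dots> = (\<Prod>j\<in>{1..d} - u. \<phi> j 0) * (\<Prod>j\<in>u. \<phi>' j (t j))"
    using u fin by (subst prod.subset_diff[OF u]) (auto simp: extend_by_def subset_iff intro!: arg_cong2[where f="(*)"] prod.cong)
  finally have "anchored_deriv d u (\<lambda>x. \<Prod>j\<in>{1..d}. \<phi> j (x j)) t = (\<Prod>j\<in>{1..d} - u. \<phi> j 0) * (\<Prod>j\<in>u. \<phi>' j (t j))" .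
  then show ?thesis by (simp add: mult.commute)
qed

context
  fixes d :: nat and \<phi> \<phi>' :: "nat \<Rightarrow> real \<Rightarrow> real"
  assumes pa: "\<And>j. j \<in> {1..d} \<Longrightarrow> piecewise_antideriv (\<phi> j) (\<phi>' j)"
begin

lemma AE_anchored_deriv_product:
  assumes u: "u \<subseteq> {1..d}"
  shows "AE t in lborel_pi u. t \<in> unit_cube u \<longrightarrow>
    anchored_deriv d u (\<lambda>x. \<Prod>j\<in>{1..d}. \<phi> j (x j)) t = (\<Prod>j\<in>u. \<phi>' j (t j)) * (\<Prod>j\<in>{1..d} - u. \<phi> j 0)"
proof -
  have "\<forall>j\<in>{1..d}. \<exists>K. finite K \<and> (\<forall>s\<in>{0..1} - K. (\<phi> j has_real_derivative \<phi>' j s) (at s))"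
    by (intro ballI piecewise_antiderivD(1) pa)
  then obtain K where K: "\<And>j. j \<in> {1..d} \<Longrightarrow> finite (K j)"
    "\<And>j s. j \<in> {1..d} \<Longrightarrow> s \<in> {0..1} - K j \<Longrightarrow> (\<phi> j has_real_derivative \<phi>' j s) (at s)"
    by metis
  have "AE t in lborel_pi u. \<forall>j\<in>u. t j \<notin> K j"
    using u K(1) by (intro AE_lborel_pi_notin finite_subset[OF u]) auto
  then show ?thesis
  proof eventually_elim
    case (elim t)
    show ?case
    proof
      assume "t \<in> unit_cube u"
      then have "\<And>j. j \<in> u \<Longrightarrow> t j \<in> {0..1} - K j" using elim by (auto simp: unit_cube_def)
      then show "anchored_deriv d u (\<lambda>x. \<Prod>j\<in>{1..d}. \<phi> j (x j)) t = (\<Prod>j\<in>u. \<phi>' j (t j)) * (\<Prod>j\<in>{1..d} - u. \<phi> j 0)"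
        using u K(2) by (intro anchored_deriv_product[where K=K]) auto
    qed
  qed
qed

lemma piecewise_antideriv_integrable:
  assumes j: "j \<in> {1..d}" and q: "0 \<le> q"
  shows "x \<in> {0..1} \<Longrightarrow> set_integrable lborel {0..x} (\<phi>' j)"
    and "set_integrable lborel {0..1} (\<lambda>s. \<bar>\<phi>' j s\<bar> powr q)"
    and "set_integrable lborel {0..1} (\<phi> j)"
proof -
  note [measurable] = piecewise_antiderivD(2)[OF pa[OF j]]
  note ftc = piecewise_antiderivD(4)[OF pa[OF j]]
  obtain B where "\<forall>s\<in>{0..1}. \<bar>\<phi>' j s\<bar> \<le> B" using piecewise_antiderivD(3)[OF pa[OF j]] by blast
  then have B: "\<bar>\<phi>' j s\<bar> \<le> B" if "s \<in> {0..1}" for s using that by blast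
  have I: "set_integrable lborel {0..x} (\<phi>' j)" if "x \<in> {0..1}" for x
    using that by (intro set_integrable_bounded_interval[where B=B] B) auto
  show "x \<in> {0..1} \<Longrightarrow> set_integrable lborel {0..x} (\<phi>' j)" by (rule I)
  show "set_integrable lborel {0..1} (\<lambda>s. \<bar>\<phi>' j s\<bar> powr q)"
  proof (rule set_integrable_bounded_interval)
    show "\<bar>\<bar>\<phi>' j s\<bar> powr q\<bar> \<le> B powr q" if "s \<in> {0..1}" for s
      using powr_mono2[OF q _ B[OF that]] by simp
  qed measurable
  \<comment> \<open>Integrability of \<phi> itself is obtained from continuity, which the integral
    representation provides.\<close>
  have "continuous_on {0..1} (\<lambda>x. LINT s:{0..x}|lborel. \<phi>' j s)"
  proof -
    have "(\<phi>' j) integrable_on {0..1}" using I[of 1] by (simp add: set_borel_integral_eq_integral(1))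
    then have "continuous_on {0..1} (\<lambda>x. integral {0..x} (\<phi>' j))" by (rule indefinite_integral_continuous_1)
    moreover have "integral {0..x} (\<phi>' j) = (LINT s:{0..x}|lborel. \<phi>' j s)" if "x \<in> {0..1}" for x
      using set_borel_integral_eq_integral(2)[OF I[OF that]] by simp
    ultimately show ?thesis by (rule continuous_on_eq)
  qed
  then have "continuous_on {0..1} (\<lambda>x. \<phi> j 0 + (LINT s:{0..x}|lborel. \<phi>' j s))" by (intro continuous_intros)
  then have "continuous_on {0..1} (\<phi> j)" by (rule continuous_on_eq) (rule ftc[symmetric])
  then show "set_integrable lborel {0..1} (\<phi> j)" by (rule borel_integrable_atLeastAtMost')
qed

lemma anchored_deriv_product_integrals:
  assumes u: "u \<subseteq> {1..d}" and q: "0 < q"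
  defines "f \<equiv> \<lambda>x::point. \<Prod>j\<in>{1..d}. \<phi> j (x j)"
  shows "in_Lq q u (anchored_deriv d u f)"
    and "x \<in> unit_cube {1..d} \<Longrightarrow> (LINT t:(\<Pi>\<^sub>E j\<in>u. {0..x j})|leb u. anchored_deriv d u f t)
           = (\<Prod>j\<in>u. LINT s:{0..x j}|lborel. \<phi>' j s) * (\<Prod>j\<in>{1..d} - u. \<phi> j 0)"
    and "(LINT t:unit_cube u|leb u. \<bar>anchored_deriv d u f t\<bar> powr q)
           = (\<Prod>j\<in>u. LINT s:{0..1}|lborel. \<bar>\<phi>' j s\<bar> powr q) * (\<Prod>j\<in>{1..d} - u. \<bar>\<phi> j 0\<bar> powr q)"
proof -
  have fin: "finite u" using u finite_subset by blast
  define c where "c = (\<Prod>j\<in>{1..d} - u. \<phi> j 0)"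
  \<comment> \<open>The Borel product that represents the anchored derivative almost everywhere; c
    collects the coordinates frozen at 0.\<close>
  define G where "G = (\<lambda>t::point. (\<Prod>j\<in>u. \<phi>' j (t j)) * c)"
  have [measurable]: "\<phi>' j \<in> borel_measurable borel" if "j \<in> u" for j
    using piecewise_antiderivD(2)[OF pa] u that by blast
  have G[measurable]: "G \<in> borel_measurable (lborel_pi u)" unfolding G_def
    by (intro borel_measurable_times borel_measurable_prod borel_measurable_const
        measurable_compose[OF measurable_component_singleton]) auto
  have ae: "AE t in lborel_pi u. t \<in> unit_cube u \<longrightarrow> anchored_deriv d u f t = G t"
    using AE_anchored_deriv_product[OF u] by (simp add: G_def c_def f_def)
  have aeq: "AE t in lborel_pi u. t \<in> unit_cube u \<longrightarrow> \<bar>anchored_deriv d u f t\<bar> powr q = \<bar>G t\<bar> powr q"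
    using ae by eventually_elim auto
  note cube = sets_unit_cube[OF fin]
  have sm: "set_borel_measurable (lborel_pi u) A g" if "A \<in> sets (lborel_pi u)" "g \<in> borel_measurable (lborel_pi u)" for A and g :: "point \<Rightarrow> real"
    using that by (simp add: set_borel_measurable_def)
  have smq: "set_borel_measurable (lborel_pi u) (unit_cube u) (\<lambda>t. \<bar>G t\<bar> powr q)"
    by (intro sm cube) measurable
  have Gq: "\<bar>G t\<bar> powr q = (\<Prod>j\<in>u. \<bar>\<phi>' j (t j)\<bar> powr q) * \<bar>c\<bar> powr q" for t
    by (simp add: G_def abs_mult powr_mult abs_prod prod_powr_distrib)
  have iq: "\<And>j. j \<in> u \<Longrightarrow> set_integrable lborel {0..1} (\<lambda>s. \<bar>\<phi>' j s\<bar> powr q)"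
    using piecewise_antideriv_integrable(2) u q by (auto simp: subset_iff)
  have "set_integrable (lborel_pi u) (unit_cube u) (\<lambda>t. \<bar>G t\<bar> powr q)"
    unfolding Gq unit_cube_def using set_integrable_box_prod[OF fin iq, of "\<lambda>j. j"]
    by (intro set_integrable_mult_left) auto
  then show "in_Lq q u (anchored_deriv d u f)"
    unfolding in_Lq_def leb_def using set_borel_measurable_completion[OF cube sm[OF cube G] ae]
      set_integrable_completion[OF cube smq aeq] by simp
  have "(LINT t:unit_cube u|leb u. \<bar>anchored_deriv d u f t\<bar> powr q) = (LINT t:unit_cube u|lborel_pi u. \<bar>G t\<bar> powr q)"
    unfolding leb_def by (rule set_integral_completion[OF cube smq aeq])
  also have "\<dots> = (\<Prod>j\<in>u. LINT s:{0..1}|lborel. \<bar>\<phi>' j s\<bar> powr q) * \<bar>c\<bar> powr q"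
    unfolding Gq unit_cube_def using set_integral_box_prod[OF fin iq, of "\<lambda>j. j"] by simp
  finally show "(LINT t:unit_cube u|leb u. \<bar>anchored_deriv d u f t\<bar> powr q)
           = (\<Prod>j\<in>u. LINT s:{0..1}|lborel. \<bar>\<phi>' j s\<bar> powr q) * (\<Prod>j\<in>{1..d} - u. \<bar>\<phi> j 0\<bar> powr q)"
    by (simp add: c_def abs_prod prod_powr_distrib)
  assume x: "x \<in> unit_cube {1..d}"
  let ?A = "\<Pi>\<^sub>E j\<in>u. {0..x j}"
  have A: "?A \<in> sets (lborel_pi u)" using fin by (intro sets_box) auto
  have "x j \<le> 1" if "j \<in> u" for j using x u that by (auto simp: unit_cube_def PiE_iff)
  then have sub: "?A \<subseteq> unit_cube u" unfolding unit_cube_def by (intro PiE_mono) auto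
  have "(LINT t:?A|leb u. anchored_deriv d u f t) = (LINT t:?A|lborel_pi u. G t)"
    unfolding leb_def
  proof (rule set_integral_completion[OF A sm[OF A G]])
    show "AE t in lborel_pi u. t \<in> ?A \<longrightarrow> anchored_deriv d u f t = G t"
      using ae sub by (auto elim!: eventually_mono)
  qed
  also have "\<dots> = (\<Prod>j\<in>u. LINT s:{0..x j}|lborel. \<phi>' j s) * c"
  proof -
    have "set_integrable lborel {0..x j} (\<phi>' j)" if "j \<in> u" for j
      using x u that by (intro piecewise_antideriv_integrable(1)[where q=1]) (auto simp: unit_cube_def)
    then show ?thesis unfolding G_def using set_integral_box_prod[OF fin, of "\<lambda>j. {0..x j}" \<phi>'] by simp
  qed
  finally show "(LINT t:?A|leb u. anchored_deriv d u f t)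
           = (\<Prod>j\<in>u. LINT s:{0..x j}|lborel. \<phi>' j s) * (\<Prod>j\<in>{1..d} - u. \<phi> j 0)"
    by (simp add: c_def)
qed

text \<open>Expanding the product of the factors \<phi>(0) + (integral of \<phi>' up to x) over all
  subsets u reproduces, term by term, the representation demanded by \<open>sobolev\<close>.\<close>

lemma sobolev_product:
  assumes q: "0 < q"
  shows "(\<lambda>x. \<Prod>j\<in>{1..d}. \<phi> j (x j)) \<in> sobolev q d"
  unfolding sobolev_def
proof (intro CollectI conjI ballI allI impI)
  fix x assume x: "x \<in> unit_cube {1..d}"
  have "(\<Prod>j\<in>{1..d}. \<phi> j (x j)) = (\<Prod>j\<in>{1..d}. (LINT s:{0..x j}|lborel. \<phi>' j s) + \<phi> j 0)"
  proof (rule prod.cong[OF refl])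
    fix j assume j: "j \<in> {1..d}"
    then have "x j \<in> {0..1}" using x by (auto simp: unit_cube_def)
    from piecewise_antiderivD(4)[OF pa[OF j] this] show "\<phi> j (x j) = (LINT s:{0..x j}|lborel. \<phi>' j s) + \<phi> j 0"
      by (simp only: add.commute)
  qed
  also have "\<dots> = (\<Sum>u\<in>Pow {1..d}. (\<Prod>j\<in>u. LINT s:{0..x j}|lborel. \<phi>' j s) * (\<Prod>j\<in>{1..d} - u. \<phi> j 0))"
    by (rule prod_add) simp
  also have "\<dots> = (\<Sum>u\<in>Pow {1..d}. LINT t:(\<Pi>\<^sub>E j\<in>u. {0..x j})|leb u.
      anchored_deriv d u (\<lambda>x. \<Prod>j\<in>{1..d}. \<phi> j (x j)) t)"
    by (intro sum.cong refl anchored_deriv_product_integrals(2)[OF _ q x, symmetric]) simp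
  finally show "(\<Prod>j\<in>{1..d}. \<phi> j (x j)) = (\<Sum>u\<in>Pow {1..d}. LINT t:(\<Pi>\<^sub>E j\<in>u. {0..x j})|leb u.
      anchored_deriv d u (\<lambda>x. \<Prod>j\<in>{1..d}. \<phi> j (x j)) t)" .
qed (rule anchored_deriv_product_integrals(1)[OF _ q])

text \<open>The same subset expansion, read backwards, makes the norm multiplicative: factors of
  one-dimensional norm 1 give a product of norm 1.\<close>

lemma sobolev_norm_product:
  assumes q: "0 < q" and \<gamma>: "\<And>j. j \<in> {1..d} \<Longrightarrow> 0 < \<gamma> j"
  shows "sobolev_norm q \<gamma> d (\<lambda>x. \<Prod>j\<in>{1..d}. \<phi> j (x j)) =
    (\<Prod>j\<in>{1..d}. \<gamma> j powr (- (q / 2)) * (LINT s:{0..1}|lborel. \<bar>\<phi>' j s\<bar> powr q) + \<bar>\<phi> j 0\<bar> powr q) powr (1 / q)"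
proof -
  have "1 / (\<Prod>j\<in>u. \<gamma> j) powr (q / 2) * (LINT t:unit_cube u|leb u. \<bar>anchored_deriv d u (\<lambda>x. \<Prod>j\<in>{1..d}. \<phi> j (x j)) t\<bar> powr q)
    = (\<Prod>j\<in>u. \<gamma> j powr (- (q / 2)) * (LINT s:{0..1}|lborel. \<bar>\<phi>' j s\<bar> powr q)) * (\<Prod>j\<in>{1..d} - u. \<bar>\<phi> j 0\<bar> powr q)"
    if u: "u \<in> Pow {1..d}" for u
  proof -
    have u': "u \<subseteq> {1..d}" using u by simp
    have "1 / (\<Prod>j\<in>u. \<gamma> j) powr (q / 2) = (\<Prod>j\<in>u. \<gamma> j powr (- (q / 2)))"
    proof -
      have "(\<Prod>j\<in>u. \<gamma> j powr (- (q / 2))) = (\<Prod>j\<in>u. inverse (\<gamma> j powr (q / 2)))"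
        by (simp only: powr_minus)
      also have "\<dots> = inverse ((\<Prod>j\<in>u. \<gamma> j) powr (q / 2))"
        by (simp only: prod_inversef[unfolded comp_def] prod_powr_distrib)
      finally show ?thesis by (simp only: divide_inverse mult_1_left)
    qed
    then show ?thesis unfolding anchored_deriv_product_integrals(3)[OF u' q] by (simp only: prod.distrib mult.assoc)
  qed
  then have "(\<Sum>u\<in>Pow {1..d}. 1 / (\<Prod>j\<in>u. \<gamma> j) powr (q / 2) *
      (LINT t:unit_cube u|leb u. \<bar>anchored_deriv d u (\<lambda>x. \<Prod>j\<in>{1..d}. \<phi> j (x j)) t\<bar> powr q))
    = (\<Prod>j\<in>{1..d}. \<gamma> j powr (- (q / 2)) * (LINT s:{0..1}|lborel. \<bar>\<phi>' j s\<bar> powr q) + \<bar>\<phi> j 0\<bar> powr q)"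
    unfolding prod_add[OF finite_atLeastAtMost] by (intro sum.cong refl)
  then show ?thesis unfolding sobolev_norm_def by (rule arg_cong)
qed

lemma integral_cube_product:
  "integral_cube d (\<lambda>x. \<Prod>j\<in>{1..d}. \<phi> j (x j)) = (\<Prod>j\<in>{1..d}. LINT s:{0..1}|lborel. \<phi> j s)"
proof -
  have I: "set_integrable lborel {0..1} (\<phi> j)" if "j \<in> {1..d}" for j
    using piecewise_antideriv_integrable(3)[OF that, of 1] by simp
  have sm: "set_borel_measurable (lborel_pi {1..d}) (unit_cube {1..d}) (\<lambda>x. \<Prod>j\<in>{1..d}. \<phi> j (x j))"
    using set_integrable_box_prod[OF _ I, of "{1..d}" "\<lambda>j. j"]
    unfolding set_integrable_def set_borel_measurable_def unit_cube_def by auto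
  have "integral_cube d (\<lambda>x. \<Prod>j\<in>{1..d}. \<phi> j (x j)) = (LINT x:unit_cube {1..d}|lborel_pi {1..d}. \<Prod>j\<in>{1..d}. \<phi> j (x j))"
    unfolding integral_cube_def leb_def by (rule set_integral_completion[OF _ sm]) auto
  also have "\<dots> = (\<Prod>j\<in>{1..d}. LINT s:{0..1}|lborel. \<phi> j s)"
    unfolding unit_cube_def using I by (intro set_integral_box_prod) auto
  finally show ?thesis .
qed

end

subsection \<open>Error bound for linear rules\<close>

lemma component_borel: "j \<in> u \<Longrightarrow> (\<lambda>t. t j) \<in> borel_measurable (lborel_pi u)"
  using measurable_component_singleton[of j u "\<lambda>_. lborel :: real measure"] by simp

text \<open>The kernel of point evaluation at x: integrating against it over the cube is integrating
  over the closed box [0, x]. The product form lets its integrals and its limits be taken coordinate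
  by coordinate.\<close>

definition dominated :: "nat set \<Rightarrow> point \<Rightarrow> point \<Rightarrow> real" where
  "dominated u t x = (\<Prod>j\<in>u. if t j \<le> x j then 1 else 0)"

lemma dominated_eq: "finite u \<Longrightarrow> dominated u t x = of_bool (\<forall>j\<in>u. t j \<le> x j)"
  by (auto simp: dominated_def intro!: prod.neutral)

lemma dominated_bounds: "0 \<le> dominated u t x" "dominated u t x \<le> 1"
  unfolding dominated_def by (auto intro!: prod_nonneg prod_le_1)

lemma measurable_dominated_left:
  "(\<lambda>t. dominated u t x) \<in> borel_measurable (lborel_pi u)"
  unfolding dominated_def
proof (rule borel_measurable_prod)
  fix j assume "j \<in> u"
  then have [measurable]: "(\<lambda>t. t j) \<in> borel_measurable (lborel_pi u)" by simp
  show "(\<lambda>t. if t j \<le> x j then 1 else 0 :: real) \<in> borel_measurable (lborel_pi u)" by measurable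
qed

lemma measurable_dominated_pair:
  assumes "u \<subseteq> v"
  shows "(\<lambda>(x, t). dominated u t x) \<in> borel_measurable (lborel_pi v \<Otimes>\<^sub>M lborel_pi u)"
  unfolding dominated_def case_prod_beta
proof (rule borel_measurable_prod)
  fix j assume j: "j \<in> u"
  have [measurable]: "(\<lambda>t. t j) \<in> borel_measurable (lborel_pi u)" using j by simp
  have "j \<in> v" using j assms by blast
  then have [measurable]: "(\<lambda>t. t j) \<in> borel_measurable (lborel_pi v)" by (rule component_borel)
  show "(\<lambda>z. if snd z j \<le> fst z j then 1 else 0 :: real) \<in> borel_measurable (lborel_pi v \<Otimes>\<^sub>M lborel_pi u)" by measurable
qed

lemma set_integral_dominated:
  assumes v: "finite v" "u \<subseteq> v" and t: "t \<in> unit_cube u"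
  shows "(LINT x:unit_cube v|lborel_pi v. dominated u t x) = (\<Prod>j\<in>u. 1 - t j)"
proof -
  \<comment> \<open>Factors equal to 1 for the coordinates outside u turn the integrand into a
    product over all of v.\<close>
  define F where "F = (\<lambda>j s. if j \<in> u \<and> \<not> t j \<le> s then 0 else 1 :: real)"
  have F: "set_integrable lborel {0..1} (F j)" for j
    unfolding F_def by (rule set_integrable_bounded_interval[where B=1]) auto
  have "dominated u t x = (\<Prod>j\<in>v. F j (x j))" for x
    unfolding dominated_def F_def using v
    by (subst prod.subset_diff[OF v(2,1)]) (auto intro!: prod.cong)
  then have "(LINT x:unit_cube v|lborel_pi v. dominated u t x) = (\<Prod>j\<in>v. LINT s:{0..1}|lborel. F j s)"
    unfolding unit_cube_def using set_integral_box_prod[OF v(1) F, of "\<lambda>j. j"] by simp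
  also have "\<dots> = (\<Prod>j\<in>v. if j \<in> u then 1 - t j else 1)"
  proof (rule prod.cong[OF refl])
    fix j
    show "(LINT s:{0..1}|lborel. F j s) = (if j \<in> u then 1 - t j else 1)"
    proof (cases "j \<in> u")
      case True
      then have tj: "0 \<le> t j" "t j \<le> 1" using t by (auto simp: unit_cube_def)
      have "(LINT s:{0..1}|lborel. F j s) = (LINT s|lborel. indicator {t j..1} s)"
        unfolding set_lebesgue_integral_def using True tj
        by (intro Bochner_Integration.integral_cong) (auto simp: F_def indicator_def)
      then show ?thesis using True tj by simp
    qed (simp add: F_def set_lebesgue_integral_def)
  qed
  also have "\<dots> = (\<Prod>j\<in>u. 1 - t j)"
    using v by (simp add: prod.If_cases Int_absorb1 inf.absorb2 Collect_mem_eq)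
  finally show ?thesis .
qed

text \<open>For a general member of the space nothing is known about the derivatives beyond
  measurability for the completion. One Borel version per u, chosen once, serves both for evaluating
  f and for its norm.\<close>

lemma sobolev_borel_derivs:
  assumes q: "1 < q" and f: "f \<in> sobolev q d"
  obtains G where
    "\<And>u. u \<subseteq> {1..d} \<Longrightarrow> G u \<in> borel_measurable (lborel_pi u)"
    "\<And>u. u \<subseteq> {1..d} \<Longrightarrow> AE t in lborel_pi u. t \<in> unit_cube u \<longrightarrow> anchored_deriv d u f t = G u t"
    "\<And>u. u \<subseteq> {1..d} \<Longrightarrow> set_integrable (lborel_pi u) (unit_cube u) (G u)"
    "\<And>u. u \<subseteq> {1..d} \<Longrightarrow> set_integrable (lborel_pi u) (unit_cube u) (\<lambda>t. \<bar>G u t\<bar> powr q)"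
    "\<And>u. u \<subseteq> {1..d} \<Longrightarrow> (LINT t:unit_cube u|leb u. \<bar>anchored_deriv d u f t\<bar> powr q)
        = (LINT t:unit_cube u|lborel_pi u. \<bar>G u t\<bar> powr q)"
proof -
  define good where "good = (\<lambda>u g. g \<in> borel_measurable (lborel_pi u) \<and>
     (AE t in lborel_pi u. t \<in> unit_cube u \<longrightarrow> anchored_deriv d u f t = g t) \<and>
     set_integrable (lborel_pi u) (unit_cube u) g \<and>
     set_integrable (lborel_pi u) (unit_cube u) (\<lambda>t. \<bar>g t\<bar> powr q) \<and>
     (LINT t:unit_cube u|leb u. \<bar>anchored_deriv d u f t\<bar> powr q)
        = (LINT t:unit_cube u|lborel_pi u. \<bar>g t\<bar> powr q))"
  have ex: "\<exists>g. good u g" if u: "u \<subseteq> {1..d}" for u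
  proof -
    have fin: "finite u" using u finite_subset by blast
    note cube = sets_unit_cube[OF fin]
    have L: "in_Lq q u (anchored_deriv d u f)" using f u by (simp add: sobolev_def)
    obtain g where g[measurable]: "g \<in> borel_measurable (lborel_pi u)"
      and ae: "AE t in lborel_pi u. indicator (unit_cube u) t *\<^sub>R anchored_deriv d u f t = g t"
      using L completion_ex_borel_measurable_real unfolding in_Lq_def leb_def set_borel_measurable_def by blast
    have ae: "AE t in lborel_pi u. t \<in> unit_cube u \<longrightarrow> anchored_deriv d u f t = g t"
      using ae by eventually_elim (auto simp: indicator_def)
    have aeq: "AE t in lborel_pi u. t \<in> unit_cube u \<longrightarrow> \<bar>anchored_deriv d u f t\<bar> powr q = \<bar>g t\<bar> powr q"
      using ae by eventually_elim auto
    have sm: "set_borel_measurable (lborel_pi u) (unit_cube u) (\<lambda>t. \<bar>g t\<bar> powr q)"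
      unfolding set_borel_measurable_def using cube by measurable
    have iq: "set_integrable (lborel_pi u) (unit_cube u) (\<lambda>t. \<bar>g t\<bar> powr q)"
      using L set_integrable_completion[OF cube sm aeq] by (simp add: in_Lq_def leb_def)
    \<comment> \<open>Since the cube has measure 1, this is an integrable majorant of g.\<close>
    have "set_integrable (lborel_pi u) (unit_cube u) (\<lambda>t. 1 + \<bar>g t\<bar> powr q)"
    proof (rule set_integral_add(1)[OF _ iq])
      show "set_integrable (lborel_pi u) (unit_cube u) (\<lambda>t. 1 :: real)"
        using fin cube by (intro set_integrable_unit_cube[where B=1]) (auto simp: set_borel_measurable_def)
    qed
    then have ig: "set_integrable (lborel_pi u) (unit_cube u) g"
      unfolding set_integrable_def
    proof (rule Bochner_Integration.integrable_bound)
      have "\<bar>g t\<bar> \<le> 1 + \<bar>g t\<bar> powr q" for t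
      proof (cases "\<bar>g t\<bar> \<le> 1")
        case False
        then have "\<bar>g t\<bar> powr 1 \<le> \<bar>g t\<bar> powr q" using q by (intro powr_mono) auto
        then show ?thesis using False by simp
      qed (auto intro: add_increasing2)
      then show "AE t in lborel_pi u. norm (indicator (unit_cube u) t *\<^sub>R g t) \<le> norm (indicator (unit_cube u) t *\<^sub>R (1 + \<bar>g t\<bar> powr q))"
        by (intro AE_I2) (auto simp: indicator_def)
    qed (use cube in measurable)
    show ?thesis unfolding leb_def good_def
      by (intro exI[of _ g] conjI g ae ig iq set_integral_completion[OF cube sm aeq])
  qed
  define G where "G = (\<lambda>u. SOME g. good u g)"
  have "good u (G u)" if "u \<subseteq> {1..d}" for u unfolding G_def using ex[OF that] by (rule someI_ex)
  then show ?thesis unfolding good_def by (intro that[of G]) blast+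
qed

context
  fixes q :: real and d f G
  assumes f: "f \<in> sobolev q d"
    and G: "\<And>u. u \<subseteq> {1..d} \<Longrightarrow> G u \<in> borel_measurable (lborel_pi u)"
    and ae: "\<And>u. u \<subseteq> {1..d} \<Longrightarrow> AE t in lborel_pi u. t \<in> unit_cube u \<longrightarrow> anchored_deriv d u f t = G u t"
    and int: "\<And>u. u \<subseteq> {1..d} \<Longrightarrow> set_integrable (lborel_pi u) (unit_cube u) (G u)"
begin

lemma sobolev_eval:
  assumes x: "x \<in> unit_cube {1..d}"
  shows "f x = (\<Sum>u\<in>Pow {1..d}. LINT t:unit_cube u|lborel_pi u. G u t * dominated u t x)"
proof -
  have "(LINT t:(\<Pi>\<^sub>E j\<in>u. {0..x j})|leb u. anchored_deriv d u f t)
      = (LINT t:unit_cube u|lborel_pi u. G u t * dominated u t x)" if u: "u \<subseteq> {1..d}" for u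
  proof -
    have fin: "finite u" using u finite_subset by blast
    let ?A = "\<Pi>\<^sub>E j\<in>u. {0..x j}"
    have x1: "x j \<le> 1" if "j \<in> u" for j using x u that by (auto simp: unit_cube_def PiE_iff)
    have A: "?A \<in> sets (lborel_pi u)" using fin by (intro sets_box) auto
    have sub: "?A \<subseteq> unit_cube u" unfolding unit_cube_def using x1 by (intro PiE_mono) auto
    have "(LINT t:?A|leb u. anchored_deriv d u f t) = (LINT t:?A|lborel_pi u. G u t)"
      unfolding leb_def
    proof (rule set_integral_completion[OF A])
      show "AE t in lborel_pi u. t \<in> ?A \<longrightarrow> anchored_deriv d u f t = G u t"
        using ae[OF u] by eventually_elim (use sub in blast)
      show "set_borel_measurable (lborel_pi u) ?A (G u)"
        unfolding set_borel_measurable_def using A G[OF u] by measurable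
    qed
    also have "\<dots> = (LINT t:unit_cube u|lborel_pi u. G u t * dominated u t x)"
      unfolding set_lebesgue_integral_def
    proof (rule Bochner_Integration.integral_cong[OF refl])
      fix t
      have "t \<in> ?A \<longleftrightarrow> t \<in> unit_cube u \<and> (\<forall>j\<in>u. t j \<le> x j)"
        using x1 by (auto simp: unit_cube_def PiE_iff dest: order_trans)
      then show "indicat_real ?A t *\<^sub>R G u t = indicat_real (unit_cube u) t *\<^sub>R (G u t * dominated u t x)"
        using fin by (simp add: dominated_eq indicator_def)
    qed
    finally show ?thesis .
  qed
  then have "(\<Sum>u\<in>Pow {1..d}. LINT t:(\<Pi>\<^sub>E j\<in>u. {0..x j})|leb u. anchored_deriv d u f t)
      = (\<Sum>u\<in>Pow {1..d}. LINT t:unit_cube u|lborel_pi u. G u t * dominated u t x)"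
    by (intro sum.cong refl) simp
  moreover have "f x = (\<Sum>u\<in>Pow {1..d}. LINT t:(\<Pi>\<^sub>E j\<in>u. {0..x j})|leb u. anchored_deriv d u f t)"
    using f x unfolding sobolev_def by blast
  ultimately show ?thesis by (rule trans[rotated])
qed

lemma integrable_deriv_mult:
  assumes u: "u \<subseteq> {1..d}" and h: "set_borel_measurable (lborel_pi u) (unit_cube u) h"
    and B: "\<And>t. t \<in> unit_cube u \<Longrightarrow> \<bar>h t\<bar> \<le> B"
  shows "set_integrable (lborel_pi u) (unit_cube u) (\<lambda>t. G u t * h t)"
  unfolding set_integrable_def
proof (rule Bochner_Integration.integrable_bound)
  have fin: "finite u" using u finite_subset by blast
  show "integrable (lborel_pi u) (\<lambda>t. indicator (unit_cube u) t *\<^sub>R G u t * B)"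
    using int[OF u] by (intro integrable_mult_left) (simp add: set_integrable_def)
  have "(\<lambda>t. (indicator (unit_cube u) t *\<^sub>R h t) * G u t) \<in> borel_measurable (lborel_pi u)"
    using h G[OF u] unfolding set_borel_measurable_def by measurable
  then show "(\<lambda>t. indicator (unit_cube u) t *\<^sub>R (G u t * h t)) \<in> borel_measurable (lborel_pi u)"
    by (simp add: mult_ac)
  have "\<bar>G u t * h t\<bar> \<le> \<bar>G u t * B\<bar>" if "t \<in> unit_cube u" for t
    unfolding abs_mult using B[OF that] by (intro mult_left_mono) auto
  then show "AE t in lborel_pi u. norm (indicator (unit_cube u) t *\<^sub>R (G u t * h t)) \<le> norm (indicator (unit_cube u) t *\<^sub>R G u t * B)"
    by (intro AE_I2) (auto simp: indicator_def)
qed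

text \<open>Integrating \<open>sobolev_eval\<close> over x and exchanging the integrals replaces
  \<open>dominated u t x\<close> by its mean over x, which is the product of the 1 - t j.\<close>

lemma integral_cube_sobolev:
  "integral_cube d f = (\<Sum>u\<in>Pow {1..d}. LINT t:unit_cube u|lborel_pi u. G u t * (\<Prod>j\<in>u. 1 - t j))"
proof -
  define F where "F = (\<lambda>u x. LINT t:unit_cube u|lborel_pi u. G u t * dominated u t x)"
  have main: "F u \<in> borel_measurable (lborel_pi {1..d}) \<and> set_integrable (lborel_pi {1..d}) (unit_cube {1..d}) (F u) \<and>
      (LINT x:unit_cube {1..d}|lborel_pi {1..d}. F u x) = (LINT t:unit_cube u|lborel_pi u. G u t * (\<Prod>j\<in>u. 1 - t j))"
    if u: "u \<subseteq> {1..d}" for u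
  proof -
    have fin: "finite u" using u finite_subset by blast
    let ?D = "{1..d}"
    interpret D: sigma_finite_measure "lborel_pi ?D" by (rule lborel_pi.sigma_finite) simp
    interpret U: sigma_finite_measure "lborel_pi u" by (rule lborel_pi.sigma_finite[OF fin])
    interpret P: pair_sigma_finite "lborel_pi ?D" "lborel_pi u" ..
    have [measurable]: "unit_cube u \<in> sets (lborel_pi u)" "unit_cube ?D \<in> sets (lborel_pi ?D)"
      using fin by (auto intro: sets_unit_cube)
    note [measurable] = G[OF u] measurable_dominated_pair[OF u]
    define H where "H = (\<lambda>x t. indicator (unit_cube ?D) x * (indicator (unit_cube u) t * (G u t * dominated u t x)) :: real)"
    have dm[measurable]: "(\<lambda>z. dominated u (snd z) (fst z)) \<in> borel_measurable (lborel_pi ?D \<Otimes>\<^sub>M lborel_pi u)"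
      using measurable_dominated_pair[OF u] by (simp add: case_prod_beta')
    have Hm: "(\<lambda>(x, t). H x t) \<in> borel_measurable (lborel_pi ?D \<Otimes>\<^sub>M lborel_pi u)"
      unfolding H_def case_prod_beta by measurable
    \<comment> \<open>E is H without the factor \<open>dominated\<close>, which lies in [0, 1]. It
      separates the variables x and t, so its integrability is immediate, and it dominates
      H.\<close>
    define E where "E = (\<lambda>x t. indicator (unit_cube ?D) x * (indicator (unit_cube u) t * G u t) :: real)"
    have iG: "integrable (lborel_pi u) (\<lambda>t. indicator (unit_cube u) t * G u t)"
      using int[OF u] by (simp add: set_integrable_def)
    have "integrable (lborel_pi ?D \<Otimes>\<^sub>M lborel_pi u) (\<lambda>(x, t). E x t)"
    proof (rule P.Fubini_integrable)
      show "(\<lambda>(x, t). E x t) \<in> borel_measurable (lborel_pi ?D \<Otimes>\<^sub>M lborel_pi u)"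
        unfolding E_def case_prod_beta by measurable
      have "integrable (lborel_pi ?D) (indicator (unit_cube ?D) :: point \<Rightarrow> real)"
        by (intro integrable_real_indicator) (auto simp: emeasure_unit_cube)
      then show "integrable (lborel_pi ?D) (\<lambda>x. LINT t|lborel_pi u. norm (case (x, t) of (x, t) \<Rightarrow> E x t))"
        by (simp add: E_def abs_mult)
      show "AE x in lborel_pi ?D. integrable (lborel_pi u) (\<lambda>t. case (x, t) of (x, t) \<Rightarrow> E x t)"
        using iG by (simp add: E_def)
    qed
    then have HI: "integrable (lborel_pi ?D \<Otimes>\<^sub>M lborel_pi u) (\<lambda>(x, t). H x t)"
    proof (rule Bochner_Integration.integrable_bound)
      have "\<bar>dominated u t x\<bar> \<le> 1" for t x using dominated_bounds[of u t x] by simp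
      then have "\<bar>H x t\<bar> \<le> \<bar>E x t\<bar>" for x t
        by (auto simp: H_def E_def abs_mult indicator_def intro: mult_left_le)
      then show "AE z in lborel_pi ?D \<Otimes>\<^sub>M lborel_pi u. norm (case z of (x, t) \<Rightarrow> H x t) \<le> norm (case z of (x, t) \<Rightarrow> E x t)"
        by (intro AE_I2) (simp add: case_prod_beta)
    qed (rule Hm)
    have FH: "indicator (unit_cube ?D) x * F u x = (LINT t|lborel_pi u. H x t)" for x
      by (simp add: F_def H_def set_lebesgue_integral_def)
    have "F u \<in> borel_measurable (lborel_pi ?D)"
      unfolding F_def set_lebesgue_integral_def
    proof (rule U.borel_measurable_lebesgue_integral)
      show "(\<lambda>(x, t). indicat_real (unit_cube u) t *\<^sub>R (G u t * dominated u t x)) \<in> borel_measurable (lborel_pi ?D \<Otimes>\<^sub>M lborel_pi u)"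
        unfolding case_prod_beta by measurable
    qed
    moreover have "set_integrable (lborel_pi ?D) (unit_cube ?D) (F u)"
      unfolding set_integrable_def real_scaleR_def FH by (rule P.integrable_fst[OF HI])
    moreover have "(LINT x:unit_cube ?D|lborel_pi ?D. F u x) = (LINT t:unit_cube u|lborel_pi u. G u t * (\<Prod>j\<in>u. 1 - t j))"
    proof -
      have "(LINT x:unit_cube ?D|lborel_pi ?D. F u x) = (LINT x|lborel_pi ?D. LINT t|lborel_pi u. H x t)"
        unfolding set_lebesgue_integral_def real_scaleR_def FH ..
      also have "\<dots> = (LINT t|lborel_pi u. LINT x|lborel_pi ?D. H x t)" by (rule P.Fubini_integral[OF HI, symmetric])
      also have "\<dots> = (LINT t:unit_cube u|lborel_pi u. G u t * (\<Prod>j\<in>u. 1 - t j))"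
        unfolding set_lebesgue_integral_def
      proof (rule Bochner_Integration.integral_cong[OF refl])
        fix t
        show "(LINT x|lborel_pi ?D. H x t) = indicat_real (unit_cube u) t *\<^sub>R (G u t * (\<Prod>j\<in>u. 1 - t j))"
        proof (cases "t \<in> unit_cube u")
          case True
          have "(LINT x|lborel_pi ?D. H x t) = (LINT x|lborel_pi ?D. G u t * (indicator (unit_cube ?D) x * dominated u t x))"
            using True by (simp add: H_def mult_ac)
          also have "\<dots> = G u t * (LINT x:unit_cube ?D|lborel_pi ?D. dominated u t x)"
            by (simp add: set_lebesgue_integral_def)
          finally show ?thesis using set_integral_dominated[OF _ u True] True by simp
        qed (simp add: H_def)
      qed
      finally show ?thesis .
    qed
    ultimately show ?thesis by blast
  qed
  have m: "set_borel_measurable (lborel_pi {1..d}) (unit_cube {1..d}) (\<lambda>x. \<Sum>u\<in>Pow {1..d}. F u x)"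
    using main sets_unit_cube[of "{1..d}"] unfolding set_borel_measurable_def
    by (intro borel_measurable_scaleR borel_measurable_sum) auto
  have "integral_cube d f = (LINT x:unit_cube {1..d}|lborel_pi {1..d}. \<Sum>u\<in>Pow {1..d}. F u x)"
    unfolding integral_cube_def leb_def
    by (rule set_integral_completion[OF _ m]) (auto simp: F_def sobolev_eval)
  also have "\<dots> = (\<Sum>u\<in>Pow {1..d}. LINT x:unit_cube {1..d}|lborel_pi {1..d}. F u x)"
    using main unfolding set_lebesgue_integral_def set_integrable_def scaleR_sum_right
    by (intro Bochner_Integration.integral_sum) auto
  also have "\<dots> = (\<Sum>u\<in>Pow {1..d}. LINT t:unit_cube u|lborel_pi u. G u t * (\<Prod>j\<in>u. 1 - t j))"
    using main by (intro sum.cong) auto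
  finally show ?thesis .
qed

end

text \<open>The representer of integral minus rule, acting on the derivative in the coordinates u.
  For u = {} it is 1 minus the sum of the weights, the error on the constant 1; for N = 0 it
  represents the integral alone.\<close>

definition error_kernel :: "nat \<Rightarrow> (nat \<Rightarrow> real) \<Rightarrow> (nat \<Rightarrow> point) \<Rightarrow> nat set \<Rightarrow> point \<Rightarrow> real" where
  "error_kernel N a x u t = (\<Prod>j\<in>u. 1 - t j) - (\<Sum>k=1..N. a k * dominated u t (x k))"

lemma measurable_error_kernel: "error_kernel N a x u \<in> borel_measurable (lborel_pi u)"
  unfolding error_kernel_def
proof (intro borel_measurable_diff borel_measurable_prod borel_measurable_sum borel_measurable_times
    borel_measurable_const measurable_dominated_left)
  fix j assume "j \<in> u"
  then show "(\<lambda>t. t j) \<in> borel_measurable (lborel_pi u)" by simp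
qed

lemma set_borel_measurableI:
  fixes h :: "point \<Rightarrow> real"
  assumes [measurable]: "finite u" "h \<in> borel_measurable (lborel_pi u)"
  shows "set_borel_measurable (lborel_pi u) (unit_cube u) h"
  using sets_unit_cube[OF assms(1)] unfolding set_borel_measurable_def by measurable

lemma error_kernel_bound:
  assumes t: "t \<in> unit_cube u"
  shows "\<bar>error_kernel N a x u t\<bar> \<le> 1 + (\<Sum>k=1..N. \<bar>a k\<bar>)"
proof -
  have "\<bar>\<Prod>j\<in>u. 1 - t j\<bar> \<le> 1"
    unfolding abs_prod using t by (intro prod_le_1) (auto simp: unit_cube_def PiE_iff)
  moreover have "\<bar>\<Sum>k=1..N. a k * dominated u t (x k)\<bar> \<le> (\<Sum>k=1..N. \<bar>a k\<bar>)"
    using dominated_bounds[of u t]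
    by (intro order_trans[OF sum_abs] sum_mono) (auto simp: abs_mult intro!: mult_left_le)
  ultimately show ?thesis unfolding error_kernel_def by linarith
qed

text \<open>Hoelder's inequality over all pairs (u, t) at once, proved by Young's inequality for the
  normalised factors. The bound S is an arbitrary positive majorant of the kernel norm, so that
  dividing by S is possible even when the kernel vanishes.\<close>

lemma integration_error_bound:
  assumes q: "1 < q" and p: "1 < p" "1 / p + 1 / q = 1" and \<gamma>: "\<And>j. j \<in> {1..d} \<Longrightarrow> 0 < \<gamma> j"
    and f: "f \<in> sobolev_ball q \<gamma> d" and x: "\<And>k. k \<in> {1..N} \<Longrightarrow> x k \<in> unit_cube {1..d}"
    and S: "0 < S" "(\<Sum>u\<in>Pow {1..d}. (\<Prod>j\<in>u. \<gamma> j) powr (p / 2) *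
        (LINT t:unit_cube u|lborel_pi u. \<bar>error_kernel N a x u t\<bar> powr p)) \<le> S powr p"
  shows "\<bar>integral_cube d f - linear_rule N a x f\<bar> \<le> S"
proof -
  let ?P = "Pow {1..d}"
  have fs: "f \<in> sobolev q d" and fn: "sobolev_norm q \<gamma> d f \<le> 1" using f by (auto simp: sobolev_ball_def)
  obtain G where G: "\<And>u. u \<subseteq> {1..d} \<Longrightarrow> G u \<in> borel_measurable (lborel_pi u)"
    and ae: "\<And>u. u \<subseteq> {1..d} \<Longrightarrow> AE t in lborel_pi u. t \<in> unit_cube u \<longrightarrow> anchored_deriv d u f t = G u t"
    and iG: "\<And>u. u \<subseteq> {1..d} \<Longrightarrow> set_integrable (lborel_pi u) (unit_cube u) (G u)"
    and iGq: "\<And>u. u \<subseteq> {1..d} \<Longrightarrow> set_integrable (lborel_pi u) (unit_cube u) (\<lambda>t. \<bar>G u t\<bar> powr q)"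
    and Gq: "\<And>u. u \<subseteq> {1..d} \<Longrightarrow> (LINT t:unit_cube u|leb u. \<bar>anchored_deriv d u f t\<bar> powr q)
        = (LINT t:unit_cube u|lborel_pi u. \<bar>G u t\<bar> powr q)"
    by (rule sobolev_borel_derivs[OF q fs]) (rule that)
  note ctx = fs G ae iG
  have eval: "f y = (\<Sum>u\<in>Pow {1..d}. LINT t:unit_cube u|lborel_pi u. G u t * dominated u t y)"
    if "y \<in> unit_cube {1..d}" for y by (rule sobolev_eval[OF ctx that])
  have Icube: "integral_cube d f = (\<Sum>u\<in>Pow {1..d}. LINT t:unit_cube u|lborel_pi u. G u t * (\<Prod>j\<in>u. 1 - t j))"
    by (rule integral_cube_sobolev[OF ctx])
  define K where "K = error_kernel N a x"
  define w where "w = (\<lambda>u. \<Prod>j\<in>u. \<gamma> j)"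
  have w: "0 < w u" if "u \<in> ?P" for u unfolding w_def using that \<gamma> by (intro prod_pos) auto
  have fin: "finite u" if "u \<in> ?P" for u using that finite_subset[of u "{1..d}"] by auto
  have im: "set_integrable (lborel_pi u) (unit_cube u) (\<lambda>t. G u t * h t)"
    if "u \<in> ?P" "h \<in> borel_measurable (lborel_pi u)" "\<And>t. t \<in> unit_cube u \<Longrightarrow> \<bar>h t\<bar> \<le> B" for u h B
    using that fin by (intro integrable_deriv_mult[OF ctx] set_borel_measurableI) auto
  \<comment> \<open>The kernel of the rule without nodes is this product, so the general kernel
    facts apply to it.\<close>
  have meas1: "(\<lambda>t. \<Prod>j\<in>u. 1 - t j) \<in> borel_measurable (lborel_pi u)" for u :: "nat set"
    using measurable_error_kernel[of 0 a x u] by (simp add: error_kernel_def)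
  have i1: "set_integrable (lborel_pi u) (unit_cube u) (\<lambda>t. G u t * (\<Prod>j\<in>u. 1 - t j))" if "u \<in> ?P" for u
    using error_kernel_bound[of _ u 0 a x] by (intro im[OF that meas1, where B=1]) (simp add: error_kernel_def)
  have i2: "set_integrable (lborel_pi u) (unit_cube u) (\<lambda>t. G u t * dominated u t (x k))" if "u \<in> ?P" for u k
    using dominated_bounds by (intro im[OF that measurable_dominated_left, where B=1]) (simp add: abs_of_nonneg)
  have i3: "set_integrable (lborel_pi u) (unit_cube u) (\<lambda>t. G u t * K u t)" if "u \<in> ?P" for u
    unfolding K_def by (rule im[OF that measurable_error_kernel error_kernel_bound])
  have i4: "set_integrable (lborel_pi u) (unit_cube u) (\<lambda>t. \<bar>K u t\<bar> powr p)" if u: "u \<in> ?P" for u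
  proof (rule set_integrable_unit_cube[OF fin[OF u]])
    show "set_borel_measurable (lborel_pi u) (unit_cube u) (\<lambda>t. \<bar>K u t\<bar> powr p)"
      unfolding K_def
      by (intro set_borel_measurableI fin[OF u] measurable_abs_powr
          measurable_error_kernel)
    fix t assume "t \<in> unit_cube u"
    then show "\<bar>\<bar>K u t\<bar> powr p\<bar> \<le> (1 + (\<Sum>k=1..N. \<bar>a k\<bar>)) powr p"
      using powr_mono2[OF _ _ error_kernel_bound[of t u N a x], of p] p unfolding K_def by simp
  qed
  have rule_eq: "linear_rule N a x f = (\<Sum>u\<in>?P. LINT t:unit_cube u|lborel_pi u. G u t * (\<Sum>k=1..N. a k * dominated u t (x k)))"
  proof -
    have "linear_rule N a x f = (\<Sum>k=1..N. a k * (\<Sum>u\<in>?P. LINT t:unit_cube u|lborel_pi u. G u t * dominated u t (x k)))"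
      unfolding linear_rule_def
    proof (rule sum.cong[OF refl])
      fix k assume k: "k \<in> {1..N}"
      show "a k * f (x k) = a k * (\<Sum>u\<in>?P. LINT t:unit_cube u|lborel_pi u. G u t * dominated u t (x k))"
        by (subst eval[OF x[OF k]]) (rule refl)
    qed
    also have "\<dots> = (\<Sum>u\<in>?P. \<Sum>k=1..N. a k * (LINT t:unit_cube u|lborel_pi u. G u t * dominated u t (x k)))"
      unfolding sum_distrib_left by (rule sum.swap)
    also have "\<dots> = (\<Sum>u\<in>?P. LINT t:unit_cube u|lborel_pi u. G u t * (\<Sum>k=1..N. a k * dominated u t (x k)))"
    proof (rule sum.cong[OF refl])
      fix u assume u: "u \<in> ?P"
      have "(\<Sum>k=1..N. a k * (LINT t:unit_cube u|lborel_pi u. G u t * dominated u t (x k)))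
         = (\<Sum>k=1..N. (LINT t|lborel_pi u. a k * (indicator (unit_cube u) t *\<^sub>R (G u t * dominated u t (x k)))))"
        by (simp add: set_lebesgue_integral_def)
      also have "\<dots> = (LINT t|lborel_pi u. (\<Sum>k=1..N. a k * (indicator (unit_cube u) t *\<^sub>R (G u t * dominated u t (x k)))))"
        using i2[OF u] unfolding set_integrable_def
        by (intro Bochner_Integration.integral_sum[symmetric] integrable_mult_right) auto
      also have "\<dots> = (LINT t:unit_cube u|lborel_pi u. G u t * (\<Sum>k=1..N. a k * dominated u t (x k)))"
        unfolding set_lebesgue_integral_def
        by (intro Bochner_Integration.integral_cong refl) (simp add: sum_distrib_left mult_ac)
      finally show "(\<Sum>k=1..N. a k * (LINT t:unit_cube u|lborel_pi u. G u t * dominated u t (x k)))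
        = (LINT t:unit_cube u|lborel_pi u. G u t * (\<Sum>k=1..N. a k * dominated u t (x k)))" .
    qed
    finally show ?thesis .
  qed
  have ker_eq: "G u t * (\<Sum>k=1..N. a k * dominated u t (x k)) = G u t * (\<Prod>j\<in>u. 1 - t j) - G u t * K u t" for u t
    by (simp add: K_def error_kernel_def algebra_simps)
  have "integral_cube d f - linear_rule N a x f = (\<Sum>u\<in>?P. LINT t:unit_cube u|lborel_pi u. G u t * K u t)"
    unfolding rule_eq Icube ker_eq sum_subtractf[symmetric]
    by (intro sum.cong refl) (simp add: set_integral_diff i1 i3)
  also have "\<bar>\<dots>\<bar> \<le> (\<Sum>u\<in>?P. \<bar>LINT t:unit_cube u|lborel_pi u. G u t * K u t\<bar>)" by (rule sum_abs)
  also have "\<dots> \<le> (\<Sum>u\<in>?P. S * (1 / w u powr (q / 2) * (LINT t:unit_cube u|lborel_pi u. \<bar>G u t\<bar> powr q) / q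
      + w u powr (p / 2) * (LINT t:unit_cube u|lborel_pi u. \<bar>K u t\<bar> powr p) / S powr p / p))"
  proof (rule sum_mono)
    fix u assume u: "u \<in> ?P"
    define A where "A = S * (1 / w u powr (q / 2)) / q"
    define C where "C = S * w u powr (p / 2) / S powr p / p"
    have young: "\<bar>G u t * K u t\<bar> \<le> A * \<bar>G u t\<bar> powr q + C * \<bar>K u t\<bar> powr p" for t
    proof -
      \<comment> \<open>Dividing G and multiplying K by the root of the weight produces the factors
        of the Sobolev norm (power -q/2) and of the discrepancy (power p/2).\<close>
      let ?r = "w u powr (1 / 2)"
      have r: "0 < ?r" using w[OF u] by simp
      have "(\<bar>G u t\<bar> / ?r) * (?r * \<bar>K u t\<bar> / S) \<le> (\<bar>G u t\<bar> / ?r) powr q / q + (?r * \<bar>K u t\<bar> / S) powr p / p"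
        using q p S r by (intro Youngs_inequality) (auto simp: add.commute)
      moreover have "(\<bar>G u t\<bar> / ?r) powr q = 1 / w u powr (q / 2) * \<bar>G u t\<bar> powr q"
        using r by (simp add: powr_divide powr_powr)
      moreover have "(?r * \<bar>K u t\<bar> / S) powr p = w u powr (p / 2) * \<bar>K u t\<bar> powr p / S powr p"
        using r S by (simp add: powr_divide powr_powr powr_mult)
      ultimately have "S * ((\<bar>G u t\<bar> / ?r) * (?r * \<bar>K u t\<bar> / S))
          \<le> S * (1 / w u powr (q / 2) * \<bar>G u t\<bar> powr q / q + w u powr (p / 2) * \<bar>K u t\<bar> powr p / S powr p / p)"
        using S by (intro mult_left_mono) auto
      then show ?thesis using r S by (simp add: A_def C_def abs_mult distrib_left mult_ac)
    qed
    have i5: "set_integrable (lborel_pi u) (unit_cube u) (\<lambda>t. A * \<bar>G u t\<bar> powr q)"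
      using iGq u by (intro set_integrable_mult_right) auto
    have i6: "set_integrable (lborel_pi u) (unit_cube u) (\<lambda>t. C * \<bar>K u t\<bar> powr p)"
      using i4[OF u] by (intro set_integrable_mult_right) auto
    have "\<bar>LINT t:unit_cube u|lborel_pi u. G u t * K u t\<bar> \<le> (LINT t:unit_cube u|lborel_pi u. \<bar>G u t * K u t\<bar>)"
      using set_integral_norm_bound[OF i3[OF u]] by simp
    also have "\<dots> \<le> (LINT t:unit_cube u|lborel_pi u. A * \<bar>G u t\<bar> powr q + C * \<bar>K u t\<bar> powr p)"
      using i3[OF u] i5 i6 young by (intro set_integral_mono set_integrable_abs set_integral_add(1)) auto
    also have "\<dots> = A * (LINT t:unit_cube u|lborel_pi u. \<bar>G u t\<bar> powr q) + C * (LINT t:unit_cube u|lborel_pi u. \<bar>K u t\<bar> powr p)"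
      by (subst set_integral_add(2)[OF i5 i6]) simp
    finally show "\<bar>LINT t:unit_cube u|lborel_pi u. G u t * K u t\<bar> \<le>
        S * (1 / w u powr (q / 2) * (LINT t:unit_cube u|lborel_pi u. \<bar>G u t\<bar> powr q) / q
      + w u powr (p / 2) * (LINT t:unit_cube u|lborel_pi u. \<bar>K u t\<bar> powr p) / S powr p / p)"
      by (simp add: A_def C_def distrib_left mult_ac)
  qed
  also have "\<dots> = S * ((\<Sum>u\<in>?P. 1 / w u powr (q / 2) * (LINT t:unit_cube u|lborel_pi u. \<bar>G u t\<bar> powr q)) / q
      + (\<Sum>u\<in>?P. w u powr (p / 2) * (LINT t:unit_cube u|lborel_pi u. \<bar>K u t\<bar> powr p)) / S powr p / p)"
    by (simp only: sum_distrib_left[symmetric] sum.distrib sum_divide_distrib)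
  also have "\<dots> \<le> S * (1 / q + 1 / p)"
  proof (intro mult_left_mono add_mono divide_right_mono)
    let ?n = "\<Sum>u\<in>?P. 1 / w u powr (q / 2) * (LINT t:unit_cube u|lborel_pi u. \<bar>G u t\<bar> powr q)"
    have "sobolev_norm q \<gamma> d f = ?n powr (1 / q)"
      unfolding sobolev_norm_def w_def by (intro arg_cong2[where f="(powr)"] sum.cong refl) (simp add: Gq)
    then have "?n powr (1 / q) \<le> 1" using fn by simp
    moreover have "1 < ?n powr (1 / q)" if "1 < ?n" using that q by (intro gr_one_powr) auto
    ultimately show "?n \<le> 1" by (meson not_le)
    show "(\<Sum>u\<in>?P. w u powr (p / 2) * (LINT t:unit_cube u|lborel_pi u. \<bar>K u t\<bar> powr p)) / S powr p \<le> 1"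
      using S unfolding w_def K_def by simp
  qed (use q p S in auto)
  finally show ?thesis using p(2) by (simp add: add.commute)
qed

subsection \<open>Extremal functions\<close>

lemma piecewise_antiderivI:
  fixes F F' :: "real \<Rightarrow> real"
  assumes cont: "continuous_on {0..1} F" and K: "finite K"
    and der: "\<And>s. s \<in> {0..1} - K \<Longrightarrow> (F has_real_derivative F' s) (at s)"
    and meas: "F' \<in> borel_measurable borel" and B: "\<And>s. s \<in> {0..1} \<Longrightarrow> \<bar>F' s\<bar> \<le> B"
  shows "piecewise_antideriv F F'"
proof -
  have ftc: "F x = F 0 + (LINT s:{0..x}|lborel. F' s)" if x: "x \<in> {0..1}" for x
  proof -
    have "(F' has_integral (F x - F 0)) {0..x}"
    proof (rule fundamental_theorem_of_calculus_strong[OF K])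
      show "continuous_on {0..x} F" by (rule continuous_on_subset[OF cont]) (use x in auto)
      show "(F has_vector_derivative F' s) (at s)" if "s \<in> {0..x} - K" for s
        using der[of s] that x by (auto simp: has_real_derivative_iff_has_vector_derivative)
    qed (use x in auto)
    moreover have "set_integrable lborel {0..x} F'"
      using x by (intro set_integrable_bounded_interval[OF meas, of _ _ B] B) auto
    ultimately show ?thesis by (simp add: set_borel_integral_eq_integral(2) integral_unique)
  qed
  show ?thesis unfolding piecewise_antideriv_def
    using K der meas B by (intro conjI ballI ftc exI[of _ K] exI[of _ B]) auto
qed

lemma set_integral_one_minus_powr:
  fixes a :: real
  assumes a: "0 < a"
  shows "(LINT s:{0..1}|lborel. (1 - s) powr a) = 1 / (a + 1)"
proof -
  define F where "F = (\<lambda>s::real. - ((1 - s) powr (a + 1) / (a + 1)))"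
  \<comment> \<open>The point 1 is exceptional because the base 1 - s is negative beyond it.\<close>
  have "piecewise_antideriv F (\<lambda>s. (1 - s) powr a)"
  proof (rule piecewise_antiderivI[where K="{1}" and B=1])
    show "continuous_on {0..1} F" unfolding F_def
      using a by (intro continuous_intros continuous_on_powr') auto
    fix s :: real assume "s \<in> {0..1} - {1}"
    then show "(F has_real_derivative (1 - s) powr a) (at s)"
      unfolding F_def using a by (auto intro!: derivative_eq_intros)
  next
    fix s :: real assume "s \<in> {0..1}"
    then show "\<bar>(1 - s) powr a\<bar> \<le> 1" using a by (auto intro!: powr_le1)
  qed auto
  from piecewise_antiderivD(4)[OF this, of 1] show ?thesis using a by (simp add: F_def)
qed

lemma set_integrable_one_minus_powr:
  fixes a :: real
  assumes a: "0 \<le> a"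
  shows "set_integrable lborel {0..1} (\<lambda>s. (1 - s) powr a)"
  using a by (intro set_integrable_bounded_interval[where B=1]) (auto intro!: powr_le1)

text \<open>Equality in Hoelder's inequality against the kernel of the integral, which is 1 for u =
  {} and 1 - t for the derivative, forces f(0) = 1 and f'(t) = g * (1 - t) powr (p - 1) up to a
  factor. The numerator is the antiderivative, and the denominator makes the norm equal to
  1.\<close>

definition extremal :: "real \<Rightarrow> real \<Rightarrow> real \<Rightarrow> real \<Rightarrow> real" where
  "extremal p q g y = (1 + g * (1 - (1 - y) powr p) / p) / (1 + g / (p + 1)) powr (1 / q)"

text \<open>The analogous equality case for evaluation at y, whose kernel is 1 and the indicator of
  t \<le> y: slope g up to the knot y, constant afterwards. Its value at the knot is (1 + g y) powr
  (1/p).\<close>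

definition spline :: "real \<Rightarrow> real \<Rightarrow> real \<Rightarrow> real \<Rightarrow> real" where
  "spline q g y x = (1 + g * min x y) / (1 + g * y) powr (1 / q)"

definition extremal_deriv :: "real \<Rightarrow> real \<Rightarrow> real \<Rightarrow> real \<Rightarrow> real" where
  "extremal_deriv p q g s = g * (1 - s) powr (p - 1) / (1 + g / (p + 1)) powr (1 / q)"

definition spline_deriv :: "real \<Rightarrow> real \<Rightarrow> real \<Rightarrow> real \<Rightarrow> real" where
  "spline_deriv q g y s = (if s < y then g / (1 + g * y) powr (1 / q) else 0)"

context
  fixes p q g :: real
  assumes p: "1 < p" and q: "1 < q" and pq: "1 / p + 1 / q = 1" and g: "0 < g" "g \<le> 1"
begin

lemma conjugate_exponents: "p * q = p + q" "(p - 1) * q = p" "1 / q = 1 - 1 / p"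
proof -
  show 1: "p * q = p + q" using pq p q by (simp add: field_simps)
  then show "(p - 1) * q = p" by (simp add: algebra_simps)
  show "1 / q = 1 - 1 / p" using pq by simp
qed

lemma piecewise_antideriv_extremal: "piecewise_antideriv (extremal p q g) (extremal_deriv p q g)"
proof (rule piecewise_antiderivI[where K="{1}" and B="g / (1 + g / (p + 1)) powr (1 / q)"])
  show "continuous_on {0..1} (extremal p q g)" unfolding extremal_def
  proof -
    have "continuous_on {0..1} (\<lambda>s::real. (1 - s) powr p)"
      using p by (intro continuous_on_powr' continuous_intros) auto
    then show "continuous_on {0..1} (\<lambda>y. (1 + g * (1 - (1 - y) powr p) / p) / (1 + g / (p + 1)) powr (1 / q))"
      using p g by (intro continuous_on_divide continuous_on_add continuous_on_mult continuous_on_diff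
          continuous_on_const) (auto simp: add_pos_pos less_imp_neq[symmetric] add_nonneg_eq_0_iff)
  qed
  fix s :: real assume "s \<in> {0..1} - {1}"
  then have s: "s < 1" by auto
  have "((\<lambda>y. 1 + g * (1 - (1 - y) powr p) / p) has_real_derivative g * (1 - s) powr (p - 1)) (at s)"
    using s p by (auto intro!: derivative_eq_intros)
  from DERIV_cdivide[OF this, of "(1 + g / (p + 1)) powr (1 / q)"]
  show "(extremal p q g has_real_derivative extremal_deriv p q g s) (at s)"
    unfolding extremal_def[abs_def] extremal_deriv_def .
next
  show "extremal_deriv p q g \<in> borel_measurable borel" unfolding extremal_deriv_def[abs_def] by measurable
  fix s :: real assume s: "s \<in> {0..1}"
  have "g * (1 - s) powr (p - 1) \<le> g * 1" using s p g by (intro mult_left_mono powr_le1) auto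
  then show "\<bar>extremal_deriv p q g s\<bar> \<le> g / (1 + g / (p + 1)) powr (1 / q)"
    unfolding extremal_deriv_def using g by (simp add: abs_mult divide_right_mono)
qed auto

lemma piecewise_antideriv_spline:
  shows "piecewise_antideriv (spline q g y) (spline_deriv q g y)"
proof (rule piecewise_antiderivI[where K="{y}" and B="g / (1 + g * y) powr (1 / q)"])
  show "continuous_on {0..1} (spline q g y)" unfolding spline_def[abs_def]
  proof (cases "(1 + g * y) powr (1 / q) = 0")
    case False
    then show "continuous_on {0..1} (\<lambda>x. (1 + g * min x y) / (1 + g * y) powr (1 / q))"
      by (intro continuous_intros) auto
  qed auto
  fix s :: real assume "s \<in> {0..1} - {y}"
  then consider "s < y" | "y < s" by fastforce
  then show "(spline q g y has_real_derivative spline_deriv q g y s) (at s)"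
  proof cases
    case 1
    have "((\<lambda>x. (1 + g * x) / (1 + g * y) powr (1 / q)) has_real_derivative g / (1 + g * y) powr (1 / q)) (at s)"
      by (intro DERIV_cdivide) (auto intro!: derivative_eq_intros)
    then have "(spline q g y has_real_derivative g / (1 + g * y) powr (1 / q)) (at s)"
      by (rule has_field_derivative_transform_within_open[where S="{..<y}"]) (use 1 in \<open>auto simp: spline_def\<close>)
    then show ?thesis using 1 by (simp add: spline_deriv_def)
  next
    case 2
    have "((\<lambda>x. (1 + g * y) / (1 + g * y) powr (1 / q)) has_real_derivative 0) (at s)" by simp
    then have "(spline q g y has_real_derivative 0) (at s)"
      by (rule has_field_derivative_transform_within_open[where S="{y<..}"]) (use 2 in \<open>auto simp: spline_def\<close>)
    then show ?thesis using 2 by (simp add: spline_deriv_def)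
  qed
next
  show "spline_deriv q g y \<in> borel_measurable borel" unfolding spline_deriv_def[abs_def] by measurable
qed (use g in \<open>auto simp: spline_deriv_def\<close>)

text \<open>By p q = p + q the total exponent -q/2 + p q/2 equals p/2. This is how the weights -q/2
  of the norm and p/2 of the discrepancy correspond under duality.\<close>

lemma weight_powr:
  assumes "0 < (w::real)" "g = w powr (p / 2)"
  shows "w powr (- (q / 2)) * g powr q = g"
proof -
  have "w powr (- (q / 2)) * g powr q = w powr (- (q / 2) + p / 2 * q)"
    using assms by (simp add: powr_powr flip: powr_add)
  also have "- (q / 2) + p / 2 * q = p / 2" using conjugate_exponents(1) by (simp add: field_simps)
  finally show ?thesis using assms by simp
qed

lemma extremal_norm:
  assumes "0 < w" "g = w powr (p / 2)"
  shows "w powr (- (q / 2)) * (LINT s:{0..1}|lborel. \<bar>extremal_deriv p q g s\<bar> powr q) + \<bar>extremal p q g 0\<bar> powr q = 1"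
proof -
  define c where "c = 1 + g / (p + 1)"
  have c: "0 < c" using g p by (simp add: c_def add_pos_nonneg)
  have cq: "(c powr (1 / q)) powr q = c" using c q by (simp add: powr_powr)
  have "\<bar>extremal_deriv p q g s\<bar> powr q = g powr q / c * (1 - s) powr p" if "s \<in> {0..1}" for s
  proof -
    have "\<bar>extremal_deriv p q g s\<bar> powr q = (g * (1 - s) powr (p - 1)) powr q / (c powr (1 / q)) powr q"
      unfolding extremal_deriv_def c_def[symmetric] using g by (simp add: abs_mult powr_divide)
    also have "\<dots> = g powr q * ((1 - s) powr (p - 1)) powr q / c" using g by (simp add: powr_mult cq)
    also have "((1 - s) powr (p - 1)) powr q = (1 - s) powr p" by (simp add: powr_powr conjugate_exponents)
    finally show ?thesis by simp
  qed
  then have "(LINT s:{0..1}|lborel. \<bar>extremal_deriv p q g s\<bar> powr q) = (LINT s:{0..1}|lborel. g powr q / c * (1 - s) powr p)"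
    by (intro set_lebesgue_integral_cong) auto
  also have "\<dots> = g powr q / c * (1 / (p + 1))" using p by (simp add: set_integral_one_minus_powr)
  finally have "w powr (- (q / 2)) * (LINT s:{0..1}|lborel. \<bar>extremal_deriv p q g s\<bar> powr q)
      = (w powr (- (q / 2)) * g powr q) / (p + 1) / c" by simp
  also have "\<dots> = g / (p + 1) / c" by (simp only: weight_powr[OF assms])
  finally have 1: "w powr (- (q / 2)) * (LINT s:{0..1}|lborel. \<bar>extremal_deriv p q g s\<bar> powr q) = g / (p + 1) / c" .
  have "\<bar>extremal p q g 0\<bar> powr q = 1 / c"
    unfolding extremal_def c_def[symmetric] using c q by (simp add: powr_divide cq)
  moreover have "g / (p + 1) / c + 1 / c = c / c" unfolding add_divide_distrib[symmetric] by (simp add: c_def add.commute)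
  ultimately show ?thesis unfolding 1 using c by simp
qed

lemma spline_norm:
  assumes "0 < w" "g = w powr (p / 2)" and y: "y \<in> {0..1}"
  shows "w powr (- (q / 2)) * (LINT s:{0..1}|lborel. \<bar>spline_deriv q g y s\<bar> powr q) + \<bar>spline q g y 0\<bar> powr q = 1"
proof -
  define c where "c = 1 + g * y"
  have c: "0 < c" using g y by (simp add: c_def add_pos_nonneg)
  have cq: "(c powr (1 / q)) powr q = c" using c q by (simp add: powr_powr)
  have "(LINT s:{0..1}|lborel. \<bar>spline_deriv q g y s\<bar> powr q) = (LINT s|lborel. indicator {0..<y} s * (g powr q / c))"
    unfolding set_lebesgue_integral_def using y g
    by (intro Bochner_Integration.integral_cong)
      (auto simp: spline_deriv_def c_def[symmetric] indicator_def powr_divide cq)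
  also have "\<dots> = y * (g powr q / c)" using y by simp
  finally have "w powr (- (q / 2)) * (LINT s:{0..1}|lborel. \<bar>spline_deriv q g y s\<bar> powr q)
      = (w powr (- (q / 2)) * g powr q) * y / c" by simp
  also have "\<dots> = g * y / c" by (simp only: weight_powr[OF assms(1,2)])
  finally have 1: "w powr (- (q / 2)) * (LINT s:{0..1}|lborel. \<bar>spline_deriv q g y s\<bar> powr q) = g * y / c" .
  have "\<bar>spline q g y 0\<bar> powr q = 1 / c"
    unfolding spline_def c_def[symmetric] using c q y by (simp add: powr_divide cq)
  moreover have "g * y / c + 1 / c = c / c" unfolding add_divide_distrib[symmetric] by (simp add: c_def add.commute)
  ultimately show ?thesis unfolding 1 using c by simp
qed

lemma integral_extremal: "(LINT s:{0..1}|lborel. extremal p q g s) = (1 + g / (p + 1)) powr (1 / p)"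
proof -
  define c where "c = 1 + g / (p + 1)"
  have c: "0 < c" using g p by (simp add: c_def add_pos_nonneg)
  have i1: "set_integrable lborel {0..1} (\<lambda>s::real. 1 + g / p)" by (rule set_integrable_bounded_interval[where B="\<bar>1 + g / p\<bar>"]) auto
  have i2: "set_integrable lborel {0..1} (\<lambda>s::real. g / p * (1 - s) powr p)"
    using set_integrable_one_minus_powr[of p] p by (intro set_integrable_mult_right) auto
  have "extremal p q g s = (1 / c powr (1 / q)) * ((1 + g / p) - g / p * (1 - s) powr p)" for s
  proof -
    have "1 + g * (1 - (1 - s) powr p) / p = (1 + g / p) - g / p * (1 - s) powr p"
      by (simp add: algebra_simps diff_divide_distrib)
    then show ?thesis by (simp add: extremal_def c_def[symmetric])
  qed
  then have "(LINT s:{0..1}|lborel. extremal p q g s)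
      = (1 / c powr (1 / q)) * (LINT s:{0..1}|lborel. (1 + g / p) - g / p * (1 - s) powr p)" by simp
  also have "(LINT s:{0..1}|lborel. (1 + g / p) - g / p * (1 - s) powr p)
      = (LINT s:{0..1::real}|lborel. 1 + g / p) - (LINT s:{0..1}|lborel. g / p * (1 - s) powr p)"
    by (intro set_integral_diff i1 i2)
  also have "(LINT s:{0..1::real}|lborel. 1 + g / p) = 1 + g / p" by (simp add: set_lebesgue_integral_def)
  also have "(LINT s:{0..1}|lborel. g / p * (1 - s) powr p) = g / p * (1 / (p + 1))"
    using p by (simp add: set_integral_one_minus_powr)
  also have "1 + g / p - g / p * (1 / (p + 1)) = c"
  proof -
    have "g / p - g / p * (1 / (p + 1)) = g / p * (1 - 1 / (p + 1))" by (simp only: right_diff_distrib mult_1_right)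
    also have "1 - 1 / (p + 1) = p / (p + 1)" using p by (simp add: field_simps)
    finally show ?thesis using p by (simp add: c_def)
  qed
  also have "1 / c powr (1 / q) * c = c powr (1 / p)"
  proof -
    have "c powr (1 / p) * c powr (1 / q) = c" using c pq by (simp add: powr_add[symmetric])
    then show ?thesis using c by (simp add: field_simps)
  qed
  finally show ?thesis by (simp add: c_def)
qed

lemma spline_nonneg: "0 \<le> x \<Longrightarrow> 0 \<le> y \<Longrightarrow> 0 \<le> spline q g y x"
  unfolding spline_def using g by (auto intro!: divide_nonneg_nonneg add_nonneg_nonneg)

lemma extremal_nonneg: "y \<in> {0..1} \<Longrightarrow> 0 \<le> extremal p q g y"
  unfolding extremal_def using g p
  by (auto intro!: divide_nonneg_nonneg add_nonneg_nonneg mult_nonneg_nonneg simp: powr_le1)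

text \<open>The p-th root of \<open>spline_inequality\<close> at u = 1 - y: the exponents (p - 1)/p
  become 1/q, and Y powr (1/p) = Y / Y powr (1/q) is the spline at its own knot.\<close>

lemma extremal_le_spline:
  assumes y: "y \<in> {0..1}"
  shows "extremal p q g y \<le> (1 + \<tau> p * g) powr (- (1 / q)) * spline q g y y"
proof -
  define A where "A = 1 + g * (1 - (1 - y) powr p) / p"
  define c where "c = 1 + g / (p + 1)"
  define e where "e = 1 + \<tau> p * g"
  define Y where "Y = 1 + g * y"
  have t: "0 < \<tau> p" by (rule tau_bounds(1)[OF p])
  have c: "0 < c" using g p by (simp add: c_def add_pos_nonneg)
  have e: "0 < e" using g t by (simp add: e_def add_pos_nonneg)
  have Y: "0 < Y" using g y by (simp add: Y_def add_pos_nonneg)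
  have A: "0 < A" using g p y by (auto simp: A_def powr_le1 intro!: add_pos_nonneg divide_nonneg_nonneg mult_nonneg_nonneg)
  have "A powr p * e powr (p - 1) \<le> c powr (p - 1) * Y"
    using spline_inequality[OF p g _ _ less_imp_le[OF t] tau_bounds(2)[OF p], of "1 - y"] y
    by (simp add: A_def e_def c_def Y_def)
  then have "(A powr p * e powr (p - 1)) powr (1 / p) \<le> (c powr (p - 1) * Y) powr (1 / p)"
    using p by (intro powr_mono2) auto
  moreover have pp: "(p - 1) * (1 / p) = 1 / q" using conjugate_exponents(3) p by (simp add: field_simps)
  ultimately have "A * e powr (1 / q) \<le> c powr (1 / q) * Y powr (1 / p)"
    using A e c Y p by (simp add: powr_mult powr_powr pp[simplified])
  then have "A / c powr (1 / q) \<le> e powr (- (1 / q)) * Y powr (1 / p)"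
    using c e by (simp add: powr_minus field_simps)
  also have "Y powr (1 / p) = Y / Y powr (1 / q)" using Y conjugate_exponents(3) by (simp add: powr_diff)
  finally show ?thesis by (simp add: extremal_def spline_def A_def c_def e_def Y_def)
qed

end

subsection \<open>Lower bound for positive rules\<close>

context
  fixes p q :: real and \<gamma> :: "nat \<Rightarrow> real" and d :: nat
  assumes p: "1 < p" and q: "1 < q" and pq: "1 / p + 1 / q = 1"
    and weights: "\<And>j. j \<in> {1..d} \<Longrightarrow> 0 < \<gamma> j \<and> \<gamma> j \<le> 1"
begin

lemma weight_powr_bounds:
  assumes "j \<in> {1..d}"
  shows "0 < \<gamma> j powr (p / 2)" "\<gamma> j powr (p / 2) \<le> 1"
  using weights[OF assms] p by (auto intro!: powr_le1)

lemma initial_disc_pos: "0 < initial_disc p \<gamma> d"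
  unfolding initial_disc_def
proof (rule prod_pos)
  fix j assume "j \<in> {1..d}"
  then have "0 < 1 + \<gamma> j powr (p / 2) / (p + 1)"
    using weight_powr_bounds[of j] p by (intro add_pos_pos divide_pos_pos) auto
  then show "0 < (1 + \<gamma> j powr (p / 2) / (p + 1)) powr (1 / p)" by simp
qed

text \<open>Without nodes the kernel is a product, each coordinate contributing the integral 1 / (p
  + 1) of (1 - s) powr p; the sum over u is then the expansion of the product of the factors 1 + g /
  (p + 1).\<close>

lemma sum_error_kernel_0:
  "(\<Sum>u\<in>Pow {1..d}. (\<Prod>j\<in>u. \<gamma> j) powr (p / 2) *
      (LINT t:unit_cube u|lborel_pi u. \<bar>error_kernel 0 a x u t\<bar> powr p)) = initial_disc p \<gamma> d powr p"
proof -
  have "(\<Prod>j\<in>u. \<gamma> j) powr (p / 2) * (LINT t:unit_cube u|lborel_pi u. \<bar>error_kernel 0 a x u t\<bar> powr p)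
    = (\<Prod>j\<in>u. \<gamma> j powr (p / 2) / (p + 1)) * (\<Prod>j\<in>{1..d} - u. 1)" if "u \<in> Pow {1..d}" for u
  proof -
    have fin: "finite u" using that finite_subset by auto
    have "(LINT t:unit_cube u|lborel_pi u. \<bar>error_kernel 0 a x u t\<bar> powr p)
        = (LINT t:unit_cube u|lborel_pi u. \<Prod>j\<in>u. (1 - t j) powr p)"
      using fin
      by (intro set_lebesgue_integral_cong sets_unit_cube)
        (auto simp: error_kernel_def unit_cube_def PiE_iff abs_prod prod_powr_distrib intro!: prod.cong)
    also have "\<dots> = (\<Prod>j\<in>u. LINT s:{0..1}|lborel. (1 - s) powr p)"
      unfolding unit_cube_def using fin p
      by (intro set_integral_box_prod[where F="\<lambda>j s. (1 - s) powr p"] set_integrable_one_minus_powr) auto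
    also have "\<dots> = (\<Prod>j\<in>u. 1 / (p + 1))" using p by (subst set_integral_one_minus_powr) auto
    finally show ?thesis by (simp only: prod_powr_distrib prod.distrib[symmetric]) simp
  qed
  then have "(\<Sum>u\<in>Pow {1..d}. (\<Prod>j\<in>u. \<gamma> j) powr (p / 2) *
      (LINT t:unit_cube u|lborel_pi u. \<bar>error_kernel 0 a x u t\<bar> powr p))
    = (\<Sum>u\<in>Pow {1..d}. (\<Prod>j\<in>u. \<gamma> j powr (p / 2) / (p + 1)) * (\<Prod>j\<in>{1..d} - u. 1))"
    by (rule sum.cong[OF refl])
  also have "\<dots> = (\<Prod>j\<in>{1..d}. \<gamma> j powr (p / 2) / (p + 1) + 1)"
    by (rule prod_add[symmetric]) simp
  also have "\<dots> = initial_disc p \<gamma> d powr p"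
    unfolding initial_disc_def prod_powr_distrib
  proof (rule prod.cong[OF refl])
    fix j assume "j \<in> {1..d}"
    then have "0 < 1 + \<gamma> j powr (p / 2) / (p + 1)"
      using weight_powr_bounds[of j] p by (intro add_pos_pos divide_pos_pos) auto
    then show "\<gamma> j powr (p / 2) / (p + 1) + 1 = ((1 + \<gamma> j powr (p / 2) / (p + 1)) powr (1 / p)) powr p"
      using p by (simp add: powr_powr add.commute)
  qed
  finally show ?thesis .
qed

text \<open>Without this bound the supremum in \<open>worst_case_error\<close> could not be compared
  with the errors of individual functions.\<close>

lemma worst_case_bdd:
  assumes x: "\<And>k. k \<in> {1..N} \<Longrightarrow> x k \<in> unit_cube {1..d}"
  shows "bdd_above ((\<lambda>f. \<bar>integral_cube d f - linear_rule N a x f\<bar>) ` sobolev_ball q \<gamma> d)"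
proof -
  define T where "T = (\<Sum>u\<in>Pow {1..d}. (\<Prod>j\<in>u. \<gamma> j) powr (p / 2) *
        (LINT t:unit_cube u|lborel_pi u. \<bar>error_kernel N a x u t\<bar> powr p))"
  have T: "0 \<le> T" unfolding T_def set_lebesgue_integral_def
    by (intro sum_nonneg mult_nonneg_nonneg Bochner_Integration.integral_nonneg) auto
  \<comment> \<open>Adding 1 to T keeps the bound positive.\<close>
  have "\<bar>integral_cube d f - linear_rule N a x f\<bar> \<le> (T + 1) powr (1 / p)" if "f \<in> sobolev_ball q \<gamma> d" for f
  proof (rule integration_error_bound[OF q p pq _ that x])
    show "(\<Sum>u\<in>Pow {1..d}. (\<Prod>j\<in>u. \<gamma> j) powr (p / 2) *
        (LINT t:unit_cube u|lborel_pi u. \<bar>error_kernel N a x u t\<bar> powr p)) \<le> ((T + 1) powr (1 / p)) powr p"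
      unfolding T_def[symmetric] using T p by (simp add: powr_powr)
  qed (use weights T in auto)
  then show ?thesis by (intro bdd_aboveI2)
qed

lemma product_in_sobolev_ball:
  assumes pa: "\<And>j. j \<in> {1..d} \<Longrightarrow> piecewise_antideriv (\<phi> j) (\<phi>' j)"
    and norm: "\<And>j. j \<in> {1..d} \<Longrightarrow> \<gamma> j powr (- (q / 2)) * (LINT s:{0..1}|lborel. \<bar>\<phi>' j s\<bar> powr q) + \<bar>\<phi> j 0\<bar> powr q = 1"
  shows "(\<lambda>x. \<Prod>j\<in>{1..d}. \<phi> j (x j)) \<in> sobolev_ball q \<gamma> d"
proof -
  have "(\<lambda>x. \<Prod>j\<in>{1..d}. \<phi> j (x j)) \<in> sobolev q d"
    using pa q by (intro sobolev_product) auto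
  moreover have "sobolev_norm q \<gamma> d (\<lambda>x. \<Prod>j\<in>{1..d}. \<phi> j (x j)) = (\<Prod>j\<in>{1..d}. 1) powr (1 / q)"
    using pa q weights by (subst sobolev_norm_product[where \<phi>'=\<phi>']) (auto simp: norm)
  ultimately show ?thesis by (simp add: sobolev_ball_def)
qed

abbreviation "extremal_prod \<equiv> (\<lambda>x::point. \<Prod>j\<in>{1..d}. extremal p q (\<gamma> j powr (p / 2)) (x j))"

lemma extremal_prod_in_ball: "extremal_prod \<in> sobolev_ball q \<gamma> d"
  using weights weight_powr_bounds
  by (intro product_in_sobolev_ball[where \<phi>'="\<lambda>j. extremal_deriv p q (\<gamma> j powr (p / 2))"]
      piecewise_antideriv_extremal[OF p q pq] extremal_norm[OF p q pq]) auto

lemma integral_extremal_prod: "integral_cube d extremal_prod = initial_disc p \<gamma> d"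
proof -
  have "integral_cube d extremal_prod = (\<Prod>j\<in>{1..d}. LINT s:{0..1}|lborel. extremal p q (\<gamma> j powr (p / 2)) s)"
    using weight_powr_bounds
    by (intro integral_cube_product[where \<phi>'="\<lambda>j. extremal_deriv p q (\<gamma> j powr (p / 2))"]
      piecewise_antideriv_extremal[OF p q pq])
  also have "\<dots> = initial_disc p \<gamma> d"
    unfolding initial_disc_def using weight_powr_bounds
    by (intro prod.cong refl integral_extremal[OF p q pq])
  finally show ?thesis .
qed

lemma spline_prod_in_ball:
  assumes y: "y \<in> unit_cube {1..d}"
  shows "(\<lambda>x. \<Prod>j\<in>{1..d}. spline q (\<gamma> j powr (p / 2)) (y j) (x j)) \<in> sobolev_ball q \<gamma> d"
proof (rule product_in_sobolev_ball[where \<phi>'="\<lambda>j. spline_deriv q (\<gamma> j powr (p / 2)) (y j)"])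
  fix j assume j: "j \<in> {1..d}"
  show "piecewise_antideriv (spline q (\<gamma> j powr (p / 2)) (y j)) (spline_deriv q (\<gamma> j powr (p / 2)) (y j))"
    by (rule piecewise_antideriv_spline[OF p q pq weight_powr_bounds[OF j]])
  have "y j \<in> {0..1}" using y j by (auto simp: unit_cube_def)
  then show "\<gamma> j powr - (q / 2) * (LINT s:{0..1}|lborel. \<bar>spline_deriv q (\<gamma> j powr (p / 2)) (y j) s\<bar> powr q) +
      \<bar>spline q (\<gamma> j powr (p / 2)) (y j) 0\<bar> powr q = 1"
    using weights[OF j] by (intro spline_norm[OF p q pq weight_powr_bounds[OF j]]) auto
qed

text \<open>The integral is the error of the rule with N = 0, whose kernel norm is
  \<open>initial_disc\<close> by \<open>sum_error_kernel_0\<close>.\<close>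

lemma abs_integral_le: "f \<in> sobolev_ball q \<gamma> d \<Longrightarrow> \<bar>integral_cube d f\<bar> \<le> initial_disc p \<gamma> d"
  using integration_error_bound[OF q p pq, where N=0 and S="initial_disc p \<gamma> d" and a="\<lambda>_. 0" and x="\<lambda>_ _. 0" and f=f
      and \<gamma>=\<gamma> and d=d, OF _ _ _ initial_disc_pos eq_refl[OF sum_error_kernel_0]] weights
  by (simp add: linear_rule_def)

lemma initial_error_eq: "initial_error q \<gamma> d = initial_disc p \<gamma> d"
  unfolding initial_error_def
proof (rule cSup_eq_maximum)
  have "\<bar>integral_cube d extremal_prod\<bar> = initial_disc p \<gamma> d"
    using initial_disc_pos unfolding integral_extremal_prod by simp
  then show "initial_disc p \<gamma> d \<in> (\<lambda>f. \<bar>integral_cube d f\<bar>) ` sobolev_ball q \<gamma> d"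
    using extremal_prod_in_ball by (metis (no_types, lifting) image_eqI)
qed (use abs_integral_le in auto)

lemma worst_case_error_lower:
  assumes rule: "\<And>k. k \<in> {1..N} \<Longrightarrow> 0 \<le> a k \<and> x k \<in> half_open_cube {1..d}"
  defines "\<rho> \<equiv> \<Prod>j\<in>{1..d}. (1 + \<tau> p * \<gamma> j powr (p / 2)) powr (- (1 / q))"
    and "e \<equiv> worst_case_error q \<gamma> d (linear_rule N a x)"
    and "E \<equiv> initial_disc p \<gamma> d"
  shows "E - e \<le> real N * \<rho> * (E + e)" and "0 \<le> e"
proof -
  have x: "x k \<in> unit_cube {1..d}" if "k \<in> {1..N}" for k
    using rule[OF that] by (fastforce simp: half_open_cube_def unit_cube_def PiE_iff)
  have err: "\<bar>integral_cube d f - linear_rule N a x f\<bar> \<le> e" if "f \<in> sobolev_ball q \<gamma> d" for f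
    unfolding e_def worst_case_error_def by (rule cSUP_upper[OF that worst_case_bdd[OF x]])
  show "0 \<le> e" using err[OF extremal_prod_in_ball] by linarith
  have \<rho>: "0 \<le> \<rho>" unfolding \<rho>_def by (intro prod_nonneg) auto
  have node: "a k * extremal_prod (x k) \<le> \<rho> * (E + e)" if k: "k \<in> {1..N}" for k
  proof -
    define \<Psi> where "\<Psi> = (\<lambda>y::point. \<Prod>j\<in>{1..d}. spline q (\<gamma> j powr (p / 2)) (x k j) (y j))"
    have \<Psi>: "\<Psi> \<in> sobolev_ball q \<gamma> d" unfolding \<Psi>_def by (rule spline_prod_in_ball[OF x[OF k]])
    have "0 \<le> \<Psi> (x i)" if "i \<in> {1..N}" for i
      unfolding \<Psi>_def using x[OF k] x[OF that] weight_powr_bounds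
      by (intro prod_nonneg ballI spline_nonneg[OF p q pq]) (auto simp: unit_cube_def PiE_iff)
    \<comment> \<open>The weights and the values of the spline product at all nodes are nonnegative,
      so a single term is at most the whole rule.\<close>
    then have "a k * \<Psi> (x k) \<le> linear_rule N a x \<Psi>"
      unfolding linear_rule_def using k rule
      by (intro member_le_sum[where f="\<lambda>k. a k * \<Psi> (x k)"]) auto
    also have "\<dots> \<le> E + e" using err[OF \<Psi>] abs_integral_le[OF \<Psi>] unfolding E_def by linarith
    finally have 1: "a k * \<Psi> (x k) \<le> E + e" .
    have "extremal_prod (x k) \<le> (\<Prod>j\<in>{1..d}. (1 + \<tau> p * \<gamma> j powr (p / 2)) powr (- (1 / q)) * spline q (\<gamma> j powr (p / 2)) (x k j) (x k j))"
    proof (rule prod_mono)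
      fix j assume j: "j \<in> {1..d}"
      then have "x k j \<in> {0..1}" using x[OF k] by (auto simp: unit_cube_def)
      then show "0 \<le> extremal p q (\<gamma> j powr (p / 2)) (x k j) \<and> extremal p q (\<gamma> j powr (p / 2)) (x k j) \<le>
          (1 + \<tau> p * \<gamma> j powr (p / 2)) powr (- (1 / q)) * spline q (\<gamma> j powr (p / 2)) (x k j) (x k j)"
        by (intro conjI extremal_nonneg[OF p q pq weight_powr_bounds[OF j]] extremal_le_spline[OF p q pq weight_powr_bounds[OF j]])
    qed
    also have "\<dots> = \<rho> * \<Psi> (x k)" by (simp add: \<rho>_def \<Psi>_def prod.distrib)
    finally have "a k * extremal_prod (x k) \<le> a k * (\<rho> * \<Psi> (x k))"
      using rule[OF k] by (intro mult_left_mono) auto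
    also have "\<dots> = \<rho> * (a k * \<Psi> (x k))" by simp
    also have "\<dots> \<le> \<rho> * (E + e)" using 1 \<rho> by (rule mult_left_mono)
    finally show ?thesis .
  qed
  have "E - e \<le> linear_rule N a x extremal_prod"
    using err[OF extremal_prod_in_ball] unfolding integral_extremal_prod E_def by linarith
  also have "\<dots> \<le> (\<Sum>k=1..N. \<rho> * (E + e))" unfolding linear_rule_def by (intro sum_mono node)
  finally show "E - e \<le> real N * \<rho> * (E + e)" by simp
qed

lemma min_error_lower:
  assumes \<epsilon>: "0 < \<epsilon>" and N: "min_error q \<gamma> N d \<le> \<epsilon> * initial_error q \<gamma> d"
  shows "(1 - 2 * \<epsilon>) * (\<Prod>j\<in>{1..d}. (1 + \<tau> p * \<gamma> j powr (p / 2)) powr (1 / q)) \<le> real N"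
proof -
  define \<rho> where "\<rho> = (\<Prod>j\<in>{1..d}. (1 + \<tau> p * \<gamma> j powr (p / 2)) powr (- (1 / q)))"
  define R where "R = (\<Prod>j\<in>{1..d}. (1 + \<tau> p * \<gamma> j powr (p / 2)) powr (1 / q))"
  define E where "E = initial_disc p \<gamma> d"
  define y where "y = real N * \<rho>"
  have E: "0 < E" unfolding E_def by (rule initial_disc_pos)
  have fac: "0 < 1 + \<tau> p * \<gamma> j powr (p / 2)" for j
    using tau_bounds(1)[OF p] by (intro add_pos_nonneg) auto
  have "\<rho> * R = (\<Prod>j\<in>{1..d}. 1)" unfolding \<rho>_def R_def prod.distrib[symmetric]
    using fac less_imp_neq[OF fac] by (intro prod.cong refl) (simp add: powr_add[symmetric])
  then have \<rho>R: "\<rho> * R = 1" by simp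
  have R0: "0 \<le> R" unfolding R_def by (intro prod_nonneg) auto
  have y0: "0 \<le> y" unfolding y_def \<rho>_def by (intro mult_nonneg_nonneg prod_nonneg) auto
  \<comment> \<open>The infimum need not be attained, so the inequality E - e \<le> y (E + e) is
    solved for e and used as a lower bound valid for every rule.\<close>
  have "E * (1 - y) / (1 + y) \<le> min_error q \<gamma> N d"
    unfolding min_error_def
  proof (rule cInf_greatest)
    show "{worst_case_error q \<gamma> d (linear_rule N a x) |a x. \<forall>k\<in>{1..N}. 0 \<le> a k \<and> x k \<in> half_open_cube {1..d}} \<noteq> {}"
      by (auto intro!: exI[of _ "\<lambda>_. 0"] exI[of _ "\<lambda>_. \<lambda>j\<in>{1..d}. 0"] simp: half_open_cube_def)
    fix e assume "e \<in> {worst_case_error q \<gamma> d (linear_rule N a x) |a x. \<forall>k\<in>{1..N}. 0 \<le> a k \<and> x k \<in> half_open_cube {1..d}}"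
    then obtain a x where e: "e = worst_case_error q \<gamma> d (linear_rule N a x)"
      and r: "\<forall>k\<in>{1..N}. 0 \<le> a k \<and> x k \<in> half_open_cube {1..d}" by auto
    have "E - e \<le> y * (E + e)"
      using worst_case_error_lower(1)[of N a x] r unfolding e y_def \<rho>_def E_def by simp
    then have "E * (1 - y) \<le> e * (1 + y)" by (simp add: algebra_simps)
    then show "E * (1 - y) / (1 + y) \<le> e" using y0 by (simp add: divide_le_eq)
  qed
  then have "E * (1 - y) / (1 + y) \<le> \<epsilon> * E" using N by (simp add: initial_error_eq E_def)
  then have "E * (1 - y) \<le> E * (\<epsilon> * (1 + y))" using y0 by (simp add: divide_le_eq mult_ac)
  then have "1 - y \<le> \<epsilon> * (1 + y)" using E by simp
  then have "1 - \<epsilon> \<le> (1 + \<epsilon>) * y" by (simp add: algebra_simps)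
  moreover have "(1 + \<epsilon>) * (1 - 2 * \<epsilon>) \<le> 1 - \<epsilon>" using \<epsilon> by (simp add: algebra_simps)
  ultimately have "(1 + \<epsilon>) * (1 - 2 * \<epsilon>) \<le> (1 + \<epsilon>) * y" by linarith
  then have "1 - 2 * \<epsilon> \<le> y" using \<epsilon> by simp
  then have "(1 - 2 * \<epsilon>) * R \<le> y * R" using R0 by (rule mult_right_mono)
  also have "\<dots> = real N * (\<rho> * R)" by (simp add: y_def)
  finally have "(1 - 2 * \<epsilon>) * R \<le> real N" by (simp only: \<rho>R mult_1_right)
  then show ?thesis by (simp only: R_def)
qed

end

subsection \<open>Discrepancy and integration error\<close>

definition face_disc :: "point set \<Rightarrow> nat set \<Rightarrow> point \<Rightarrow> real" where
  "face_disc P u t = (\<Sum>y\<in>P. \<Prod>j\<in>u. if y j < t j then 1 else 0) / real (card P) - (\<Prod>j\<in>u. t j)"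

text \<open>Coordinates of t equal to 1 impose no condition on the points, because these lie in the
  half-open cube. What remains is a count over u, written as a sum of products parallel to
  \<open>dominated\<close>, but with strict inequalities.\<close>

lemma local_disc_extend_by:
  assumes u: "u \<subseteq> {1..d}" and P: "P \<subseteq> half_open_cube {1..d}" "finite P"
  shows "local_disc d P (extend_by d u 1 t) = face_disc P u t"
proof -
  have fin: "finite u" using u finite_subset by blast
  have mem: "y \<in> (\<Pi>\<^sub>E j\<in>{1..d}. {0..<extend_by d u 1 t j}) \<longleftrightarrow> (\<forall>j\<in>u. y j < t j)" if "y \<in> P" for y
  proof -
    have y: "y \<in> half_open_cube {1..d}" using that P by blast
    show ?thesis using y u unfolding half_open_cube_def extend_by_def PiE_iff by (auto split: if_splits)
  qed
  have "real (card {y \<in> P. y \<in> (\<Pi>\<^sub>E j\<in>{1..d}. {0..<extend_by d u 1 t j})}) = (\<Sum>y\<in>P. of_bool (\<forall>j\<in>u. y j < t j))"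
  proof -
    have "{y \<in> P. y \<in> (\<Pi>\<^sub>E j\<in>{1..d}. {0..<extend_by d u 1 t j})} = {y \<in> P. \<forall>j\<in>u. y j < t j}"
      using mem by blast
    then show ?thesis using P(2) by (simp add: sum.If_cases of_bool_def Int_def)
  qed
  also have "\<dots> = (\<Sum>y\<in>P. \<Prod>j\<in>u. if y j < t j then 1 else 0)"
    using fin by (intro sum.cong refl) (auto intro!: prod.neutral[symmetric])
  finally have 1: "real (card {y \<in> P. y \<in> (\<Pi>\<^sub>E j\<in>{1..d}. {0..<extend_by d u 1 t j})}) = (\<Sum>y\<in>P. \<Prod>j\<in>u. if y j < t j then 1 else 0)" .
  have "(\<Prod>j\<in>{1..d}. extend_by d u 1 t j) = (\<Prod>j\<in>{1..d} - u. 1) * (\<Prod>j\<in>u. t j)"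
    using u by (subst prod.subset_diff[OF u]) (auto simp: extend_by_def subset_iff)
  then show ?thesis unfolding local_disc_def face_disc_def 1 by simp
qed

lemma measurable_face_disc:
  "finite P \<Longrightarrow> face_disc P u \<in> borel_measurable (lborel_pi u)"
  unfolding face_disc_def
proof (intro borel_measurable_diff borel_measurable_divide borel_measurable_prod borel_measurable_sum
    borel_measurable_const component_borel)
  fix y :: point and j assume "j \<in> u"
  then have [measurable]: "(\<lambda>t. t j) \<in> borel_measurable (lborel_pi u)" by (rule component_borel)
  show "(\<lambda>t. if y j < t j then 1 else 0 :: real) \<in> borel_measurable (lborel_pi u)" by measurable
qed auto

text \<open>The discrepancy omits u = {}, whereas the kernel norm includes it. The two sums agree
  because \<open>face_disc\<close> vanishes there: card P / card P - 1 = 0 for nonempty P.\<close>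

lemma weighted_disc_eq:
  assumes p: "1 < p" and P: "P \<subseteq> half_open_cube {1..d}" "finite P" "P \<noteq> {}"
  shows "weighted_disc p \<gamma> d P = (\<Sum>u\<in>Pow {1..d}. (\<Prod>j\<in>u. \<gamma> j) powr (p / 2) *
        (LINT t:unit_cube u|lborel_pi u. \<bar>face_disc P u t\<bar> powr p)) powr (1 / p)"
proof -
  have "face_disc P {} t = 0" for t using P by (simp add: face_disc_def)
  then have "(\<Sum>u\<in>Pow {1..d}. (\<Prod>j\<in>u. \<gamma> j) powr (p / 2) * (LINT t:unit_cube u|lborel_pi u. \<bar>face_disc P u t\<bar> powr p))
    = (\<Sum>u\<in>Pow {1..d} - {{}}. (\<Prod>j\<in>u. \<gamma> j) powr (p / 2) * (LINT t:unit_cube u|lborel_pi u. \<bar>face_disc P u t\<bar> powr p))"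
    using p by (intro sum.mono_neutral_right) auto
  also have "\<dots> = (\<Sum>u\<in>Pow {1..d} - {{}}. (\<Prod>j\<in>u. \<gamma> j) powr (p / 2) *
        (LINT t:unit_cube u|leb u. \<bar>local_disc d P (extend_by d u 1 t)\<bar> powr p))"
  proof (rule sum.cong[OF refl])
    fix u assume "u \<in> Pow {1..d} - {{}}"
    then have u: "u \<subseteq> {1..d}" by blast
    have fin: "finite u" using u finite_subset by blast
    have "(LINT t:unit_cube u|leb u. \<bar>local_disc d P (extend_by d u 1 t)\<bar> powr p) = (LINT t:unit_cube u|lborel_pi u. \<bar>face_disc P u t\<bar> powr p)"
      unfolding leb_def
    proof (rule set_integral_completion[OF sets_unit_cube[OF fin]])
      show "set_borel_measurable (lborel_pi u) (unit_cube u) (\<lambda>t. \<bar>face_disc P u t\<bar> powr p)"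
        by (intro set_borel_measurableI[OF fin] measurable_abs_powr measurable_face_disc P(2))
    qed (simp add: local_disc_extend_by[OF u P(1,2)])
    then show "(\<Prod>j\<in>u. \<gamma> j) powr (p / 2) * (LINT t:unit_cube u|lborel_pi u. \<bar>face_disc P u t\<bar> powr p)
      = (\<Prod>j\<in>u. \<gamma> j) powr (p / 2) * (LINT t:unit_cube u|leb u. \<bar>local_disc d P (extend_by d u 1 t)\<bar> powr p)" by simp
  qed
  finally show ?thesis unfolding weighted_disc_def by simp
qed

text \<open>The reflected nodes \<open>1 - y\<close> may have coordinates equal to \<open>1\<close>, which is not allowed; shrinking
  them towards \<open>0\<close> also turns the non-strict inequality in \<open>dominated\<close> into a strict one in the limit.\<close>

lemma tendsto_dominated_reflect:
  assumes "finite u" and y: "\<And>j. j \<in> u \<Longrightarrow> y j < 1"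
    and x: "\<And>n j. j \<in> u \<Longrightarrow> x n j = (1 - 1 / real (n + 2)) * (1 - y j)"
  shows "(\<lambda>n. dominated u t (x n)) \<longlonglongrightarrow> (\<Prod>j\<in>u. if y j < 1 - t j then 1 else 0)"
  unfolding dominated_def
proof (rule tendsto_prod)
  fix j assume j: "j \<in> u"
  have lim: "(\<lambda>n. x n j) \<longlonglongrightarrow> 1 - y j"
  proof -
    have "(\<lambda>n. (1 - 1 / real (n + 2)) * (1 - y j)) \<longlonglongrightarrow> (1 - 0) * (1 - y j)"
      using LIMSEQ_ignore_initial_segment[OF lim_1_over_n, of 2] by (intro tendsto_intros) auto
    then show ?thesis using x[OF j] by simp
  qed
  have lt: "x n j < 1 - y j" for n
  proof -
    have "(1 - 1 / real (n + 2)) * (1 - y j) < 1 * (1 - y j)"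
      using y[OF j] by (intro mult_strict_right_mono) auto
    then show ?thesis by (simp only: x[OF j] mult_1_left)
  qed
  show "(\<lambda>n. if t j \<le> x n j then 1 else 0 :: real) \<longlonglongrightarrow> (if y j < 1 - t j then 1 else 0)"
  proof (rule tendsto_eventually)
    show "\<forall>\<^sub>F n in sequentially. (if t j \<le> x n j then 1 else 0 :: real) = (if y j < 1 - t j then 1 else 0)"
    proof (cases "y j < 1 - t j")
      case True
      then have "\<forall>\<^sub>F n in sequentially. t j < x n j" using order_tendstoD(1)[OF lim, of "t j"] by simp
      then show ?thesis by eventually_elim (use True in auto)
    next
      case False
      then have "\<not> t j \<le> x n j" for n using lt[of n] by linarith
      then show ?thesis using False by simp
    qed
  qed
qed

context
  fixes p q :: real and \<gamma> :: "nat \<Rightarrow> real" and d :: nat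
  assumes p: "1 < p" and q: "1 < q" and pq: "1 / p + 1 / q = 1"
    and weights: "\<And>j. j \<in> {1..d} \<Longrightarrow> 0 < \<gamma> j \<and> \<gamma> j \<le> 1"
begin

lemma worst_case_le:
  assumes x: "\<And>k. k \<in> {1..N} \<Longrightarrow> x k \<in> unit_cube {1..d}" and S: "0 < S"
    and le: "(\<Sum>u\<in>Pow {1..d}. (\<Prod>j\<in>u. \<gamma> j) powr (p / 2) *
        (LINT t:unit_cube u|lborel_pi u. \<bar>error_kernel N a x u t\<bar> powr p)) \<le> S powr p"
  shows "worst_case_error q \<gamma> d (linear_rule N a x) \<le> S"
  unfolding worst_case_error_def
proof (rule cSUP_least)
  show "sobolev_ball q \<gamma> d \<noteq> {}"
    using extremal_prod_in_ball[where \<gamma>=\<gamma> and d=d, OF p q pq weights] by blast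
qed (use integration_error_bound[OF q p pq _ _ x S le] weights in blast)

lemma bdd_below_errors:
  "bdd_below {worst_case_error q \<gamma> d (linear_rule N a x) |a x. \<forall>k\<in>{1..N}. 0 \<le> a k \<and> x k \<in> half_open_cube {1..d}}"
proof (rule bdd_belowI[of _ 0])
  fix e assume "e \<in> {worst_case_error q \<gamma> d (linear_rule N a x) |a x. \<forall>k\<in>{1..N}. 0 \<le> a k \<and> x k \<in> half_open_cube {1..d}}"
  then obtain a x where e: "e = worst_case_error q \<gamma> d (linear_rule N a x)"
    and r: "\<forall>k\<in>{1..N}. 0 \<le> a k \<and> x k \<in> half_open_cube {1..d}" by blast
  show "0 \<le> e" unfolding e
    by (rule worst_case_error_lower(2)[where \<gamma>=\<gamma> and d=d and N=N, OF p q pq weights]) (use r in auto)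
qed

text \<open>The equal-weight rules with shrunken reflected nodes have kernels that converge
  pointwise to minus \<open>face_disc\<close> at the reflected argument. Dominated convergence and
  reflection invariance carry this over to the norms, so the discrepancy is reached up to an
  arbitrary \<eta>.\<close>

lemma min_error_le_weighted_disc:
  assumes P: "P \<subseteq> half_open_cube {1..d}" "finite P" "card P = N" and N: "1 \<le> N"
  shows "min_error q \<gamma> N d \<le> weighted_disc p \<gamma> d P"
proof (rule field_le_epsilon)
  fix \<eta> :: real assume \<eta>: "0 < \<eta>"
  have Pne: "P \<noteq> {}" using P N by auto
  define D where "D = (\<Sum>u\<in>Pow {1..d}. (\<Prod>j\<in>u. \<gamma> j) powr (p / 2) *
        (LINT t:unit_cube u|lborel_pi u. \<bar>face_disc P u t\<bar> powr p))"
  define S where "S = weighted_disc p \<gamma> d P + \<eta>"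
  have D0: "0 \<le> D" unfolding D_def set_lebesgue_integral_def
    by (intro sum_nonneg mult_nonneg_nonneg Bochner_Integration.integral_nonneg) auto
  have wd: "weighted_disc p \<gamma> d P = D powr (1 / p)"
    unfolding D_def by (rule weighted_disc_eq[OF p P(1,2) Pne])
  have S: "0 < S" unfolding S_def wd using \<eta> by (simp add: add_nonneg_pos)
  have "D = (D powr (1 / p)) powr p" using D0 p by (simp add: powr_powr)
  also have "\<dots> < S powr p" unfolding S_def wd using \<eta> p by (intro powr_less_mono2) auto
  \<comment> \<open>Strictness leaves room to replace the limit D by the value at some finite
    n.\<close>
  finally have DS: "D < S powr p" .
  obtain y where y: "bij_betw y {1..N} P"
    using ex_bij_betw_nat_finite_1[OF P(2)] P(3) by auto
  \<comment> \<open>The shift by 2 keeps the contraction factor in [1/2, 1) for every n.\<close>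
  define x where "x = (\<lambda>n k. \<lambda>j\<in>{1..d}. (1 - 1 / real (n + 2)) * (1 - y k j))"
  define K where "K = (\<lambda>n. error_kernel N (\<lambda>_. 1 / real N) (x n))"
  have yP: "y k \<in> P" if "k \<in> {1..N}" for k using y that bij_betwE by blast
  have y01: "0 \<le> y k j" "y k j < 1" if "k \<in> {1..N}" "j \<in> {1..d}" for k j
    using yP[OF that(1)] P(1) that(2) by (auto simp: half_open_cube_def PiE_iff subset_iff)
  have xk: "x n k \<in> half_open_cube {1..d}" if "k \<in> {1..N}" for n k
  proof -
    have "(1 - 1 / real (n + 2)) * (1 - y k j) < 1 * 1" if j: "j \<in> {1..d}" for j
      using y01[OF \<open>k \<in> {1..N}\<close> j] by (intro mult_less_le_imp_less) auto
    moreover have "0 \<le> (1 - 1 / real (n + 2)) * (1 - y k j)" if j: "j \<in> {1..d}" for j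
      using y01[OF \<open>k \<in> {1..N}\<close> j] by (intro mult_nonneg_nonneg) auto
    ultimately show ?thesis by (auto simp: half_open_cube_def x_def)
  qed
  have xk': "x n k \<in> unit_cube {1..d}" if "k \<in> {1..N}" for n k
    using xk[OF that, of n] by (fastforce simp: half_open_cube_def unit_cube_def PiE_iff)
  have lim: "(\<lambda>n. LINT t:unit_cube u|lborel_pi u. \<bar>K n u t\<bar> powr p) \<longlonglongrightarrow>
      (LINT t:unit_cube u|lborel_pi u. \<bar>face_disc P u t\<bar> powr p)" if u: "u \<subseteq> {1..d}" for u
  proof -
    have fin: "finite u" using u finite_subset by blast
    note cube = sets_unit_cube[OF fin]
    let ?r = "\<lambda>t. \<lambda>j\<in>u. 1 - t j"
    have fm: "set_borel_measurable (lborel_pi u) (unit_cube u) (\<lambda>t. \<bar>face_disc P u t\<bar> powr p)"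
      by (intro set_borel_measurableI[OF fin] measurable_abs_powr measurable_face_disc P(2))
    have rm: "(\<lambda>t. face_disc P u (?r t)) \<in> borel_measurable (lborel_pi u)"
      by (rule measurable_compose[OF _ measurable_face_disc[OF P(2)]]) measurable
    have pt: "(\<lambda>n. \<bar>K n u t\<bar> powr p) \<longlonglongrightarrow> \<bar>face_disc P u (?r t)\<bar> powr p" for t
    proof -
      have "(\<lambda>n. K n u t) \<longlonglongrightarrow> (\<Prod>j\<in>u. 1 - t j) - (\<Sum>k=1..N. 1 / real N * (\<Prod>j\<in>u. if y k j < 1 - t j then 1 else 0))"
        unfolding K_def error_kernel_def
      proof (intro tendsto_diff tendsto_const tendsto_sum tendsto_mult)
        fix k assume k: "k \<in> {1..N}"
        show "(\<lambda>n. dominated u t (x n k)) \<longlonglongrightarrow> (\<Prod>j\<in>u. if y k j < 1 - t j then 1 else 0)"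
          using y01[OF k] u by (intro tendsto_dominated_reflect[OF fin]) (auto simp: x_def subset_iff)
      qed
      also have "(\<Prod>j\<in>u. 1 - t j) - (\<Sum>k=1..N. 1 / real N * (\<Prod>j\<in>u. if y k j < 1 - t j then 1 else 0))
          = - face_disc P u (?r t)"
      proof -
        have "(\<Sum>k=1..N. 1 / real N * (\<Prod>j\<in>u. if y k j < 1 - t j then 1 else 0))
          = (\<Sum>k=1..N. (\<Prod>j\<in>u. if y k j < ?r t j then 1 else 0)) / real (card P)"
          unfolding sum_divide_distrib using P(3) by (intro sum.cong refl) simp
        also have "(\<Sum>k=1..N. (\<Prod>j\<in>u. if y k j < ?r t j then 1 else 0)) = (\<Sum>z\<in>P. \<Prod>j\<in>u. if z j < ?r t j then 1 else (0::real))"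
          by (rule sum.reindex_bij_betw[OF y])
        finally show ?thesis by (simp add: face_disc_def)
      qed
      finally have "(\<lambda>n. \<bar>K n u t\<bar>) \<longlonglongrightarrow> \<bar>- face_disc P u (?r t)\<bar>" by (rule tendsto_rabs)
      then show ?thesis using p by (intro tendsto_powr2) auto
    qed
    \<comment> \<open>The weights sum to 1, so the general kernel bound is 1 + 1, uniformly in
      n.\<close>
    have bd: "\<bar>K n u t\<bar> powr p \<le> 2 powr p" if "t \<in> unit_cube u" for n t
    proof -
      have "\<bar>K n u t\<bar> \<le> 1 + (\<Sum>k=1..N. \<bar>1 / real N\<bar>)" unfolding K_def by (rule error_kernel_bound[OF that])
      also have "\<dots> = 2" using N by simp
      finally show ?thesis using p by (intro powr_mono2) auto
    qed
    have "(\<lambda>n. LINT t:unit_cube u|lborel_pi u. \<bar>K n u t\<bar> powr p) \<longlonglongrightarrow>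
      (LINT t:unit_cube u|lborel_pi u. \<bar>face_disc P u (?r t)\<bar> powr p)"
      unfolding set_lebesgue_integral_def
    proof (rule integral_dominated_convergence[where w="\<lambda>t. indicator (unit_cube u) t * 2 powr p"])
      show "(\<lambda>t. indicator (unit_cube u) t *\<^sub>R \<bar>face_disc P u (?r t)\<bar> powr p) \<in> borel_measurable (lborel_pi u)"
        using set_borel_measurableI[OF fin measurable_abs_powr[OF rm]] by (simp add: set_borel_measurable_def)
      show "(\<lambda>t. indicator (unit_cube u) t *\<^sub>R \<bar>K n u t\<bar> powr p) \<in> borel_measurable (lborel_pi u)" for n
        using set_borel_measurableI[OF fin measurable_abs_powr[OF measurable_error_kernel]]
        unfolding K_def by (simp add: set_borel_measurable_def)
      show "integrable (lborel_pi u) (\<lambda>t. indicator (unit_cube u) t * 2 powr p)"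
        using fin cube by (intro integrable_mult_left integrable_real_indicator) (auto simp: emeasure_unit_cube)
      show "AE t in lborel_pi u. (\<lambda>n. indicator (unit_cube u) t *\<^sub>R \<bar>K n u t\<bar> powr p)
          \<longlonglongrightarrow> indicator (unit_cube u) t *\<^sub>R \<bar>face_disc P u (?r t)\<bar> powr p"
        by (intro AE_I2 tendsto_scaleR tendsto_const pt)
      show "AE t in lborel_pi u. norm (indicator (unit_cube u) t *\<^sub>R \<bar>K n u t\<bar> powr p) \<le> indicator (unit_cube u) t * 2 powr p" for n
        using bd by (intro AE_I2) (auto simp: indicator_def)
    qed
    then show ?thesis using set_integral_unit_cube_reflect[OF fin fm] by simp
  qed
  have "(\<lambda>n. \<Sum>u\<in>Pow {1..d}. (\<Prod>j\<in>u. \<gamma> j) powr (p / 2) *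
      (LINT t:unit_cube u|lborel_pi u. \<bar>K n u t\<bar> powr p)) \<longlonglongrightarrow> D"
    unfolding D_def by (intro tendsto_sum tendsto_mult tendsto_const lim) auto
  from order_tendstoD(2)[OF this DS] obtain n where
    n: "(\<Sum>u\<in>Pow {1..d}. (\<Prod>j\<in>u. \<gamma> j) powr (p / 2) * (LINT t:unit_cube u|lborel_pi u. \<bar>K n u t\<bar> powr p)) < S powr p"
    using eventually_happens'[OF sequentially_bot] by blast
  have "min_error q \<gamma> N d \<le> worst_case_error q \<gamma> d (linear_rule N (\<lambda>_. 1 / real N) (x n))"
    unfolding min_error_def
    by (intro cInf_lower[OF _ bdd_below_errors] CollectI exI[of _ "\<lambda>_. 1 / real N"] exI[of _ "x n"]
        conjI refl ballI xk) auto
  also have "\<dots> \<le> S"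
    by (rule worst_case_le[OF xk' S]) (use n in \<open>simp_all add: K_def\<close>)
  finally show "min_error q \<gamma> N d \<le> weighted_disc p \<gamma> d P + \<eta>" by (simp add: S_def)
qed

end

section \<open>Regular grids and the existence of point sets with small discrepancy\<close>

definition grid :: "nat \<Rightarrow> nat \<Rightarrow> point set" where
  "grid d m = (\<Pi>\<^sub>E j\<in>{1..d}. (\<lambda>i. real i / real m) ` {..<m})"

lemma grid_facts:
  assumes "1 \<le> m"
  shows "grid d m \<subseteq> half_open_cube {1..d}" "finite (grid d m)" "card (grid d m) = m ^ d"
proof -
  show "grid d m \<subseteq> half_open_cube {1..d}"
    unfolding grid_def half_open_cube_def by (intro PiE_mono) auto
  show "finite (grid d m)" unfolding grid_def by (intro finite_PiE) auto
  have "inj_on (\<lambda>i. real i / real m) {..<m}" using assms by (intro inj_onI) auto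
  then show "card (grid d m) = m ^ d" unfolding grid_def by (simp add: card_PiE card_image)
qed

lemma grid_count:
  assumes m: "1 \<le> m" and t: "t \<in> {0..1}"
  defines "c \<equiv> (\<Sum>s\<in>(\<lambda>i. real i / real m) ` {..<m}. if s < t then 1 else 0 :: real)"
  shows "\<bar>c / real m - t\<bar> \<le> 1 / real m" and "0 \<le> c" and "c \<le> real m"
proof -
  have inj: "inj_on (\<lambda>i. real i / real m) {..<m}" using m by (intro inj_onI) auto
  have "c = (\<Sum>i<m. if real i / real m < t then 1 else 0)"
    unfolding c_def by (simp add: sum.reindex[OF inj])
  also have "\<dots> = real (card {i\<in>{..<m}. real i / real m < t})"
    by (simp add: sum.If_cases Int_def)
  \<comment> \<open>Indexing starts at 0, so the number of i with i < t m is the ceiling of t m; t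
    \<le> 1 makes the restriction i < m automatic.\<close>
  also have "{i\<in>{..<m}. real i / real m < t} = {..<nat \<lceil>t * real m\<rceil>}"
  proof -
    have "t * real m \<le> real m" using t by (intro mult_left_le_one_le) auto
    then have "real i < real m" if "real i < t * real m" for i using that by linarith
    moreover have "i < nat \<lceil>t * real m\<rceil> \<longleftrightarrow> real i < t * real m" for i
      by (simp add: zless_nat_eq_int_zless less_ceiling_iff)
    ultimately show ?thesis using m by (auto simp: divide_less_eq)
  qed
  finally have c: "c = real (nat \<lceil>t * real m\<rceil>)" by simp
  show "0 \<le> c" by (simp add: c)
  have "0 \<le> t * real m" using t by simp
  then have "t * real m \<le> c" "c < t * real m + 1" unfolding c by linarith+
  then have "\<bar>c - t * real m\<bar> \<le> 1" by linarith
  then have "\<bar>c - t * real m\<bar> / real m \<le> 1 / real m" by (intro divide_right_mono) auto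
  moreover have "\<bar>c - t * real m\<bar> / real m = \<bar>c / real m - t\<bar>"
  proof -
    have "c / real m - t = (c - t * real m) / real m" using m by (simp add: field_simps)
    then show ?thesis by simp
  qed
  ultimately show "\<bar>c / real m - t\<bar> \<le> 1 / real m" by simp
  have "c \<le> (\<Sum>s\<in>(\<lambda>i. real i / real m) ` {..<m}. 1)" unfolding c_def by (intro sum_mono) auto
  then show "c \<le> real m" by (simp add: card_image[OF inj])
qed

text \<open>On a grid the relative count is a product over u of one-dimensional relative counts. Two
  products with factors in [0, 1] differ by at most the sum of the differences of the factors, each
  at most 1/m here.\<close>

lemma face_disc_grid:
  assumes m: "1 \<le> m" and u: "u \<subseteq> {1..d}" and t: "t \<in> unit_cube u"
  shows "\<bar>face_disc (grid d m) u t\<bar> \<le> real d / real m"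
proof -
  let ?G = "(\<lambda>i. real i / real m) ` {..<m}"
  define c where "c = (\<lambda>t. \<Sum>s\<in>?G. if s < t then 1 else 0 :: real)"
  have fin: "finite u" using u finite_subset by blast
  have tj: "t j \<in> {0..1}" if "j \<in> u" for j using t that by (auto simp: unit_cube_def)
  have cardG: "card ?G = m"
    using m by (subst card_image) (auto intro!: inj_onI)
  have "(\<Sum>y\<in>grid d m. \<Prod>j\<in>u. if y j < t j then 1 else 0 :: real)
      = (\<Sum>y\<in>grid d m. \<Prod>j\<in>{1..d}. if j \<in> u then if y j < t j then 1 else 0 else 1)"
  proof (rule sum.cong[OF refl])
    fix y
    show "(\<Prod>j\<in>u. if y j < t j then 1 else 0 :: real) = (\<Prod>j\<in>{1..d}. if j \<in> u then if y j < t j then 1 else 0 else 1)"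
      by (subst prod.subset_diff[OF u]) auto
  qed
  also have "\<dots> = (\<Prod>j\<in>{1..d}. \<Sum>s\<in>?G. if j \<in> u then if s < t j then 1 else 0 else 1)"
    unfolding grid_def by (rule prod_sum_PiE[symmetric]) auto
  also have "\<dots> = (\<Prod>j\<in>{1..d}. if j \<in> u then c (t j) else real m)"
    using cardG by (intro prod.cong refl) (auto simp: c_def)
  also have "\<dots> / real (card (grid d m)) = (\<Prod>j\<in>{1..d}. (if j \<in> u then c (t j) else real m) / real m)"
    by (simp add: grid_facts(3)[OF m] prod_dividef)
  also have "\<dots> = (\<Prod>j\<in>u. c (t j) / real m)"
    using m by (subst prod.subset_diff[OF u]) auto
  finally have "face_disc (grid d m) u t = (\<Prod>j\<in>u. c (t j) / real m) - (\<Prod>j\<in>u. t j)"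
    by (simp add: face_disc_def)
  also have "\<bar>\<dots>\<bar> \<le> (\<Sum>j\<in>u. \<bar>c (t j) / real m - t j\<bar>)"
    using norm_prod_diff[of u "\<lambda>j. c (t j) / real m" t] grid_count(2,3)[OF m tj] tj m
    by (auto simp: c_def)
  also have "\<dots> \<le> (\<Sum>j\<in>u. 1 / real m)"
    unfolding c_def by (intro sum_mono grid_count(1)[OF m tj])
  also have "\<dots> \<le> real d / real m"
    using card_mono[OF _ u] by (simp add: divide_right_mono)
  finally show ?thesis .
qed

text \<open>This provides the witness without which \<open>LEAST\<close> in \<open>N_disc\<close>
  would be arbitrary. Grids with N = m ^ d points suffice, since no rate in N is required.\<close>

lemma min_disc_small:
  assumes p: "1 < p" and \<eta>: "0 < \<eta>"
  shows "\<exists>N\<ge>1. min_disc p \<gamma> N d \<le> \<eta>"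
proof -
  define C where "C = (\<Sum>u\<in>Pow {1..d}. (\<Prod>j\<in>u. \<gamma> j) powr (p / 2))"
  have C: "0 \<le> C" unfolding C_def by (intro sum_nonneg) auto
  \<comment> \<open>m0 may be 0; its successor gives an admissible grid size.\<close>
  obtain m0 where m0: "C powr (1 / p) * real d / \<eta> \<le> real m0" using real_arch_simple by blast
  define m where "m = Suc m0"
  have m: "1 \<le> m" by (simp add: m_def)
  have "C powr (1 / p) * real d / \<eta> \<le> real m" using m0 by (simp add: m_def)
  then have mb: "C powr (1 / p) * (real d / real m) \<le> \<eta>" using \<eta> m by (simp add: field_simps)
  note G = grid_facts[OF m, of d]
  have ne: "grid d m \<noteq> {}" using G(3) m by (metis card.empty less_one not_le power_eq_0_iff)
  have "weighted_disc p \<gamma> d (grid d m) = (\<Sum>u\<in>Pow {1..d}. (\<Prod>j\<in>u. \<gamma> j) powr (p / 2) *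
        (LINT t:unit_cube u|lborel_pi u. \<bar>face_disc (grid d m) u t\<bar> powr p)) powr (1 / p)"
    by (rule weighted_disc_eq[OF p G(1,2) ne])
  also have "\<dots> \<le> (\<Sum>u\<in>Pow {1..d}. (\<Prod>j\<in>u. \<gamma> j) powr (p / 2) * (real d / real m) powr p) powr (1 / p)"
  proof (intro powr_mono2 sum_mono mult_left_mono)
    show "0 \<le> (\<Sum>u\<in>Pow {1..d}. (\<Prod>j\<in>u. \<gamma> j) powr (p / 2) *
        (LINT t:unit_cube u|lborel_pi u. \<bar>face_disc (grid d m) u t\<bar> powr p))"
      unfolding set_lebesgue_integral_def
      by (intro sum_nonneg mult_nonneg_nonneg Bochner_Integration.integral_nonneg) auto
    fix u assume "u \<in> Pow {1..d}"
    then have u: "u \<subseteq> {1..d}" by blast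
    have fin: "finite u" using u finite_subset by blast
    have "(LINT t:unit_cube u|lborel_pi u. \<bar>face_disc (grid d m) u t\<bar> powr p)
        \<le> (LINT t|lborel_pi u. indicator (unit_cube u) t * (real d / real m) powr p)"
      unfolding set_lebesgue_integral_def
    proof (rule integral_mono')
      show "integrable (lborel_pi u) (\<lambda>t. indicator (unit_cube u) t * (real d / real m) powr p)"
        using fin by (intro integrable_mult_left integrable_real_indicator sets_unit_cube) (auto simp: emeasure_unit_cube)
      fix t
      have "\<bar>face_disc (grid d m) u t\<bar> powr p \<le> (real d / real m) powr p" if "t \<in> unit_cube u"
        using p by (intro powr_mono2 face_disc_grid[OF m u that]) auto
      then show "indicat_real (unit_cube u) t *\<^sub>R \<bar>face_disc (grid d m) u t\<bar> powr p
          \<le> indicat_real (unit_cube u) t * (real d / real m) powr p" by (auto simp: indicator_def)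
    qed auto
    also have "\<dots> = (real d / real m) powr p"
      using fin by (simp add: measure_unit_cube Int_absorb2 sets.sets_into_space[OF sets_unit_cube])
    finally show "(LINT t:unit_cube u|lborel_pi u. \<bar>face_disc (grid d m) u t\<bar> powr p) \<le> (real d / real m) powr p" .
  qed (use p in auto)
  also have "\<dots> = (C * (real d / real m) powr p) powr (1 / p)" by (simp add: C_def sum_distrib_right)
  also have "\<dots> = C powr (1 / p) * (real d / real m)" using p C by (simp add: powr_mult powr_powr)
  also have "\<dots> \<le> \<eta>" by (rule mb)
  finally have wd: "weighted_disc p \<gamma> d (grid d m) \<le> \<eta>" .
  have "min_disc p \<gamma> (m ^ d) d \<le> weighted_disc p \<gamma> d (grid d m)"
    unfolding min_disc_def
  proof (rule cInf_lower)
    show "bdd_below {weighted_disc p \<gamma> d P |P. P \<subseteq> half_open_cube {1..d} \<and> finite P \<and> card P = m ^ d}"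
      by (rule bdd_belowI[of _ 0]) (auto simp: weighted_disc_def)
  qed (use G in blast)
  then show ?thesis using wd m by (intro exI[of _ "m ^ d"]) auto
qed

text \<open>This keeps the infimum in \<open>min_disc\<close> from being taken over the empty set.
  For d = 0 the cube is a single point, hence the hypothesis.\<close>

lemma exists_points:
  assumes "1 \<le> d"
  shows "\<exists>P. P \<subseteq> half_open_cube {1..d} \<and> finite P \<and> card P = N"
proof -
  have "infinite (half_open_cube {1..d})"
  proof
    assume fin: "finite (half_open_cube {1..d})"
    have "(\<lambda>s::real. \<lambda>j\<in>{1..d}. s) ` {0..<1} \<subseteq> half_open_cube {1..d}"
      by (auto simp: half_open_cube_def)
    then have "finite ((\<lambda>s::real. \<lambda>j\<in>{1..d}. s) ` {0..<1})" using fin finite_subset by blast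
    moreover have "inj_on (\<lambda>s::real. \<lambda>j\<in>{1..d}. s) {0..<1}"
    proof (rule inj_onI)
      fix a b :: real assume "(\<lambda>j\<in>{1..d}. a) = (\<lambda>j\<in>{1..d}. b)"
      then have "(\<lambda>j\<in>{1..d}. a) 1 = (\<lambda>j\<in>{1..d}. b) 1" by metis
      then show "a = b" using assms by simp
    qed
    ultimately have "finite {0..<1::real}" by (rule finite_imageD)
    then show False using infinite_Ico[of 0 "1::real"] by simp
  qed
  then show ?thesis using infinite_arbitrarily_large by metis
qed

theorem theorem4:
  fixes \<gamma> :: "nat \<Rightarrow> real" and p q :: real
  assumes weights: "\<And>j. 1 \<le> j \<Longrightarrow> 0 < \<gamma> j \<and> \<gamma> j \<le> 1"
    and q: "1 < q"
    and conj_exp: "1 / p + 1 / q = 1"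
  shows "0 < \<tau> p \<and>
    (\<forall>d::nat. \<forall>\<epsilon>::real. 1 \<le> d \<longrightarrow> 0 < \<epsilon> \<longrightarrow> \<epsilon> < 1 / 2 \<longrightarrow>
       N_disc p \<gamma> \<epsilon> d \<ge> N_int q \<gamma> \<epsilon> d \<and>
       real (N_int q \<gamma> \<epsilon> d) \<ge>
         (1 - 2 * \<epsilon>) * (\<Prod>j=1..d. (1 + \<tau> p * \<gamma> j powr (p / 2)) powr (1 / q)))"
proof -
  have "1 / p = 1 - 1 / q" using conj_exp by simp
  moreover have "0 < 1 - 1 / q" "1 - 1 / q < 1" using q by auto
  ultimately have p01: "0 < 1 / p" "1 / p < 1" by auto
  then have p0: "0 < p" by simp
  then have p: "1 < p" using p01 by (simp add: divide_less_eq)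
  have main: "N_disc p \<gamma> \<epsilon> d \<ge> N_int q \<gamma> \<epsilon> d \<and>
       real (N_int q \<gamma> \<epsilon> d) \<ge> (1 - 2 * \<epsilon>) * (\<Prod>j=1..d. (1 + \<tau> p * \<gamma> j powr (p / 2)) powr (1 / q))"
    if d: "1 \<le> d" and \<epsilon>: "0 < \<epsilon>" for d \<epsilon>
  proof -
    have w: "\<And>j. j \<in> {1..d} \<Longrightarrow> 0 < \<gamma> j \<and> \<gamma> j \<le> 1" using weights by auto
    note hyps = p q conj_exp w
    let ?Pd = "\<lambda>N. 1 \<le> N \<and> min_disc p \<gamma> N d \<le> \<epsilon> * initial_disc p \<gamma> d"
    let ?Pi = "\<lambda>N. 1 \<le> N \<and> min_error q \<gamma> N d \<le> \<epsilon> * initial_error q \<gamma> d"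
    have E: "0 < initial_disc p \<gamma> d" by (rule initial_disc_pos[where \<gamma>=\<gamma> and d=d, OF hyps])
    have ee: "initial_error q \<gamma> d = initial_disc p \<gamma> d" by (rule initial_error_eq[where \<gamma>=\<gamma> and d=d, OF hyps])
    have le: "min_error q \<gamma> N d \<le> min_disc p \<gamma> N d" if N: "1 \<le> N" for N
      unfolding min_disc_def
    proof (rule cInf_greatest)
      show "{weighted_disc p \<gamma> d P |P. P \<subseteq> half_open_cube {1..d} \<and> finite P \<and> card P = N} \<noteq> {}"
        using exists_points[OF d, of N] by blast
      fix D assume "D \<in> {weighted_disc p \<gamma> d P |P. P \<subseteq> half_open_cube {1..d} \<and> finite P \<and> card P = N}"
      then obtain P where "D = weighted_disc p \<gamma> d P" "P \<subseteq> half_open_cube {1..d}" "finite P" "card P = N" by blast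
      then show "min_error q \<gamma> N d \<le> D"
        using min_error_le_weighted_disc[where \<gamma>=\<gamma> and d=d and P=P and N=N, OF hyps _ _ _ N] by blast
    qed
    have "\<exists>N. ?Pd N" using min_disc_small[OF p, of "\<epsilon> * initial_disc p \<gamma> d" \<gamma> d] E \<epsilon> by auto
    then have Nd: "?Pd (N_disc p \<gamma> \<epsilon> d)" unfolding N_disc_def by (rule LeastI_ex)
    \<comment> \<open>The initial error and the initial discrepancy coincide, so
      \<open>N_disc\<close> is itself a candidate for \<open>N_int\<close>. This gives both the
      comparison and the existence of the second least element.\<close>
    then have Pi: "?Pi (N_disc p \<gamma> \<epsilon> d)" using le[of "N_disc p \<gamma> \<epsilon> d"] ee by simp
    have "?Pi (N_int q \<gamma> \<epsilon> d)" unfolding N_int_def using Pi by (rule LeastI)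
    then have "(1 - 2 * \<epsilon>) * (\<Prod>j=1..d. (1 + \<tau> p * \<gamma> j powr (p / 2)) powr (1 / q)) \<le> real (N_int q \<gamma> \<epsilon> d)"
      by (intro min_error_lower[where \<gamma>=\<gamma> and d=d, OF hyps \<epsilon>]) auto
    moreover have "N_int q \<gamma> \<epsilon> d \<le> N_disc p \<gamma> \<epsilon> d"
      unfolding N_int_def using Pi by (rule Least_le)
    ultimately show ?thesis by blast
  qed
  then show ?thesis using tau_bounds(1)[OF p] by blast
qed

end
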